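(* Let $r,s\in\mathbb{N}$. There exists a positive integer $t$ depending only on $r,s$ such that the following holds. Let $d,D,H,M,N,V\in\mathbb{N}$ and $\delta>0$ satisfy $d\le r$, $C\delta^{-C'}\le H\le M$ and $H^dMV\le N$, where $C'$ depends only on $r,s$ and $C$ only on $D,r,s$. Let $\mathbf{C}_1,\dots,\mathbf{C}_s\in\mathbb{Z}^D[h_1,\dots,h_r]$ be multilinear polynomials $\mathbf{C}_j(\underline h)=\sum_{\underline u\in\{0,1\}^r}\boldsymbol{\gamma}_{j\underline u}\underline h^{\underline u}$ of degree at most $d$ with all coefficient coordinates at most $V$ in absolute value. Then for all $1$-bounded $f:\mathbb{Z}^D\to\mathbb{C}$ supported on $[N]^D$, the bound $$\mathbb{E}_{\underline h\in[\pm H]^r}\|f\|^{2^s}_{\mathbf{C}_1(\underline h)\cdot[\pm M],\dots,\mathbf{C}_s(\underline h)\cdot[\pm M]}\ge\delta N^D$$ implies $\|f\|^{2^{st}}_{E_1^t,\dots,E_s^t}\ge c\,\delta^{c'}N^D$, where $E_j=\sum_{\underline u\in\{0,1\}^r}\boldsymbol{\gamma}_{j\underline u}\cdot[\pm H^{|\underline u|+1}]$, $c'>0$ depends only on $r,s$, and $c>0$ only on $D,r,s$.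
   Context: Notation: $\underline h^{\underline u}=h_1^{u_1}\cdots h_r^{u_r}$, $|\underline u|=u_1+\dots+u_r$; $[\pm X]$ is the set of integers in $[-X,X]$, $[N]=\{1,\dots,N\}$; $1$-bounded means $|f|\le1$. For $\mathbf{v}\in\mathbb{Z}^D$ and finite $I\subseteq\mathbb{Z}$, $\mathbf{v}\cdot I$ is the multiset $\{\mathbf{v}n:n\in I\}$; sums of multisets are Minkowski sums counted with multiplicity (the multiplicity of $z$ in $X+Y$ is $\#\{(x,y)\in X\times Y:x+y=z\}$). Box norm along finite nonempty multisets: $\|f\|^{2^s}_{E_1,\dots,E_s}=\mathbb{E}_{h_1,h_1'\in E_1}\cdots\mathbb{E}_{h_s,h_s'\in E_s}\sum_{\mathbf{x}}\prod_{\underline\epsilon\in\{0,1\}^s}\mathcal{C}^{|\underline\epsilon|}f(\mathbf{x}+\sum_i((1-\epsilon_i)h_i+\epsilon_ih_i'))$, $\mathcal{C}$ complex conjugation, multiplicities counted; $E^t$ means $E$ repeated $t$ times. *)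

theory Defs
  imports
    "HOL-Analysis.Analysis"
    "HOL-Library.Multiset"
    "HOL-Library.Function_Algebras"
begin

text \<open>
  The dimension \<open>D\<close> is quantified after some of the constants of the theorem and before others,
  so it cannot be a type. \<open>\<int>\<^sup>D\<close> is rendered as the set of integer sequences vanishing outside
  \<open>{..<D}\<close>, with the pointwise addition of \<^theory>\<open>HOL-Library.Function_Algebras\<close>.
\<close>

type_synonym vec = "nat \<Rightarrow> int"

definition zvec :: "nat \<Rightarrow> vec set" where
  "zvec D = {x. \<forall>k\<ge>D. x k = 0}"

definition vscale :: "int \<Rightarrow> vec \<Rightarrow> vec" where
  "vscale n v = (\<lambda>k. n * v k)"

text \<open>\<open>cube r\<close> is \<open>{0,1}\<^sup>r\<close>, with entries indexed by \<open>{..<r}\<close>.\<close>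

definition cube :: "nat \<Rightarrow> (nat \<Rightarrow> nat) set" where
  "cube r = {..<r} \<rightarrow>\<^sub>E {0,1}"

definition weight :: "nat \<Rightarrow> (nat \<Rightarrow> nat) \<Rightarrow> nat" where
  "weight r u = (\<Sum>i<r. u i)"

definition monomial :: "nat \<Rightarrow> (nat \<Rightarrow> int) \<Rightarrow> (nat \<Rightarrow> nat) \<Rightarrow> int" where
  "monomial r h u = (\<Prod>i<r. h i ^ u i)"

definition multilin :: "nat \<Rightarrow> ((nat \<Rightarrow> nat) \<Rightarrow> vec) \<Rightarrow> (nat \<Rightarrow> int) \<Rightarrow> vec" where
  "multilin r \<gamma> h = (\<Sum>u\<in>cube r. vscale (monomial r h u) (\<gamma> u))"

definition pm :: "nat \<Rightarrow> int set" where
  "pm X = {- int X..int X}"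

definition prog :: "vec \<Rightarrow> int set \<Rightarrow> vec multiset" where
  "prog v I = {# vscale n v. n \<in># mset_set I #}"

definition minkowski :: "'a::comm_monoid_add multiset \<Rightarrow> 'a multiset \<Rightarrow> 'a multiset" where
  "minkowski X Y = (\<Sum>x\<in>#X. {# x + y. y \<in># Y #})"

lemma count_minkowski:
  "count (minkowski X Y) z = (\<Sum>x\<in>#X. \<Sum>y\<in>#Y. if x + y = z then 1 else 0)"
proof -
  have "count {# x + y. y \<in># Y #} z = (\<Sum>y\<in>#Y. if x + y = z then 1 else 0)" for x
    by (induction Y) auto
  then show ?thesis
    unfolding minkowski_def by (induction X) auto
qed

lemma minkowski_empty [simp]: "minkowski {#} Y = {#}"
  by (simp add: minkowski_def)

lemma minkowski_add_mset [simp]: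
  "minkowski (add_mset x X) Y = {# x + y. y \<in># Y #} + minkowski X Y"
  by (simp add: minkowski_def)

lemma minkowski_plus: "minkowski (X + X') Y = minkowski X Y + minkowski X' Y"
  by (simp add: minkowski_def)

lemma minkowski_image:
  "minkowski {# x + y. y \<in># Y #} Z = {# x + z. z \<in># minkowski Y Z #}"
  by (induction Y) (simp_all add: multiset.map_comp comp_def add.assoc)

lemma minkowski_assoc: "minkowski (minkowski X Y) Z = minkowski X (minkowski Y Z)"
  by (induction X) (simp_all add: minkowski_plus minkowski_image)

lemma minkowski_empty_right [simp]: "minkowski X {#} = {#}"
  by (induction X) simp_all

lemma minkowski_add_mset_right:
  "minkowski X (add_mset y Y) = {# x + y. x \<in># X #} + minkowski X Y"
  by (induction X) simp_all

lemma minkowski_commute: "minkowski X Y = minkowski Y X"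
  by (induction X) (simp_all add: minkowski_add_mset_right add.commute)

text \<open>\<open>minkowski_sum.F E A\<close> is the Minkowski sum of the multisets \<open>E a\<close> over \<open>a \<in> A\<close>.\<close>

global_interpretation minkowski_sum: comm_monoid_set minkowski "{#0::'a::comm_monoid_add#}"
  by (unfold_locales; (rule minkowski_assoc | rule minkowski_commute | simp add: minkowski_add_mset_right))

definition mexpect :: "'a multiset \<Rightarrow> ('a \<Rightarrow> complex) \<Rightarrow> complex" where
  "mexpect E g = (\<Sum>x\<in>#E. g x) / of_nat (size E)"

text \<open>
  \<open>iexpect [E\<^sub>1, \<dots>, E\<^sub>s] g\<close> is the iterated average over \<open>h\<^sub>i, h\<^sub>i' \<in> E\<^sub>i\<close> of
  \<open>g [(h\<^sub>1, h\<^sub>1'), \<dots>, (h\<^sub>s, h\<^sub>s')]\<close>.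
\<close>

fun iexpect :: "'a multiset list \<Rightarrow> (('a \<times> 'a) list \<Rightarrow> complex) \<Rightarrow> complex" where
  "iexpect [] g = g []"
| "iexpect (E # Es) g =
     mexpect E (\<lambda>h. mexpect E (\<lambda>h'. iexpect Es (\<lambda>ps. g ((h, h') # ps))))"

text \<open>
  \<open>boxpow D [E\<^sub>1, \<dots>, E\<^sub>s] f\<close> is the \<open>2\<^sup>s\<close>-th power of the box norm of \<open>f\<close> along
  \<open>E\<^sub>1, \<dots>, E\<^sub>s\<close>. For \<open>s \<ge> 1\<close> and finitely supported \<open>f\<close> the average is a nonnegative real
  number, and the real part only converts it to type \<^typ>\<open>real\<close>.
\<close>

definition boxpow :: "nat \<Rightarrow> vec multiset list \<Rightarrow> (vec \<Rightarrow> complex) \<Rightarrow> real" where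
  "boxpow D Es f = Re (iexpect Es (\<lambda>ps. \<Sum>\<^sub>\<infinity>x\<in>zvec D.
     \<Prod>\<epsilon>\<in>cube (length Es). (cnj ^^ weight (length Es) \<epsilon>)
       (f (x + (\<Sum>i<length Es. vscale (1 - int (\<epsilon> i)) (fst (ps ! i))
                              + vscale (int (\<epsilon> i)) (snd (ps ! i)))))))"

end

theory Submission
  imports Defs
begin

text \<open>
  The variables \<open>h\<^sub>1, \<dots>, h\<^sub>r\<close> are treated one at a time, and for each of them the \<open>s\<close> directions
  are treated one at a time. Repeated Cauchy--Schwarz turns an average over \<open>h\<close> of box norms along
  \<open>X(h), Y\<^sub>1(h), \<dots>, Y\<^sub>m(h)\<close> into an average over \<open>h, h'\<close> of box norms along
  \<open>X(h) + X(h')\<close>, the \<open>Y\<^sub>i(h)\<close> and the \<open>Y\<^sub>i(h')\<close>; directions not depending on \<open>h\<close> need not be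
  duplicated, because one can apply this to multiplicative derivatives of \<open>f\<close> along them. Hence every
  direction ends up depending on fewer variables. After two steps one has
  \<open>X(h\<^sub>1) + \<dots> + X(h\<^sub>4)\<close>; for \<open>X(h) = (v + h w) \<sqdot> [\<plusminus>L]\<close> and most \<open>h\<^sub>1, \<dots>, h\<^sub>4\<close> this multiset has
  multiplicities comparable to those of \<open>v \<sqdot> [\<plusminus>L] + w \<sqdot> [\<plusminus>HL]\<close>, since the linear form
  \<open>(h\<^sub>1 - h\<^sub>3) n\<^sub>1 + (h\<^sub>2 - h\<^sub>3) n\<^sub>2\<close> has few repeated values when \<open>h\<^sub>2 - h\<^sub>3\<close> is large and
  \<open>gcd (h\<^sub>1 - h\<^sub>3, h\<^sub>2 - h\<^sub>3)\<close> is small. Comparing multiplicities suffices to replace the one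
  multiset by the other at the cost of one extra copy of the new direction, because a box norm with at
  least one further direction is an average of nonnegative terms. These extra copies, and the
  padding to equal numbers of copies, are where \<open>t\<close> comes from.
\<close>


section \<open>Averages over multisets and sums of finitely supported functions\<close>

text \<open>Why the comparison needs three summands: (v + h w)\<sqdot>[-L, L] has about L elements,
  its target v\<sqdot>[-L, L] + w\<sqdot>[-HL, HL] about H L^2. Two summands give only L^2 elements,
  too few for the target; three give L^3, so multiplicities of order L / H, which is a sensible
  bound only for L \<ge> H. Hence every interval length is a positive power of H, starting from
  [-H, H]. Concatenation doubles the number of summands, so four is the first available count.
  Degenerate triples are discarded at a density \<eta> proportional to the current average. As the
  loss is polynomial in 1/\<eta>, this only raises the power of the average. The dimension must stay
  out of the exponents. All box norms are therefore divided by one T that bounds the support of f as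
  well as its enlargement by each new direction. The inequalities then relate numbers in [0, 1],
  with constants depending on r and s, and D enters only through T / N^D = (2R+3)^D, where R = 4^r.
  The hypothesis H^d M V \<le> N makes this T available.\<close>

definition avg :: "'b multiset \<Rightarrow> ('b \<Rightarrow> 'c::real_vector) \<Rightarrow> 'c" where
  "avg E g = (\<Sum>x\<in>#E. g x) /\<^sub>R real (size E)"

lemma mexpect_eq_avg: "mexpect E g = avg E g"
  by (simp add: mexpect_def avg_def scaleR_conv_of_real divide_inverse mult.commute of_real_inverse)

lemma avg_cong: "(\<And>x. x \<in># E \<Longrightarrow> g x = h x) \<Longrightarrow> avg E g = avg E h"
  unfolding avg_def by (metis image_mset_cong)

lemma avg_empty [simp]: "avg {#} g = 0"
  by (simp add: avg_def)

lemma sum_mset_const: "(\<Sum>x\<in>#E. c) = real (size E) *\<^sub>R (c::'c::real_vector)"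
  by (induction E) (simp_all add: algebra_simps)

lemma avg_const: "E \<noteq> {#} \<Longrightarrow> avg E (\<lambda>_. c) = c"
  by (simp add: avg_def sum_mset_const)

lemma avg_add: "avg E (\<lambda>x. g x + h x) = avg E g + avg E h"
  by (simp add: avg_def sum_mset.distrib scaleR_add_right)

lemma avg_mult_left: "c * avg E g = avg E (\<lambda>x. c * g x)" for g :: "_ \<Rightarrow> 'c::real_algebra"
  by (simp add: avg_def sum_mset_distrib_left)

lemma avg_mult_right: "avg E g * c = avg E (\<lambda>x. g x * c)" for g :: "_ \<Rightarrow> 'c::real_algebra"
  by (simp add: avg_def sum_mset_distrib_right)

lemma avg_mono: "(\<And>x. x \<in># E \<Longrightarrow> g x \<le> h x) \<Longrightarrow> avg E g \<le> (avg E h :: real)"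
  unfolding avg_def by (simp add: mult_left_mono sum_mset_mono)

lemma avg_nonneg: "(\<And>x. x \<in># E \<Longrightarrow> g x \<ge> 0) \<Longrightarrow> (avg E g :: real) \<ge> 0"
  using avg_mono[of E "\<lambda>_. 0" g] by (simp add: avg_def)

lemma avg_le_const: "(\<And>x. x \<in># E \<Longrightarrow> g x \<le> c) \<Longrightarrow> 0 \<le> c \<Longrightarrow> (avg E g :: real) \<le> c"
  using avg_mono[of E g "\<lambda>_. c"] by (cases "E = {#}") (auto simp: avg_const)

lemma avg_bounded_linear:
  assumes "bounded_linear F" shows "F (avg E g) = avg E (\<lambda>x. F (g x))"
proof -
  interpret bounded_linear F by fact
  have "F (\<Sum>x\<in>#E. g x) = (\<Sum>x\<in>#E. F (g x))"
    by (induction E) (simp_all add: add)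
  then show ?thesis by (simp add: avg_def scaleR)
qed

lemmas Re_avg = avg_bounded_linear[OF bounded_linear_Re]
lemmas cnj_avg = avg_bounded_linear[OF bounded_linear_cnj]
lemmas of_real_avg = avg_bounded_linear[OF bounded_linear_of_real]

lemma norm_avg_le: "norm (avg E g) \<le> avg E (\<lambda>x. norm (g x))"
proof -
  have "norm (\<Sum>x\<in>#E. g x) \<le> (\<Sum>x\<in>#E. norm (g x))"
    by (induction E) (auto intro: norm_triangle_le)
  then show ?thesis by (simp add: avg_def mult_left_mono)
qed

lemma sum_mset_scaleR: "c *\<^sub>R (\<Sum>x\<in>#E. g x) = (\<Sum>x\<in>#E. c *\<^sub>R (g x :: 'c::real_vector))"
  by (induction E) (simp_all add: scaleR_add_right)

lemma avg_swap: "avg A (\<lambda>a. avg B (\<lambda>b. g a b)) = avg B (\<lambda>b. avg A (\<lambda>a. g a b))"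
  unfolding avg_def by (simp add: sum_mset_scaleR[symmetric], subst sum_mset.swap) (simp add: mult.commute)

lemma avg_image: "avg (image_mset f A) g = avg A (\<lambda>x. g (f x))"
  by (simp add: avg_def multiset.map_comp comp_def)

lemma sum_mset_minkowski:
  "(\<Sum>z\<in>#minkowski X Y. g z) = (\<Sum>x\<in>#X. \<Sum>y\<in>#Y. g (x + y))"
  by (induction X) (simp_all add: multiset.map_comp comp_def)

lemma size_minkowski [simp]: "size (minkowski X Y) = size X * size Y"
  by (induction X) simp_all

lemma avg_minkowski: "avg (minkowski X Y) g = avg X (\<lambda>x. avg Y (\<lambda>y. g (x + y)))"
  by (simp add: avg_def sum_mset_minkowski sum_mset_scaleR[symmetric] mult.commute)

definition mtimes :: "'a multiset \<Rightarrow> 'b multiset \<Rightarrow> ('a \<times> 'b) multiset" where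
  "mtimes A B = (\<Sum>a\<in>#A. image_mset (Pair a) B)"

lemma sum_mset_mtimes: "(\<Sum>z\<in>#mtimes A B. g z) = (\<Sum>a\<in>#A. \<Sum>b\<in>#B. g (a, b))"
  by (induction A) (simp_all add: mtimes_def multiset.map_comp comp_def)

lemma size_mtimes [simp]: "size (mtimes A B) = size A * size B"
  by (induction A) (simp_all add: mtimes_def)

lemma set_mtimes [simp]: "set_mset (mtimes A B) = set_mset A \<times> set_mset B"
  by (induction A) (auto simp: mtimes_def)

lemma avg_mtimes: "avg (mtimes A B) g = avg A (\<lambda>a. avg B (\<lambda>b. g (a, b)))"
  by (simp add: avg_def sum_mset_mtimes sum_mset_scaleR[symmetric] mult.commute)

lemma avg_mset_set: "finite A \<Longrightarrow> avg (mset_set A) g = (\<Sum>x\<in>A. g x) /\<^sub>R real (card A)"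
  by (simp add: avg_def sum_unfold_sum_mset)

text \<open>Convexity: the graph of the power lies above its tangent at y. In the induction step the
  excess is exactly p y^(p-1) (x-y)^2.\<close>

lemma power_tangent:
  fixes x y :: real
  assumes "x \<ge> 0" "y \<ge> 0"
  shows "x ^ p \<ge> y ^ p + real p * y ^ (p - 1) * (x - y)"
proof (induction p)
  case (Suc p)
  have "x ^ Suc p \<ge> x * (y ^ p + real p * y ^ (p - 1) * (x - y))"
    using mult_left_mono[OF Suc assms(1)] by simp
  moreover have "x * (y ^ p + real p * y ^ (p - 1) * (x - y))
      = y ^ Suc p + real (Suc p) * y ^ (Suc p - 1) * (x - y) + real p * y ^ (p - 1) * (x - y)\<^sup>2"
    by (cases p) (simp_all add: algebra_simps power2_eq_square)
  moreover have "real p * y ^ (p - 1) * (x - y)\<^sup>2 \<ge> 0" using assms by simp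
  ultimately show ?case by linarith
qed simp

text \<open>Jensen's inequality: with the tangent taken at the mean y, the linear term averages to
  zero.\<close>

lemma avg_power_le:
  fixes g :: "_ \<Rightarrow> real"
  assumes "\<And>x. x \<in># E \<Longrightarrow> g x \<ge> 0" "p \<ge> 1"
  shows "avg E g ^ p \<le> avg E (\<lambda>x. g x ^ p)"
proof (cases "E = {#}")
  case False
  define y where "y = avg E g"
  have y: "y \<ge> 0" unfolding y_def using assms by (intro avg_nonneg)
  have "y ^ p + real p * y ^ (p - 1) * (avg E g + - y)
      = avg E (\<lambda>x. y ^ p + real p * y ^ (p - 1) * (g x + - y))"
    by (simp only: avg_add avg_const[OF False] avg_mult_left[symmetric])
  also have "\<dots> \<le> avg E (\<lambda>x. g x ^ p)"
    using power_tangent[OF assms(1) y] by (intro avg_mono) simp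
  finally show ?thesis by (simp add: y_def)
qed (use assms in \<open>simp add: zero_power\<close>)

lemma norm_avg_power_le:
  assumes "p \<ge> 1"
  shows "norm (avg E g) ^ p \<le> avg E (\<lambda>x. norm (g x) ^ p)"
  using power_mono[OF norm_avg_le norm_ge_zero, of E g p] avg_power_le[of E "\<lambda>x. norm (g x)" p] assms
  by fastforce

section \<open>Sums over finite supports and the squared l2 norm\<close>

definition total :: "('a \<Rightarrow> 'c::real_normed_vector) \<Rightarrow> 'c" where
  "total g = sum g {z. g z \<noteq> 0}"

abbreviation finsupp :: "('a \<Rightarrow> 'c::zero) \<Rightarrow> bool" where
  "finsupp g \<equiv> finite {z. g z \<noteq> 0}"

lemma total_superset: "finite A \<Longrightarrow> {z. g z \<noteq> 0} \<subseteq> A \<Longrightarrow> total g = sum g A"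
  unfolding total_def by (rule sum.mono_neutral_left) auto

lemma finsupp_subset: "finsupp g \<Longrightarrow> (\<And>z. f z \<noteq> 0 \<Longrightarrow> g z \<noteq> 0) \<Longrightarrow> finsupp f"
  by (rule finite_subset) auto

lemma shift_support: "{z. g (z + a) \<noteq> 0} = (\<lambda>z. z - a) ` {z. g z \<noteq> (0::'c::zero)}" for a :: "'a::ab_group_add"
  by (auto simp: image_iff intro!: exI[of _ "_ + a"]) 

lemma finsupp_shift: "finsupp g \<Longrightarrow> finsupp (\<lambda>z. g (z + a))" for a :: "'a::ab_group_add"
  unfolding shift_support by simp

lemma card_shift: "card {z. g (z + a) \<noteq> (0::'c::zero)} = card {z. g z \<noteq> 0}" for a :: "'a::ab_group_add"
  unfolding shift_support by (intro card_image inj_onI) simp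

lemma total_shift: "total (\<lambda>z. g (z + a)) = total g" for a :: "'a::ab_group_add"
  unfolding total_def shift_support
  by (subst sum.reindex) (auto intro: inj_onI)

lemma avg_zero: "(\<And>i. i \<in># I \<Longrightarrow> g i = 0) \<Longrightarrow> avg I g = 0"
  unfolding avg_def by (subst sum_mset.neutral) auto

lemma avg_support: "{z. avg I (\<lambda>i. g i z) \<noteq> 0} \<subseteq> (\<Union>i\<in>set_mset I. {z. g i z \<noteq> 0})"
proof -
  have "\<exists>i\<in>#I. g i z \<noteq> 0" if "avg I (\<lambda>i. g i z) \<noteq> 0" for z
    using that avg_zero[of I "\<lambda>i. g i z"] by auto
  then show ?thesis by auto
qed

lemma finsupp_avg: "(\<And>i. i \<in># I \<Longrightarrow> finsupp (g i)) \<Longrightarrow> finsupp (\<lambda>z. avg I (\<lambda>i. g i z))"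
  by (rule finite_subset[OF avg_support]) auto

lemma total_avg:
  assumes "\<And>i. i \<in># I \<Longrightarrow> finsupp (g i)"
  shows "total (\<lambda>z. avg I (\<lambda>i. g i z)) = avg I (\<lambda>i. total (g i))"
proof -
  define A where "A = (\<Union>i\<in>set_mset I. {z. g i z \<noteq> 0})"
  have A: "finite A" unfolding A_def using assms by auto
  have "total (\<lambda>z. avg I (\<lambda>i. g i z)) = (\<Sum>z\<in>A. avg I (\<lambda>i. g i z))"
    by (rule total_superset[OF A]) (unfold A_def, rule avg_support)
  also have "\<dots> = avg I (\<lambda>i. \<Sum>z\<in>A. g i z)"
    unfolding avg_def sum_unfold_sum_mset
    by (subst sum_mset.swap) (simp add: sum_mset_scaleR)
  also have "\<dots> = avg I (\<lambda>i. total (g i))"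
    by (intro avg_cong total_superset[OF A, symmetric]) (auto simp: A_def)
  finally show ?thesis .
qed

lemma total_mono:
  fixes g h :: "_ \<Rightarrow> real"
  assumes "finsupp g" "finsupp h" "\<And>z. g z \<le> h z" shows "total g \<le> total h"
proof -
  define A where "A = {z. g z \<noteq> 0} \<union> {z. h z \<noteq> 0}"
  have A: "finite A" using assms by (simp add: A_def)
  have "total g = sum g A" by (rule total_superset[OF A]) (auto simp: A_def)
  moreover have "total h = sum h A" by (rule total_superset[OF A]) (auto simp: A_def)
  ultimately   show ?thesis using assms(3) by (simp add: sum_mono)
qed

lemma total_of_real: "total (\<lambda>z. complex_of_real (g z)) = of_real (total g)"
  unfolding total_def by simp

text \<open>The squared l2 norm of u.\<close>

definition energy :: "('a \<Rightarrow> complex) \<Rightarrow> real" where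
  "energy u = total (\<lambda>z. (cmod (u z))\<^sup>2)"

lemma energy_nonneg: "energy u \<ge> 0"
  unfolding energy_def total_def by (simp add: sum_nonneg)

lemma total_cauchy_schwarz:
  assumes "finsupp u" "finsupp v"
  shows "(cmod (total (\<lambda>z. u z * v z)))\<^sup>2 \<le> energy u * energy v"
proof -
  define A where "A = {z. u z \<noteq> 0} \<union> {z. v z \<noteq> 0}"
  have A: "finite A" using assms by (simp add: A_def)
  have "total (\<lambda>z. u z * v z) = (\<Sum>z\<in>A. u z * v z)"
    by (rule total_superset[OF A]) (auto simp: A_def)
  then have "cmod (total (\<lambda>z. u z * v z)) \<le> (\<Sum>z\<in>A. cmod (u z) * cmod (v z))"
    by (simp add: norm_mult[symmetric] norm_sum)
  then have "(cmod (total (\<lambda>z. u z * v z)))\<^sup>2 \<le> (\<Sum>z\<in>A. cmod (u z) * cmod (v z))\<^sup>2"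
    by (simp add: power_mono)
  also have "\<dots> \<le> (\<Sum>z\<in>A. (cmod (u z))\<^sup>2) * (\<Sum>z\<in>A. (cmod (v z))\<^sup>2)"
    by (rule Cauchy_Schwarz_ineq_sum)
  also have "(\<Sum>z\<in>A. (cmod (u z))\<^sup>2) = energy u" unfolding energy_def
    by (rule total_superset[OF A, symmetric]) (auto simp: A_def)
  also have "(\<Sum>z\<in>A. (cmod (v z))\<^sup>2) = energy v" unfolding energy_def
    by (rule total_superset[OF A, symmetric]) (auto simp: A_def)
  finally show ?thesis .
qed

lemma energy_eq_total: "of_real (energy u) = total (\<lambda>z. u z * cnj (u z))"
  by (simp add: energy_def total_of_real[symmetric] complex_norm_square del: of_real_power) 

lemma energy_shift: "energy (\<lambda>z. u (z + a)) = energy u" for a :: "'a::ab_group_add"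
  unfolding energy_def by (rule total_shift)

lemma finsupp_norm2: "finsupp u \<Longrightarrow> finsupp (\<lambda>z. (cmod (u z))\<^sup>2)"
  by simp

lemma energy_avg_le:
  assumes "\<And>i. i \<in># I \<Longrightarrow> finsupp (u i)"
  shows "energy (\<lambda>z. avg I (\<lambda>i. u i z)) \<le> avg I (\<lambda>i. energy (u i))"
proof -
  have "energy (\<lambda>z. avg I (\<lambda>i. u i z)) \<le> total (\<lambda>z. avg I (\<lambda>i. (cmod (u i z))\<^sup>2))"
    unfolding energy_def
    by (intro total_mono norm_avg_power_le finsupp_norm2 finsupp_avg) (use assms in auto)
  also have "\<dots> = avg I (\<lambda>i. energy (u i))"
    unfolding energy_def by (rule total_avg) (use assms in auto)
  finally show ?thesis .
qed

text \<open>Opening the square. Read from right to left, it recognises a double average of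
  correlations as a squared norm; the nonnegativity of box norms comes from here.\<close>

lemma energy_avg_expand:
  assumes "\<And>i. i \<in># I \<Longrightarrow> finsupp (u i)"
  shows "of_real (energy (\<lambda>z. avg I (\<lambda>i. u i z)))
    = avg I (\<lambda>i. avg I (\<lambda>j. total (\<lambda>z. u i z * cnj (u j z))))"
proof -
  have fs1: "finsupp (\<lambda>z. u i z * v z)" if "i \<in># I" for i and v :: "_ \<Rightarrow> complex"
    by (rule finsupp_subset[OF assms[OF that]]) auto
  have "of_real (energy (\<lambda>z. avg I (\<lambda>i. u i z)))
      = total (\<lambda>z. avg I (\<lambda>i. avg I (\<lambda>j. u i z * cnj (u j z))))"
    unfolding energy_eq_total cnj_avg avg_mult_right by (simp only: avg_mult_left)
  also have "\<dots> = avg I (\<lambda>i. total (\<lambda>z. avg I (\<lambda>j. u i z * cnj (u j z))))"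
    by (rule total_avg, rule finsupp_avg, rule fs1)
  also have "\<dots> = avg I (\<lambda>i. avg I (\<lambda>j. total (\<lambda>z. u i z * cnj (u j z))))"
    by (intro avg_cong total_avg, rule fs1)
  finally show ?thesis .
qed

lemma energy_le_card:
  assumes "finsupp u" "\<And>z. cmod (u z) \<le> 1" "real (card {z. u z \<noteq> 0}) \<le> S"
  shows "energy u \<le> S"
proof -
  have "energy u = (\<Sum>z\<in>{z. u z \<noteq> 0}. (cmod (u z))\<^sup>2)" unfolding energy_def
    by (rule total_superset) (use assms in auto)
  also have "\<dots> \<le> (\<Sum>z\<in>{z. u z \<noteq> 0}. 1)"
    by (rule sum_mono) (simp add: assms abs_square_le_1)
  finally show ?thesis using assms by simp
qed

section \<open>Box norms and multiplicative derivatives\<close>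

text \<open>A list \<open>t\<close> of pairs \<open>(h\<^sub>i, h\<^sub>i')\<close> spans a cube; \<open>mderiv_pair t u f\<close> is the product over its vertices
  of the (conjugated) shifts of \<open>f\<close>, except that the vertex with all \<open>\<epsilon>\<^sub>i = 0\<close> carries \<open>u\<close>.\<close>

fun mderiv_pair :: "('a::ab_group_add \<times> 'a) list \<Rightarrow> ('a \<Rightarrow> complex) \<Rightarrow> ('a \<Rightarrow> complex) \<Rightarrow> 'a \<Rightarrow> complex" where
  "mderiv_pair [] u f = u"
| "mderiv_pair ((y, y') # t) u f =
     mderiv_pair t (\<lambda>z. u (z + y) * cnj (f (z + y'))) (\<lambda>z. f (z + y) * cnj (f (z + y')))"

abbreviation "mderiv t f \<equiv> mderiv_pair t f f"

abbreviation base_shift :: "('a::ab_group_add \<times> 'a) list \<Rightarrow> 'a" where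
  "base_shift t \<equiv> sum_list (map fst t)"

text \<open>A single multiset of lists in place of 2s nested averages, so that one
  \<open>avg_swap\<close> or one Cauchy-Schwarz step handles a whole group of directions.\<close>

fun pair_lists :: "'a multiset list \<Rightarrow> ('a \<times> 'a) list multiset" where
  "pair_lists [] = {#[]#}"
| "pair_lists (Y # Ys) = image_mset (\<lambda>(p, t). p # t) (mtimes (mtimes Y Y) (pair_lists Ys))"

lemma avg_single [simp]: "avg {#x#} g = g x"
  by (simp add: avg_def)

lemma avg_pair_lists_Cons:
  "avg (pair_lists (Y # Ys)) g = avg Y (\<lambda>y. avg Y (\<lambda>y'. avg (pair_lists Ys) (\<lambda>t. g ((y, y') # t))))"
  by (simp add: avg_image avg_mtimes)

lemma avg_pair_lists_append:
  "avg (pair_lists (Xs @ Ys)) g = avg (pair_lists Xs) (\<lambda>s. avg (pair_lists Ys) (\<lambda>t. g (s @ t)))"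
  by (induction Xs arbitrary: g) (simp_all add: avg_pair_lists_Cons del: pair_lists.simps(2))

lemma mderiv_pair_mult: "mderiv_pair t (\<lambda>z. u z * v z) (\<lambda>z. f z * g z) = (\<lambda>z. mderiv_pair t u f z * mderiv_pair t v g z)"
proof (induction t arbitrary: u v f g)
  case (Cons p t)
  obtain y y' where p: "p = (y, y')" by force
  show ?case
    using Cons[of "\<lambda>z. u (z + y) * cnj (f (z + y'))" "\<lambda>z. v (z + y) * cnj (g (z + y'))"
        "\<lambda>z. f (z + y) * cnj (f (z + y'))" "\<lambda>z. g (z + y) * cnj (g (z + y'))"]
    by (simp add: p mult_ac)
qed simp

lemma mderiv_pair_cnj: "mderiv_pair t (\<lambda>z. cnj (u z)) (\<lambda>z. cnj (f z)) = (\<lambda>z. cnj (mderiv_pair t u f z))"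
proof (induction t arbitrary: u f)
  case (Cons p t)
  obtain y y' where p: "p = (y, y')" by force
  show ?case
    using Cons[of "\<lambda>z. u (z + y) * cnj (f (z + y'))" "\<lambda>z. f (z + y) * cnj (f (z + y'))"]
    by (simp add: p mult_ac)
qed simp

lemma mderiv_pair_shift: "mderiv_pair t (\<lambda>z. u (z + a)) (\<lambda>z. f (z + a)) = (\<lambda>z. mderiv_pair t u f (z + a))"
proof (induction t arbitrary: u f)
  case (Cons p t)
  obtain y y' where p: "p = (y, y')" by force
  show ?case
    using Cons[of "\<lambda>z. u (z + y) * cnj (f (z + y'))" "\<lambda>z. f (z + y) * cnj (f (z + y'))"]
    by (simp add: p add_ac)
qed simp

text \<open>The function u occurs only at the vertex with all \<epsilon>_i = 0, which is z +
  \<open>base_shift t\<close>; with the constant 1 in its place the rest of the product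
  remains.\<close>

lemma mderiv_pair_decomp: "mderiv_pair t u f z = u (z + base_shift t) * mderiv_pair t (\<lambda>_. 1) f z"
proof (induction t arbitrary: u f z)
  case (Cons p t)
  obtain y y' where p: "p = (y, y')" by force
  show ?case
    using Cons[of "\<lambda>z. u (z + y) * cnj (f (z + y'))" "\<lambda>z. f (z + y) * cnj (f (z + y'))" z]
      Cons[of "\<lambda>z. cnj (f (z + y'))" "\<lambda>z. f (z + y) * cnj (f (z + y'))" z]
    by (simp add: p add_ac)
qed simp

lemma mderiv_pair_delta:
  "mderiv_pair t (\<lambda>z. u (z + y) * cnj (v (z + y'))) (\<lambda>z. f (z + y) * cnj (g (z + y')))
    = (\<lambda>z. mderiv_pair t u f (z + y) * cnj (mderiv_pair t v g (z + y')))"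
  by (simp add: mderiv_pair_mult mderiv_pair_cnj[of t "\<lambda>z. v (z + y')" "\<lambda>z. g (z + y')"] mderiv_pair_shift)

text \<open>Derivatives along different pairs commute. This is why the order of the directions in a
  box norm is irrelevant.\<close>

lemma mderiv_comm: "mderiv_pair t (mderiv s u) (mderiv s f) = mderiv s (mderiv_pair t u f)"
proof (induction s arbitrary: u f)
  case (Cons p s)
  obtain y y' where p: "p = (y, y')" by force
  show ?case by (simp add: p Cons mderiv_pair_delta)
qed simp

lemma mderiv_append: "mderiv (s @ t) f = mderiv t (mderiv s f)"
proof (induction s arbitrary: f)
  case (Cons p s)
  obtain y y' where p: "p = (y, y')" by force
  show ?case by (simp add: p Cons)
qed simp

lemma mderiv_pair_one_le: "(\<And>z. cmod (u z) \<le> 1) \<Longrightarrow> (\<And>z. cmod (f z) \<le> 1) \<Longrightarrow> cmod (mderiv_pair t u f z) \<le> 1"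
proof (induction t arbitrary: u f z)
  case (Cons p t)
  obtain y y' where p: "p = (y, y')" by force
  show ?case unfolding p mderiv_pair.simps
    by (intro Cons.IH) (auto simp: norm_mult intro!: mult_le_one Cons.prems)
qed simp

lemma mderiv_pair_support: "mderiv_pair t u f z \<noteq> 0 \<Longrightarrow> u (z + base_shift t) \<noteq> 0"
  by (subst (asm) mderiv_pair_decomp) simp

lemma finsupp_mderiv_pair: "finsupp u \<Longrightarrow> finsupp (mderiv_pair t u f)"
  by (rule finsupp_subset[OF finsupp_shift[of u "base_shift t"]]) (auto dest: mderiv_pair_support)

definition one_bounded :: "real \<Rightarrow> ('a \<Rightarrow> complex) \<Rightarrow> bool" where
  "one_bounded S f \<longleftrightarrow> finsupp f \<and> (\<forall>z. cmod (f z) \<le> 1) \<and> real (card {z. f z \<noteq> 0}) \<le> S"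

text \<open>The shift a is allowed because a derivative of f lives on a translate of the support of
  f.\<close>

lemma one_bounded_subset:
  fixes f g :: "'a::ab_group_add \<Rightarrow> complex"
  assumes "one_bounded S f" "\<And>z. cmod (g z) \<le> 1" "\<And>z. g z \<noteq> 0 \<Longrightarrow> f (z + a) \<noteq> 0"
  shows "one_bounded S g"
proof -
  have "card {z. g z \<noteq> 0} \<le> card {z. f (z + a) \<noteq> 0}"
    using assms by (intro card_mono finsupp_shift[of f]) (auto simp: one_bounded_def)
  then have "card {z. g z \<noteq> 0} \<le> card {z. f z \<noteq> 0}" by (simp add: card_shift)
  moreover have "finsupp g" using assms by (intro finsupp_subset[OF finsupp_shift, of f g a]) (auto simp: one_bounded_def)
  ultimately show ?thesis using assms by (simp add: one_bounded_def)
qed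

lemma one_bounded_mderiv_pair: "one_bounded S u \<Longrightarrow> (\<And>z. cmod (f z) \<le> 1) \<Longrightarrow> one_bounded S (mderiv_pair t u f)"
  by (rule one_bounded_subset[of S u _ "base_shift t"]) (auto simp: one_bounded_def intro!: mderiv_pair_one_le dest!: mderiv_pair_support)

lemma one_bounded_mderiv: "one_bounded S u \<Longrightarrow> one_bounded S (mderiv t u)"
  by (rule one_bounded_mderiv_pair) (simp_all add: one_bounded_def)

lemma one_bounded_mult_cnj: "one_bounded S f \<Longrightarrow> one_bounded S (\<lambda>z. f (z + a) * cnj (f (z + b)))"
  for f :: "'a::ab_group_add \<Rightarrow> complex"
  by (rule one_bounded_subset[of S f _ a]) (auto simp: one_bounded_def norm_mult intro!: mult_le_one)

lemma one_bounded_nonneg: "one_bounded S f \<Longrightarrow> S \<ge> 0"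
  unfolding one_bounded_def by (meson of_nat_0_le_iff order_trans)

lemma energy_le_one_bounded: "one_bounded S f \<Longrightarrow> energy f \<le> S"
  unfolding one_bounded_def by (intro energy_le_card) auto

definition gbox :: "'a::ab_group_add multiset list \<Rightarrow> ('a \<Rightarrow> complex) \<Rightarrow> complex" where
  "gbox Xs f = avg (pair_lists Xs) (\<lambda>t. total (mderiv t f))"

text \<open>For a nonempty list and finitely supported f this loses nothing
  (\<open>gbox_real\<close>); along the empty list the value is \<open>total f\<close>, which may be
  any complex number.\<close>

definition rbox :: "'a::ab_group_add multiset list \<Rightarrow> ('a \<Rightarrow> complex) \<Rightarrow> real" where
  "rbox Xs f = Re (gbox Xs f)"

lemma gbox_Nil [simp]: "gbox [] f = total f"
  by (simp add: gbox_def)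

lemma gbox_append: "gbox (Xs @ Ys) f = avg (pair_lists Xs) (\<lambda>s. gbox Ys (mderiv s f))"
  by (simp add: gbox_def avg_pair_lists_append mderiv_append)

lemma gbox_Cons:
  "gbox (X # Xs) f = avg X (\<lambda>x. avg X (\<lambda>x'. gbox Xs (\<lambda>z. f (z + x) * cnj (f (z + x')))))"
  by (simp add: gbox_def avg_pair_lists_Cons del: pair_lists.simps(2))

lemma gbox_commute: "gbox (Xs @ Ys) f = gbox (Ys @ Xs) f"
  by (simp add: gbox_def avg_pair_lists_append mderiv_append avg_swap[of "pair_lists Xs"] mderiv_comm)

lemma gbox_move: "gbox (Xs @ Y # Ys) f = gbox (Y # Xs @ Ys) f"
proof -
  have "gbox (Xs @ [Y] @ Ys) f = avg (pair_lists Ys) (\<lambda>s. gbox (Xs @ [Y]) (mderiv s f))"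
    using gbox_commute[of "Xs @ [Y]" Ys f] by (simp add: gbox_append)
  also have "\<dots> = avg (pair_lists Ys) (\<lambda>s. gbox ([Y] @ Xs) (mderiv s f))"
    by (subst gbox_commute) simp
  also have "\<dots> = gbox (([Y] @ Xs) @ Ys) f"
    by (subst gbox_commute[of "[Y] @ Xs"]) (rule gbox_append[symmetric])
  finally show ?thesis by simp
qed

lemma gbox_perm: "mset Xs = mset Ys \<Longrightarrow> gbox Xs f = gbox Ys f"
proof (induction Xs arbitrary: Ys f)
  case (Cons X Xs)
  obtain As Bs where Ys: "Ys = As @ X # Bs"
    using Cons.prems by (metis list.set_intros(1) set_mset_mset split_list)
  then have "mset Xs = mset (As @ Bs)" using Cons.prems by simp
  from Cons.IH[OF this] show ?case unfolding Ys gbox_move by (simp add: gbox_Cons)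
qed simp

lemma rbox_perm: "mset Xs = mset Ys \<Longrightarrow> rbox Xs f = rbox Ys f"
  unfolding rbox_def by (metis gbox_perm)

lemma rbox_append: "rbox (Xs @ Ys) f = avg (pair_lists Xs) (\<lambda>s. rbox Ys (mderiv s f))"
  by (simp add: rbox_def gbox_append Re_avg)

lemma rbox_Cons:
  "rbox (X # Xs) f = avg X (\<lambda>x. avg X (\<lambda>x'. rbox Xs (\<lambda>z. f (z + x) * cnj (f (z + x')))))"
  by (simp add: rbox_def gbox_Cons Re_avg)

lemma gbox_single:
  assumes "finsupp f"
  shows "gbox [X] f = of_real (energy (\<lambda>z. avg X (\<lambda>x. f (z + x))))"
  by (subst energy_avg_expand) (simp_all add: gbox_Cons finsupp_shift assms)

text \<open>Moving X to the innermost place turns its two averages into a square, so the box norm is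
  an average of energies.\<close>

lemma gbox_Cons_energy:
  assumes "finsupp f"
  shows "gbox (X # Xs) f = of_real (avg (pair_lists Xs) (\<lambda>t. energy (\<lambda>z. avg X (\<lambda>x. mderiv t f (z + x)))))"
proof -
  have "gbox (X # Xs) f = gbox (Xs @ [X]) f" by (rule gbox_perm) simp
  then show ?thesis
    by (simp add: gbox_append gbox_single finsupp_mderiv_pair assms of_real_avg)
qed

lemma rbox_Cons_energy:
  assumes "finsupp f"
  shows "rbox (X # Xs) f = avg (pair_lists Xs) (\<lambda>t. energy (\<lambda>z. avg X (\<lambda>x. mderiv t f (z + x))))"
  by (simp add: rbox_def gbox_Cons_energy assms)

lemma gbox_real:
  assumes "finsupp f" "Xs \<noteq> []"
  shows "gbox Xs f = of_real (rbox Xs f)"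
  using assms by (cases Xs) (simp_all add: rbox_Cons_energy gbox_Cons_energy)

lemma rbox_nonneg: "finsupp f \<Longrightarrow> Xs \<noteq> [] \<Longrightarrow> rbox Xs f \<ge> 0"
  by (cases Xs) (auto simp: rbox_Cons_energy intro!: avg_nonneg energy_nonneg)

lemma cmod_box: "finsupp f \<Longrightarrow> Xs \<noteq> [] \<Longrightarrow> cmod (gbox Xs f) = rbox Xs f"
  by (simp add: gbox_real rbox_nonneg)

lemma energy_avg_shift_le:
  fixes f :: "'a::ab_group_add \<Rightarrow> complex"
  assumes "finsupp f" shows "energy (\<lambda>z. avg X (\<lambda>x. f (z + x))) \<le> energy f"
proof -
  have "energy (\<lambda>z. avg X (\<lambda>x. f (z + x))) \<le> avg X (\<lambda>x. energy f)"
    using energy_avg_le[of X "\<lambda>x z. f (z + x)", OF finsupp_shift[OF assms]] by (simp only: energy_shift)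
  also have "\<dots> \<le> energy f" by (rule avg_le_const) (simp_all add: energy_nonneg)
  finally show ?thesis .
qed

lemma rbox_le:
  assumes "one_bounded S f" "Xs \<noteq> []" shows "rbox Xs f \<le> S"
proof -
  obtain X Ys where Xs: "Xs = X # Ys" using assms by (cases Xs) auto
  have f: "finsupp f" using assms by (simp add: one_bounded_def)
  show ?thesis unfolding Xs rbox_Cons_energy[OF f]
    by (intro avg_le_const order_trans[OF energy_avg_shift_le] energy_le_one_bounded one_bounded_mderiv assms finsupp_mderiv_pair f one_bounded_nonneg[OF assms(1)])
qed

lemma gbox_shift: "gbox Xs (\<lambda>z. f (z + a)) = gbox Xs f"
  by (simp add: gbox_def mderiv_pair_shift total_shift)

lemma rbox_shift: "rbox Xs (\<lambda>z. f (z + a)) = rbox Xs f"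
  by (simp add: rbox_def gbox_shift)

section \<open>The Gowers-Cauchy-Schwarz inequality and concatenation\<close>

lemma finsupp_mult_left: "finsupp u \<Longrightarrow> finsupp (\<lambda>z. u z * v z)" for u :: "'a \<Rightarrow> complex"
  by (rule finsupp_subset) auto

lemma finsupp_mult_right: "finsupp v \<Longrightarrow> finsupp (\<lambda>z. u z * v z)" for v :: "'a \<Rightarrow> complex"
  by (rule finsupp_subset) auto

text \<open>The cube splits into two faces in direction Y: the y-face contains the vertex carrying
  u, the y'-face involves f only. Cauchy-Schwarz in z bounds the second face by its energy, at most
  S, and replaces it by a copy of the first.\<close>

lemma gcs_step:
  fixes u f :: "'a::ab_group_add \<Rightarrow> complex"
  assumes u: "finsupp u" and f: "one_bounded S f"
  shows "(cmod (avg (pair_lists (Y # Ys)) (\<lambda>t. total (mderiv_pair t u f))))\<^sup>2 \<le> S * cmod (avg Y (\<lambda>y. avg Y (\<lambda>y'.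
    avg (pair_lists Ys) (\<lambda>t. total (mderiv_pair t (\<lambda>z. u (z + y) * cnj (u (z + y'))) (\<lambda>z. f (z + y) * cnj (f (z + y'))))))))"
    (is "?L \<le> S * cmod ?R")
proof -
  have fsf: "finsupp f" using f by (simp add: one_bounded_def)
  define g where "g t z = avg Y (\<lambda>y. mderiv_pair t u f (z + y))" for t z
  define h where "h t z = avg Y (\<lambda>y. mderiv t f (z + y))" for t z
  have fsg: "finsupp (g t)" for t unfolding g_def by (intro finsupp_avg finsupp_shift finsupp_mderiv_pair u)
  have fsh: "finsupp (h t)" for t unfolding h_def by (intro finsupp_avg finsupp_shift finsupp_mderiv_pair fsf)
  have "avg (pair_lists (Y # Ys)) (\<lambda>t. total (mderiv_pair t u f))
      = avg (pair_lists Ys) (\<lambda>t. avg Y (\<lambda>y. avg Y (\<lambda>y'. total (\<lambda>z. mderiv_pair t u f (z + y) * cnj (mderiv t f (z + y'))))))"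
    by (simp add: avg_pair_lists_Cons avg_swap[of Y "pair_lists Ys"] mderiv_pair_delta del: pair_lists.simps)
  also have "\<dots> = avg (pair_lists Ys) (\<lambda>t. total (\<lambda>z. g t z * cnj (h t z)))"
  proof (rule avg_cong)
    fix t
    have 1: "finsupp (\<lambda>z. mderiv_pair t u f (z + y) * v z)" for y and v :: "'a \<Rightarrow> complex"
      by (intro finsupp_mult_left finsupp_shift finsupp_mderiv_pair u)
    have "avg Y (\<lambda>y. avg Y (\<lambda>y'. total (\<lambda>z. mderiv_pair t u f (z + y) * cnj (mderiv t f (z + y')))))
      = avg Y (\<lambda>y. total (\<lambda>z. avg Y (\<lambda>y'. mderiv_pair t u f (z + y) * cnj (mderiv t f (z + y')))))"
      by (subst total_avg) (rule 1, rule refl)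
    also have "\<dots> = total (\<lambda>z. avg Y (\<lambda>y. avg Y (\<lambda>y'. mderiv_pair t u f (z + y) * cnj (mderiv t f (z + y')))))"
      by (subst total_avg) (intro finsupp_avg 1, rule refl)
    also have "\<dots> = total (\<lambda>z. g t z * cnj (h t z))"
      unfolding g_def h_def cnj_avg avg_mult_right by (simp only: avg_mult_left)
    finally show "avg Y (\<lambda>y. avg Y (\<lambda>y'. total (\<lambda>z. mderiv_pair t u f (z + y) * cnj (mderiv t f (z + y'))))) = \<dots>" .
  qed
  finally have "?L \<le> avg (pair_lists Ys) (\<lambda>t. (cmod (total (\<lambda>z. g t z * cnj (h t z))))\<^sup>2)"
    by (simp add: norm_avg_power_le)
  also have "\<dots> \<le> avg (pair_lists Ys) (\<lambda>t. S * energy (g t))"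
  proof (rule avg_mono)
    fix t
    have "(cmod (total (\<lambda>z. g t z * cnj (h t z))))\<^sup>2 \<le> energy (g t) * energy (\<lambda>z. cnj (h t z))"
      by (rule total_cauchy_schwarz) (use fsg fsh in auto)
    also have "energy (\<lambda>z. cnj (h t z)) = energy (h t)" by (simp add: energy_def)
    finally have 1: "(cmod (total (\<lambda>z. g t z * cnj (h t z))))\<^sup>2 \<le> energy (g t) * energy (h t)" .
    have "energy (h t) \<le> energy (mderiv t f)" unfolding h_def by (intro energy_avg_shift_le finsupp_mderiv_pair fsf)
    also have "\<dots> \<le> S" by (intro energy_le_one_bounded one_bounded_mderiv f)
    finally have "energy (g t) * energy (h t) \<le> energy (g t) * S" by (intro mult_left_mono energy_nonneg)
    with 1 show "(cmod (total (\<lambda>z. g t z * cnj (h t z))))\<^sup>2 \<le> S * energy (g t)"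
      by (simp add: mult.commute)
  qed
  also have "\<dots> = S * avg (pair_lists Ys) (\<lambda>t. energy (g t))" by (simp add: avg_mult_left)
  also have "avg (pair_lists Ys) (\<lambda>t. energy (g t)) = cmod (of_real (avg (pair_lists Ys) (\<lambda>t. energy (g t))))"
    by (simp add: avg_nonneg energy_nonneg)
  also have "of_real (avg (pair_lists Ys) (\<lambda>t. energy (g t)))
     = avg (pair_lists Ys) (\<lambda>t. avg Y (\<lambda>y. avg Y (\<lambda>y'. total (\<lambda>z. mderiv_pair t u f (z + y) * cnj (mderiv_pair t u f (z + y'))))))"
    unfolding of_real_avg g_def
    by (intro avg_cong energy_avg_expand finsupp_shift finsupp_mderiv_pair u)
  also have "\<dots> = ?R"
    by (simp add: avg_swap[of Y "pair_lists Ys"] mderiv_pair_delta)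
  finally show ?thesis .
qed

text \<open>Each use of \<open>gcs_step\<close> clears f from one face and leaves a cube of lower
  dimension for derivatives of u and f. Jensen moves the doubled powers inside the averages; after
  the last direction only u is left.\<close>

lemma gowers_cauchy_schwarz:
  fixes u f :: "'a::ab_group_add \<Rightarrow> complex"
  assumes "finsupp u" "one_bounded S f"
  shows "cmod (avg (pair_lists Ys) (\<lambda>t. total (mderiv_pair t u f))) ^ (2 ^ length Ys)
    \<le> S ^ (2 ^ length Ys - 1) * cmod (gbox Ys u)"
  using assms
proof (induction Ys arbitrary: u f)
  case (Cons Y Ys)
  let ?D = "\<lambda>y y' (f :: 'a \<Rightarrow> complex) z. f (z + y) * cnj (f (z + y'))"
  let ?W = "\<lambda>y y'. avg (pair_lists Ys) (\<lambda>t. total (mderiv_pair t (?D y y' u) (?D y y' f)))"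
  have S: "S \<ge> 0" using Cons.prems one_bounded_nonneg by blast
  have fsD: "finsupp (?D y y' u)" for y y' by (intro finsupp_mult_left finsupp_shift Cons.prems)
  note step = gcs_step[OF Cons.prems, of Y Ys]
  show ?case
  \<comment> \<open>For empty Ys the inner term is a plain \<open>total\<close>, which need not be
    nonnegative, so moduli cannot be taken inside the averages and out again. Here the step alone is
    the claim.\<close>
  proof (cases "Ys = []")
    case True
    then show ?thesis using step by (simp add: gbox_Cons)
  next
    case False
    let ?n = "2 ^ length Ys :: nat"
    have n: "?n \<ge> 1" by simp
    have "cmod (avg (pair_lists (Y # Ys)) (\<lambda>t. total (mderiv_pair t u f))) ^ (2 * ?n)
        \<le> (S * cmod (avg Y (\<lambda>y. avg Y (\<lambda>y'. ?W y y')))) ^ ?n"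
      unfolding power_mult by (rule power_mono[OF step]) simp
    also have "\<dots> \<le> S ^ ?n * avg Y (\<lambda>y. avg Y (\<lambda>y'. cmod (?W y y') ^ ?n))"
      unfolding power_mult_distrib
      by (intro mult_left_mono order_trans[OF norm_avg_power_le[OF n]] avg_mono norm_avg_power_le[OF n])
        (use S in auto)
    also have "\<dots> \<le> S ^ ?n * avg Y (\<lambda>y. avg Y (\<lambda>y'. S ^ (?n - 1) * cmod (gbox Ys (?D y y' u))))"
      by (intro mult_left_mono avg_mono Cons.IH fsD one_bounded_mult_cnj Cons.prems) (use S in auto)
    also have "\<dots> = S ^ (?n + (?n - 1)) * avg Y (\<lambda>y. avg Y (\<lambda>y'. cmod (gbox Ys (?D y y' u))))"
      by (simp only: avg_mult_left[symmetric] power_add mult_ac)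
    also have "avg Y (\<lambda>y. avg Y (\<lambda>y'. cmod (gbox Ys (?D y y' u)))) = rbox (Y # Ys) u"
      unfolding rbox_Cons using fsD False by (simp add: cmod_box)
    also have "rbox (Y # Ys) u = cmod (gbox (Y # Ys) u)"
      by (simp add: cmod_box Cons.prems)
    also have "?n + (?n - 1) = 2 ^ length (Y # Ys) - 1" by simp
    finally show ?thesis by simp
  qed
qed simp


text \<open>The dual function: pulling the factor at one vertex out of the cube product leaves \<open>dual f (x' - x) t\<close>.\<close>

definition dual :: "('a::ab_group_add \<Rightarrow> complex) \<Rightarrow> 'a \<Rightarrow> ('a \<times> 'a) list \<Rightarrow> 'a \<Rightarrow> complex" where
  "dual f c t z = mderiv_pair t (\<lambda>_. 1) f (z - base_shift t) * cnj (mderiv t f (z - base_shift t + c))"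

lemma finsupp_dual: "finsupp f \<Longrightarrow> finsupp (dual f c t)"
  unfolding dual_def
  using finsupp_mult_right[OF finsupp_shift[OF finsupp_mderiv_pair[of f t f], of "- base_shift t + c"], of "\<lambda>z. mderiv_pair t (\<lambda>_. 1) f (z - base_shift t)"]
  by (simp add: algebra_simps)

text \<open>Translating the special vertex to z makes the other factors depend on x and x' only
  through x' - x.\<close>

lemma total_mderiv_eq_dual:
  "total (mderiv t (\<lambda>z. f (z + x) * cnj (f (z + x')))) = total (\<lambda>z. f z * dual f (x' - x) t z)"
proof -
  have "mderiv t (\<lambda>z. f (z + x) * cnj (f (z + x'))) z
      = f (z + (x + base_shift t)) * dual f (x' - x) t (z + (x + base_shift t))" for z
    unfolding mderiv_pair_delta dual_def
    by (subst mderiv_pair_decomp[of t f f "z + x"]) (simp add: algebra_simps)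
  then have "total (mderiv t (\<lambda>z. f (z + x) * cnj (f (z + x'))))
      = total (\<lambda>z. f (z + (x + base_shift t)) * dual f (x' - x) t (z + (x + base_shift t)))"
    by (intro arg_cong[where f = total] ext)
  also have "\<dots> = total (\<lambda>z. f z * dual f (x' - x) t z)"
    by (rule total_shift[of "\<lambda>z. f z * dual f (x' - x) t z"])
  finally show ?thesis .
qed

text \<open>Correlation with a dual function is again a cube average, now with v inserted at the
  special vertex. This is the shape to which \<open>gowers_cauchy_schwarz\<close> applies.\<close>

lemma total_dual_mult:
  "total (\<lambda>z. dual f a t z * v z)
    = total (mderiv_pair t (\<lambda>z. cnj (f (z + a)) * v z) (\<lambda>z. f z * cnj (f (z + a))))"
proof -
  have one: "mderiv_pair t (\<lambda>_. 1) (\<lambda>z. f z * cnj (f (z + a))) z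
      = mderiv_pair t (\<lambda>_. 1) f z * cnj (mderiv_pair t (\<lambda>_. 1) f (z + a))" for z
    using mderiv_pair_delta[of t "\<lambda>_. 1" 0 "\<lambda>_. 1" a f f] by (simp add: fun_eq_iff)
  have "dual f a t (z + base_shift t) * v (z + base_shift t)
      = mderiv_pair t (\<lambda>z. cnj (f (z + a)) * v z) (\<lambda>z. f z * cnj (f (z + a))) z" for z
    unfolding dual_def
    by (subst mderiv_pair_decomp[of t f f], subst (2) mderiv_pair_decomp) (simp add: one algebra_simps)
  then show ?thesis
    using total_shift[of "\<lambda>z. dual f a t z * v z" "base_shift t"] by (simp only: fun_eq_iff[symmetric])
qed

lemma mderiv_dual: "mderiv s (dual f b t) = dual (mderiv s f) b t"
proof -
  have "mderiv s (\<lambda>_. 1 :: complex) = (\<lambda>_. 1)" by (induction s) auto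
  then have one: "mderiv s (mderiv_pair t (\<lambda>_. 1) f) = mderiv_pair t (\<lambda>_. 1) (mderiv s f)"
    using mderiv_comm[of t s "\<lambda>_. 1" f] by simp
  have d: "dual g b t = (\<lambda>z. mderiv_pair t (\<lambda>_. 1) g (z + - base_shift t) * cnj (mderiv t g (z + (- base_shift t + b))))" for g
    by (simp add: dual_def fun_eq_iff algebra_simps)
  show ?thesis unfolding d mderiv_pair_delta one mderiv_comm ..
qed

text \<open>The correlation of two dual functions is opened twice: a first Gowers-Cauchy-Schwarz
  inequality over the cubes along Ps, a second over those along Qs. Each contributes a power 2^m,
  and all factors except f(z + b) cnj (f(z + a)) disappear.\<close>

lemma avg_mderiv_pair_dual:
  fixes f :: "'a::ab_group_add \<Rightarrow> complex" and a b :: 'a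
  assumes f: "one_bounded S f" and len: "length Ps = m" "length Qs = m"
  defines "V \<equiv> avg (pair_lists Qs) (\<lambda>t'. avg (pair_lists Ps) (\<lambda>t. total (\<lambda>z. dual f a t z * cnj (dual f b t' z))))"
  shows "m = 0 \<Longrightarrow> V = gbox (Ps @ Qs) (\<lambda>z. f (z + b) * cnj (f (z + a)))"
    and "m > 0 \<Longrightarrow> cmod V ^ (4 ^ m) \<le> S ^ (4 ^ m - 1) * rbox (Ps @ Qs) (\<lambda>z. f (z + b) * cnj (f (z + a)))"
proof -
  define K where "K g c z = g (z + c) * cnj (g z)" for g :: "'a \<Rightarrow> complex" and c z
  \<comment> \<open>This is the special vertex given by \<open>total_dual_mult\<close> for v = cnj
    (dual f b t'). It is stated for every g because a derivative of u f t' is u of a derivative of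
    f.\<close>
  define u where "u g t' z = cnj (g (z + a)) * cnj (dual g b t' z)" for g :: "'a \<Rightarrow> complex" and t' z
  let ?F = "\<lambda>z. f (z + b) * cnj (f (z + a))"
  have fsf: "finsupp f" using f by (simp add: one_bounded_def)
  have V: "V = avg (pair_lists Qs) (\<lambda>t'. avg (pair_lists Ps) (\<lambda>t. total (mderiv_pair t (u f t') (\<lambda>z. f z * cnj (f (z + a))))))"
    unfolding V_def u_def total_dual_mult ..
  have fsu: "finsupp (u g t')" if "finsupp g" for g t'
    unfolding u_def by (rule finsupp_subset[OF finsupp_shift[OF that, of a]]) auto
  have total_u: "total (u g t') = total (mderiv_pair t' (\<lambda>z. g (z + b) * cnj (g (z + a))) (K g b))" for g t'
  proof -
    have "total (u g t') = cnj (total (\<lambda>z. dual g b t' z * g (z + a)))"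
      unfolding u_def total_def by (simp add: mult.commute)
    also have "\<dots> = cnj (total (mderiv_pair t' (\<lambda>z. cnj (g (z + b)) * g (z + a)) (\<lambda>z. g z * cnj (g (z + b)))))"
      unfolding total_dual_mult ..
    also have "\<dots> = total (\<lambda>z. cnj (mderiv_pair t' (\<lambda>z. cnj (g (z + b)) * g (z + a)) (\<lambda>z. g z * cnj (g (z + b))) z))"
      unfolding total_def by simp
    also have "\<dots> = total (mderiv_pair t' (\<lambda>z. g (z + b) * cnj (g (z + a))) (K g b))"
      unfolding mderiv_pair_cnj[symmetric] K_def by (simp add: mult.commute)
    finally show ?thesis .
  qed
  have mderiv_u: "mderiv s (u f t') = u (mderiv s f) t'" for s t'
  proof -
    have "u f t' = (\<lambda>z. cnj (f (z + a) * dual f b t' (z + 0)))" by (simp add: u_def fun_eq_iff)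
    then show ?thesis
      unfolding u_def using mderiv_pair_cnj[of s "\<lambda>z. f (z + a) * dual f b t' z" "\<lambda>z. f (z + a) * dual f b t' z"]
        mderiv_pair_mult[of s "\<lambda>z. f (z + a)" "dual f b t'" "\<lambda>z. f (z + a)" "dual f b t'"]
      by (simp add: mderiv_dual mderiv_pair_shift fun_eq_iff)
  qed
  have box_u: "avg (pair_lists Qs) (\<lambda>t'. gbox Ps (u f t'))
      = avg (pair_lists Ps) (\<lambda>s. avg (pair_lists Qs) (\<lambda>t'. total (mderiv_pair t' (mderiv s ?F) (K (mderiv s f) b))))"
    unfolding gbox_def by (subst avg_swap) (simp add: mderiv_u total_u mderiv_pair_delta)
  show "V = gbox (Ps @ Qs) ?F" if "m = 0"
    using that len by (simp add: V total_u)
  show "cmod V ^ (4 ^ m) \<le> S ^ (4 ^ m - 1) * rbox (Ps @ Qs) ?F" if "m > 0"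
  proof -
    let ?n = "2 ^ m :: nat"
    have n: "?n \<ge> 1" by simp
    have S: "S \<ge> 0" using f one_bounded_nonneg by blast
    have ne: "Ps \<noteq> []" "Qs \<noteq> []" using that len by auto
    have bdK1: "one_bounded S (\<lambda>z. f z * cnj (f (z + a)))" using one_bounded_mult_cnj[OF f, of 0 a] by simp
    have bdK: "one_bounded S (K (mderiv s f) b)" for s
      unfolding K_def using one_bounded_mult_cnj[OF one_bounded_mderiv[OF f], of s b 0] by simp
    have "cmod V ^ ?n \<le> avg (pair_lists Qs) (\<lambda>t'. cmod (avg (pair_lists Ps) (\<lambda>t. total (mderiv_pair t (u f t') (\<lambda>z. f z * cnj (f (z + a)))))) ^ ?n)"
      unfolding V by (rule norm_avg_power_le[OF n])
    also have "\<dots> \<le> avg (pair_lists Qs) (\<lambda>t'. S ^ (?n - 1) * cmod (gbox Ps (u f t')))"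
      using gowers_cauchy_schwarz[OF fsu[OF fsf] bdK1, of Ps] len by (intro avg_mono) simp
    also have "\<dots> = S ^ (?n - 1) * avg (pair_lists Qs) (\<lambda>t'. rbox Ps (u f t'))"
      by (simp only: avg_mult_left[symmetric] cmod_box[OF fsu[OF fsf] ne(1)])
    \<comment> \<open>Along the nonempty list Ps these boxes are nonnegative reals, so the modulus
      may leave the average over t'. That average is then opened in the other order.\<close>
    also have "avg (pair_lists Qs) (\<lambda>t'. rbox Ps (u f t')) \<le> cmod (avg (pair_lists Qs) (\<lambda>t'. gbox Ps (u f t')))"
      unfolding rbox_def Re_avg[symmetric] by (rule complex_Re_le_cmod)
    finally have 1: "cmod V ^ ?n \<le> S ^ (?n - 1) * cmod (avg (pair_lists Qs) (\<lambda>t'. gbox Ps (u f t')))"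
      using S by (simp add: mult_left_mono)
    have "cmod (avg (pair_lists Qs) (\<lambda>t'. gbox Ps (u f t'))) ^ ?n
        \<le> avg (pair_lists Ps) (\<lambda>s. cmod (avg (pair_lists Qs) (\<lambda>t'. total (mderiv_pair t' (mderiv s ?F) (K (mderiv s f) b)))) ^ ?n)"
      unfolding box_u by (rule norm_avg_power_le[OF n])
    also have "\<dots> \<le> avg (pair_lists Ps) (\<lambda>s. S ^ (?n - 1) * cmod (gbox Qs (mderiv s ?F)))"
      using gowers_cauchy_schwarz[OF _ bdK, of _ Qs] len finsupp_mderiv_pair[OF finsupp_mult_left[OF finsupp_shift[OF fsf]]]
      by (intro avg_mono) simp
    also have "\<dots> = S ^ (?n - 1) * rbox (Ps @ Qs) ?F"
      by (simp only: avg_mult_left[symmetric] cmod_box[OF finsupp_mderiv_pair[OF finsupp_mult_left[OF finsupp_shift[OF fsf]]] ne(2)] rbox_append)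
    finally have 2: "cmod (avg (pair_lists Qs) (\<lambda>t'. gbox Ps (u f t'))) ^ ?n \<le> S ^ (?n - 1) * rbox (Ps @ Qs) ?F" .
    have "cmod V ^ (?n * ?n) \<le> (S ^ (?n - 1)) ^ ?n * (S ^ (?n - 1) * rbox (Ps @ Qs) ?F)"
      unfolding power_mult
      by (rule order_trans[OF power_mono[OF 1]])
        (use S 2 in \<open>auto simp: power_mult_distrib intro!: mult_left_mono\<close>)
    also have "\<dots> = S ^ ((?n - 1) * ?n + (?n - 1)) * rbox (Ps @ Qs) ?F"
      by (simp only: power_mult power_add mult.assoc)
    also have "(?n - 1) * ?n + (?n - 1) = ?n * ?n - 1"
      using n by (simp add: algebra_simps)
    also have "?n * ?n = 4 ^ m" by (simp add: power_mult_distrib[symmetric])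
    finally show ?thesis .
  qed
qed

text \<open>Dual functions write each box norm as the \<open>total\<close> of f times v i.
  Cauchy-Schwarz removes f and leaves the correlations T i j of v i and v j. The exponent consists
  of 2 for this inequality and 4^m for the bound on the correlations.\<close>

lemma concatenation_step:
  fixes f :: "'a::ab_group_add \<Rightarrow> complex"
  assumes f: "one_bounded S f" and len: "\<And>i. i \<in># I \<Longrightarrow> length (Ys i) = m"
  shows "avg I (\<lambda>i. rbox (X i # Ys i) f) ^ (2 * 4 ^ m)
    \<le> S ^ (2 * 4 ^ m - 1) * avg I (\<lambda>i. avg I (\<lambda>j. rbox (minkowski (X i) (X j) # Ys i @ Ys j) f))"
proof -
  have fsf: "finsupp f" using f by (simp add: one_bounded_def)
  have S: "S \<ge> 0" using f one_bounded_nonneg by blast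
  define v where "v i z = avg (X i) (\<lambda>x. avg (X i) (\<lambda>x'. avg (pair_lists (Ys i)) (\<lambda>t. dual f (x' - x) t z)))" for i z
  have fsv: "finsupp (v i)" for i unfolding v_def by (intro finsupp_avg finsupp_dual fsf)
  have fsv': "finsupp (\<lambda>z. avg I (\<lambda>i. v i z))" by (intro finsupp_avg fsv)
  have fsm: "finsupp (\<lambda>z. f z * h z)" for h by (rule finsupp_mult_left[OF fsf])
  have box1: "gbox (X i # Ys i) f = total (\<lambda>z. f z * v i z)" for i
    unfolding gbox_Cons unfolding gbox_def total_mderiv_eq_dual v_def avg_mult_left
    by (subst total_avg, (intro finsupp_avg fsm)?)+ (rule refl)
  define T where "T i j = total (\<lambda>z. v i z * cnj (v j z))" for i j
  have "avg I (\<lambda>i. rbox (X i # Ys i) f) \<le> cmod (avg I (\<lambda>i. gbox (X i # Ys i) f))"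
    unfolding rbox_def Re_avg[symmetric] by (rule complex_Re_le_cmod)
  also have "avg I (\<lambda>i. gbox (X i # Ys i) f) = total (\<lambda>z. f z * avg I (\<lambda>i. v i z))"
    unfolding box1 avg_mult_left by (subst total_avg) (rule fsm, rule refl)
  finally have "(avg I (\<lambda>i. rbox (X i # Ys i) f))\<^sup>2 \<le> (cmod (total (\<lambda>z. f z * avg I (\<lambda>i. v i z))))\<^sup>2"
    by (intro power_mono avg_nonneg rbox_nonneg fsf) auto
  also have "\<dots> \<le> energy f * energy (\<lambda>z. avg I (\<lambda>i. v i z))"
    by (rule total_cauchy_schwarz[OF fsf fsv'])
  also have "\<dots> \<le> S * energy (\<lambda>z. avg I (\<lambda>i. v i z))"
    by (intro mult_right_mono energy_le_one_bounded f energy_nonneg)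
  also have "energy (\<lambda>z. avg I (\<lambda>i. v i z)) = cmod (of_real (energy (\<lambda>z. avg I (\<lambda>i. v i z))))"
    by (simp add: energy_nonneg)
  also have "\<dots> = cmod (avg I (\<lambda>i. avg I (\<lambda>j. T i j)))"
    unfolding T_def by (subst energy_avg_expand) (auto intro: fsv)
  finally have sq: "(avg I (\<lambda>i. rbox (X i # Ys i) f))\<^sup>2 \<le> S * cmod (avg I (\<lambda>i. avg I (\<lambda>j. T i j)))" .
  let ?B = "\<lambda>i j. rbox (minkowski (X i) (X j) # Ys i @ Ys j) f"
  have T: "cmod (T i j) ^ 4 ^ m \<le> S ^ (4 ^ m - 1) * ?B i j" if ij: "i \<in># I" "j \<in># I" for i j
  proof -
    define V where "V a b = avg (pair_lists (Ys j)) (\<lambda>t'. avg (pair_lists (Ys i)) (\<lambda>t. total (\<lambda>z. dual f a t z * cnj (dual f b t' z))))" for a b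
    define F where "F a b z = f (z + b) * cnj (f (z + a))" for a b z
    define A where "A h = avg (X i) (\<lambda>x. avg (X i) (\<lambda>x'. avg (X j) (\<lambda>y. avg (X j) (\<lambda>y'. h (x' - x) (y' - y)))))"
      for h :: "'a \<Rightarrow> 'a \<Rightarrow> complex"
    define A' where "A' h = avg (X i) (\<lambda>x. avg (X i) (\<lambda>x'. avg (X j) (\<lambda>y. avg (X j) (\<lambda>y'. h (x' - x) (y' - y)))))"
      for h :: "'a \<Rightarrow> 'a \<Rightarrow> real"
    have fsd: "finsupp (\<lambda>z. dual f a t z * h z)" for a t h
      by (intro finsupp_mult_left finsupp_dual fsf)
    have "T i j = avg (X i) (\<lambda>x. avg (X i) (\<lambda>x'. avg (pair_lists (Ys i)) (\<lambda>t. avg (X j) (\<lambda>y. avg (X j) (\<lambda>y'.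
        avg (pair_lists (Ys j)) (\<lambda>t'. total (\<lambda>z. dual f (x' - x) t z * cnj (dual f (y' - y) t' z))))))))"
      unfolding T_def v_def cnj_avg avg_mult_right unfolding avg_mult_left
      by (subst total_avg, (intro finsupp_avg fsd)?)+ (rule refl)
    also have "\<dots> = A V"
      unfolding A_def V_def by (simp add: avg_swap[of "pair_lists (Ys i)"])
    finally have TV: "T i j = A V" .
    \<comment> \<open>Origin of the Minkowski sum: translation by x + y turns f(z + y' - y) and f(z
      + x' - x) into the values of f at z + (x + y') and z + (x' + y), which are shifts by
      independent elements of X i + X j.\<close>
    have BA: "avg (X i) (\<lambda>x. avg (X i) (\<lambda>x'. avg (X j) (\<lambda>y. avg (X j) (\<lambda>y'. G (F (x' - x) (y' - y))))))
        = avg (minkowski (X i) (X j)) (\<lambda>x. avg (minkowski (X i) (X j)) (\<lambda>x'. G (\<lambda>z. f (z + x) * cnj (f (z + x')))))"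
      if G: "\<And>h c. G (\<lambda>z. h (z + c)) = G h" for G :: "('a \<Rightarrow> complex) \<Rightarrow> 'c::real_vector"
    proof -
      have "G (F (x' - x) (y' - y)) = G (\<lambda>z. f (z + (x + y')) * cnj (f (z + (x' + y))))" for x x' y y'
        using G[of "F (x' - x) (y' - y)" "x + y"] by (simp add: F_def algebra_simps)
      then have "avg (X i) (\<lambda>x. avg (X i) (\<lambda>x'. avg (X j) (\<lambda>y. avg (X j) (\<lambda>y'. G (F (x' - x) (y' - y))))))
          = avg (X i) (\<lambda>x. avg (X i) (\<lambda>x'. avg (X j) (\<lambda>y. avg (X j) (\<lambda>y'.
              G (\<lambda>z. f (z + (x + y')) * cnj (f (z + (x' + y))))))))" by simp
      also have "\<dots> = avg (X i) (\<lambda>x. avg (X i) (\<lambda>x'. avg (X j) (\<lambda>y'. avg (X j) (\<lambda>y.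
              G (\<lambda>z. f (z + (x + y')) * cnj (f (z + (x' + y))))))))"
        by (intro avg_cong avg_swap)
      also have "\<dots> = avg (X i) (\<lambda>x. avg (X j) (\<lambda>y'. avg (X i) (\<lambda>x'. avg (X j) (\<lambda>y.
              G (\<lambda>z. f (z + (x + y')) * cnj (f (z + (x' + y))))))))"
        by (intro avg_cong, rule avg_swap)
      finally show ?thesis by (simp only: avg_minkowski)
    qed
    show ?thesis
    \<comment> \<open>Without further directions V a b is a complex number, and only the averages in
      A turn it into a box norm; so this case uses an equality instead of moduli.\<close>
    proof (cases "m = 0")
      case True
      then have "V a b = gbox (Ys i @ Ys j) (F a b)" for a b
        using avg_mderiv_pair_dual(1)[OF f len len, OF ij] by (simp add: V_def F_def[abs_def])
      then have "T i j = gbox (minkowski (X i) (X j) # Ys i @ Ys j) f"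
        unfolding TV A_def gbox_Cons by (simp add: BA gbox_shift)
      then show ?thesis using True by (simp add: cmod_box fsf)
    next
      case False
      then have m: "m > 0" by simp
      have V: "cmod (V a b) ^ 4 ^ m \<le> S ^ (4 ^ m - 1) * rbox (Ys i @ Ys j) (F a b)" for a b
        using avg_mderiv_pair_dual(2)[OF f len len, OF ij m] by (simp add: V_def F_def[abs_def])
      have n: "(1::nat) \<le> 4 ^ m" by simp
      have "cmod (T i j) ^ 4 ^ m \<le> A' (\<lambda>a b. cmod (V a b) ^ 4 ^ m)"
        unfolding TV A_def A'_def
        by (rule order_trans[OF norm_avg_power_le[OF n]] avg_mono norm_avg_power_le[OF n])+
      also have "\<dots> \<le> A' (\<lambda>a b. S ^ (4 ^ m - 1) * rbox (Ys i @ Ys j) (F a b))"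
        unfolding A'_def by (intro avg_mono V)
      also have "\<dots> = S ^ (4 ^ m - 1) * ?B i j"
        unfolding A'_def avg_mult_left[symmetric] rbox_Cons by (simp add: BA rbox_shift)
      finally show ?thesis .
    qed
  qed
  have n: "(1::nat) \<le> 4 ^ m" by simp
  have "avg I (\<lambda>i. rbox (X i # Ys i) f) ^ (2 * 4 ^ m) \<le> (S * cmod (avg I (\<lambda>i. avg I (\<lambda>j. T i j)))) ^ (4 ^ m)"
    unfolding power_mult by (rule power_mono[OF sq]) simp
  also have "\<dots> \<le> S ^ (4 ^ m) * avg I (\<lambda>i. avg I (\<lambda>j. S ^ (4 ^ m - 1) * ?B i j))"
    unfolding power_mult_distrib
    by (intro mult_left_mono order_trans[OF norm_avg_power_le[OF n]] avg_mono order_trans[OF norm_avg_power_le[OF n]] T)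
      (use S in auto)
  also have "\<dots> = S ^ (4 ^ m + (4 ^ m - 1)) * avg I (\<lambda>i. avg I (\<lambda>j. ?B i j))"
    by (simp only: avg_mult_left[symmetric] power_add mult_ac)
  also have "4 ^ m + (4 ^ m - 1) = 2 * 4 ^ m - (1::nat)" by simp
  finally show ?thesis .
qed

section \<open>Domination of multisets and additional directions\<close>

lemma minkowski_mono_left: "X \<subseteq># X' \<Longrightarrow> minkowski X Y \<subseteq># minkowski X' Y"
  by (metis minkowski_plus mset_subset_eq_add_left subset_mset.le_iff_add)

lemma minkowski_mono: "X \<subseteq># X' \<Longrightarrow> Y \<subseteq># Y' \<Longrightarrow> minkowski X Y \<subseteq># minkowski X' Y'"
  by (metis minkowski_mono_left minkowski_commute subset_mset.order_trans)

text \<open>\<open>X\<close> is covered by boundedly many translates of \<open>E\<close>, counted with multiplicity. This single notion covers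
  both the comparison of multiplicities and the passage from a long interval to a shorter one.\<close>

definition dominated :: "real \<Rightarrow> 'a::ab_group_add multiset \<Rightarrow> 'a multiset \<Rightarrow> bool" where
  "dominated b X E \<longleftrightarrow> (\<exists>Y. X \<subseteq># minkowski Y E \<and> real (size Y * size E) \<le> b * real (size X))"

lemma dominated_refl: "dominated 1 X X"
  unfolding dominated_def by (rule exI[of _ "{#0#}"]) simp

lemma dominated_mono: "dominated b X E \<Longrightarrow> b \<le> c \<Longrightarrow> dominated c X E"
  unfolding dominated_def by (meson mult_right_mono of_nat_0_le_iff order_trans)

lemma dominated_trans:
  assumes "dominated b X E" "dominated c E G" "b \<ge> 0" "c \<ge> 0"
  shows "dominated (b * c) X G"
proof -
  obtain Y where Y: "X \<subseteq># minkowski Y E" "real (size Y * size E) \<le> b * real (size X)"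
    using assms(1) by (auto simp: dominated_def)
  obtain Y' where Y': "E \<subseteq># minkowski Y' G" "real (size Y' * size G) \<le> c * real (size E)"
    using assms(2) by (auto simp: dominated_def)
  have "X \<subseteq># minkowski (minkowski Y Y') G"
    unfolding minkowski_assoc
    using Y(1) minkowski_mono[OF subset_mset.order_refl Y'(1), of Y] by (rule subset_mset.order_trans)
  moreover have "real (size (minkowski Y Y') * size G) \<le> real (size Y) * (c * real (size E))"
    using mult_left_mono[OF Y'(2), of "real (size Y)"] by simp
  moreover have "\<dots> \<le> c * (b * real (size X))"
    using mult_left_mono[OF Y(2) assms(4)] by (simp add: mult_ac)
  ultimately show ?thesis
    unfolding dominated_def by (intro exI[of _ "minkowski Y Y'"]) (simp add: mult_ac)
qed

lemma dominated_minkowski: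
  assumes "dominated b X E" "dominated b' X' E'" "b \<ge> 0" "b' \<ge> 0"
  shows "dominated (b * b') (minkowski X X') (minkowski E E')"
proof -
  obtain Y where Y: "X \<subseteq># minkowski Y E" "real (size Y * size E) \<le> b * real (size X)"
    using assms(1) by (auto simp: dominated_def)
  obtain Y' where Y': "X' \<subseteq># minkowski Y' E'" "real (size Y' * size E') \<le> b' * real (size X')"
    using assms(2) by (auto simp: dominated_def)
  have "minkowski (minkowski Y E) (minkowski Y' E') = minkowski (minkowski Y Y') (minkowski E E')"
    by (metis minkowski_assoc minkowski_commute)
  then have "minkowski X X' \<subseteq># minkowski (minkowski Y Y') (minkowski E E')"
    using minkowski_mono[OF Y(1) Y'(1)] by simp
  moreover have "real (size Y * size E) * real (size Y' * size E') \<le> (b * real (size X)) * (b' * real (size X'))"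
    by (rule mult_mono[OF Y(2) Y'(2)]) (use assms in auto)
  ultimately show ?thesis
    unfolding dominated_def by (intro exI[of _ "minkowski Y Y'"]) (simp add: mult_ac)
qed

text \<open>X + X' consists of translates of X. This takes care of the fourth summand once the first
  three have been compared with the target.\<close>

lemma dominated_extra:
  assumes "dominated b X E"
  shows "dominated b (minkowski X X') E"
proof -
  obtain Y where Y: "X \<subseteq># minkowski Y E" "real (size Y * size E) \<le> b * real (size X)"
    using assms(1) by (auto simp: dominated_def)
  have "minkowski X X' \<subseteq># minkowski (minkowski Y X') E"
    using minkowski_mono_left[OF Y(1), of X'] by (metis minkowski_assoc minkowski_commute)
  then show ?thesis using mult_right_mono[OF Y(2), of "real (size X')"]
    unfolding dominated_def by (intro exI[of _ "minkowski Y X'"]) (simp add: mult_ac)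
qed

lemma image_minkowski:
  assumes "\<And>x y. \<phi> (x + y) = \<phi> x + \<phi> y"
  shows "image_mset \<phi> (minkowski X Y) = minkowski (image_mset \<phi> X) (image_mset \<phi> Y)"
  by (induction X) (simp_all add: multiset.map_comp comp_def assms)

lemma dominated_image:
  assumes "dominated b X E" "\<And>x y. \<phi> (x + y) = \<phi> x + \<phi> y"
  shows "dominated b (image_mset \<phi> X) (image_mset \<phi> E)"
proof -
  obtain Y where Y: "X \<subseteq># minkowski Y E" "real (size Y * size E) \<le> b * real (size X)"
    using assms(1) by (auto simp: dominated_def)
  then show ?thesis
    unfolding dominated_def
    by (intro exI[of _ "image_mset \<phi> Y"]) (simp add: image_minkowski[OF assms(2), symmetric] image_mset_subseteq_mono)
qed

lemma dominated_sum:
  assumes "finite W" "\<And>w. w \<in> W \<Longrightarrow> dominated b (X w) (E w)" "b \<ge> 0"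
  shows "dominated (b ^ card W) (minkowski_sum.F X W) (minkowski_sum.F E W)"
  using assms
proof (induction W rule: finite_induct)
  case empty then show ?case by (simp add: dominated_refl)
next
  case (insert w W)
  then show ?case by (simp add: dominated_minkowski)
qed

section \<open>Effect of domination and of additional directions on box norms\<close>

lemma sum_mset_subset_mono:
  fixes g :: "_ \<Rightarrow> real"
  assumes "X \<subseteq># Y" "\<And>y. y \<in># Y \<Longrightarrow> g y \<ge> 0"
  shows "(\<Sum>x\<in>#X. g x) \<le> (\<Sum>y\<in>#Y. g y)"
proof -
  obtain Z where Z: "Y = X + Z" using assms(1) by (auto simp: subset_mset.le_iff_add)
  have "(\<Sum>z\<in>#Z. 0) \<le> (\<Sum>z\<in>#Z. g z)" using assms(2) Z by (intro sum_mset_mono) simp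
  then show ?thesis by (simp add: Z)
qed

lemma sum_mset_eq_avg: "X \<noteq> {#} \<Longrightarrow> (\<Sum>x\<in>#X. g x) = real (size X) * avg X g" for g :: "_ \<Rightarrow> real"
  by (simp add: avg_def)

lemma rbox_sum: "X \<noteq> {#} \<Longrightarrow> (real (size X))\<^sup>2 * rbox (X # L) f
   = (\<Sum>x\<in>#X. \<Sum>x'\<in>#X. rbox L (\<lambda>z. f (z + x) * cnj (f (z + x'))))"
  by (simp add: rbox_Cons sum_mset_eq_avg avg_mult_left power2_eq_square mult.assoc)

text \<open>Averaging a function over its translates by Y cannot increase the l2 norm.\<close>

lemma rbox_minkowski_le:
  assumes "finsupp f" shows "rbox (minkowski Y E # L) f \<le> rbox (E # L) f"
  unfolding rbox_Cons_energy[OF assms] avg_minkowski add.assoc[symmetric]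
proof (rule avg_mono)
  fix t
  have "finsupp (\<lambda>z. avg E (\<lambda>e. mderiv t f (z + e)))" by (intro finsupp_avg finsupp_shift finsupp_mderiv_pair assms)
  from energy_avg_shift_le[OF this, of Y]
  show "energy (\<lambda>z. avg Y (\<lambda>y. avg E (\<lambda>e. mderiv t f (z + y + e)))) \<le> energy (\<lambda>z. avg E (\<lambda>e. mderiv t f (z + e)))" .
qed

text \<open>All terms are nonnegative because L is nonempty, so both averages over X may be enlarged
  to the cover W. The factor b is paid once for each.\<close>

lemma rbox_dominated:
  assumes "dominated b X E" "finsupp f" "L \<noteq> []" "X \<noteq> {#}"
  shows "rbox (X # L) f \<le> b\<^sup>2 * rbox (E # L) f"
proof -
  obtain Y where Y: "X \<subseteq># minkowski Y E" "real (size Y * size E) \<le> b * real (size X)"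
    using assms(1) by (auto simp: dominated_def)
  define W where "W = minkowski Y E"
  have W: "X \<subseteq># W" "real (size W) \<le> b * real (size X)" "W \<noteq> {#}" using Y assms(4) by (auto simp: W_def)
  let ?Q = "\<lambda>x x'. rbox L (\<lambda>z. f (z + x) * cnj (f (z + x')))"
  have Q: "?Q x x' \<ge> 0" for x x'
    by (intro rbox_nonneg finsupp_mult_left finsupp_shift assms)
  have "(real (size X))\<^sup>2 * rbox (X # L) f = (\<Sum>x\<in>#X. \<Sum>x'\<in>#X. ?Q x x')"
    by (rule rbox_sum[OF assms(4)])
  also have "\<dots> \<le> (\<Sum>x\<in>#X. \<Sum>x'\<in>#W. ?Q x x')"
    by (intro sum_mset_mono sum_mset_subset_mono W Q)
  also have "\<dots> \<le> (\<Sum>x\<in>#W. \<Sum>x'\<in>#W. ?Q x x')"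
  proof (intro sum_mset_subset_mono W)
    fix y
    have "(\<Sum>x'\<in>#W. 0) \<le> (\<Sum>x'\<in>#W. ?Q y x')" by (intro sum_mset_mono Q)
    then show "(\<Sum>x'\<in>#W. ?Q y x') \<ge> 0" by simp
  qed
  also have "\<dots> = (real (size W))\<^sup>2 * rbox (W # L) f" by (rule rbox_sum[OF W(3), symmetric])
  also have "\<dots> \<le> (b * real (size X))\<^sup>2 * rbox (E # L) f"
    by (intro mult_mono power_mono W rbox_minkowski_le[OF assms(2), of Y E L, folded W_def] rbox_nonneg assms(2)) auto
  finally have "(real (size X))\<^sup>2 * rbox (X # L) f \<le> (real (size X))\<^sup>2 * (b\<^sup>2 * rbox (E # L) f)"
    by (simp add: power_mult_distrib mult_ac)
  then show ?thesis using assms(4) by simp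
qed

text \<open>The difference set A - E. If f lives on A, the average of f over its translates by E
  lives here.\<close>

definition thick :: "'a::ab_group_add set \<Rightarrow> 'a multiset \<Rightarrow> 'a set" where
  "thick A E = {z. \<exists>e\<in>#E. z + e \<in> A}"

lemma finite_thick: "finite A \<Longrightarrow> finite (thick A E)"
proof (rule finite_subset)
  show "thick A E \<subseteq> (\<lambda>(a, e). a - e) ` (A \<times> set_mset E)"
    by (auto simp: thick_def image_iff) (metis add_diff_cancel_right')
qed auto

lemma total_le_card:
  assumes "finite B" "{z. h z \<noteq> 0} \<subseteq> B"
  shows "(cmod (total h))\<^sup>2 \<le> real (card B) * energy h"
proof -
  let ?u = "\<lambda>z. if z \<in> B then 1 else 0 :: complex"
  have finsupp: "finsupp ?u" "finsupp h" using assms finite_subset by auto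
  have "h = (\<lambda>z. ?u z * h z)" using assms(2) by (auto simp: fun_eq_iff)
  then have "(cmod (total h))\<^sup>2 \<le> energy ?u * energy h" using total_cauchy_schwarz[OF finsupp] by simp
  moreover have "energy ?u = real (card B)"
    unfolding energy_def by (subst total_superset[of B]) (use assms in auto)
  ultimately show ?thesis by simp
qed

text \<open>Averaging a derivative over translates by E preserves its \<open>total\<close>, while
  the energy of the average is the one in the box norm with E added. Cauchy-Schwarz against the
  indicator of its support, of size at most T, compares the two.\<close>

lemma rbox_add_direction:
  assumes A: "finite A" "{z. f z \<noteq> 0} \<subseteq> A" and E: "E \<noteq> {#}" "real (card (thick A E)) \<le> T"
  shows "(rbox Xs f)\<^sup>2 \<le> T * rbox (E # Xs) f"
proof -
  have fsf: "finsupp f" using A finite_subset by blast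
  have "(rbox Xs f)\<^sup>2 \<le> (cmod (gbox Xs f))\<^sup>2"
    unfolding rbox_def using power_mono[OF abs_Re_le_cmod, of "gbox Xs f" 2] by simp
  also have "\<dots> \<le> avg (pair_lists Xs) (\<lambda>t. (cmod (total (mderiv t f)))\<^sup>2)"
    unfolding gbox_def by (rule norm_avg_power_le) simp
  also have "\<dots> \<le> avg (pair_lists Xs) (\<lambda>t. T * energy (\<lambda>z. avg E (\<lambda>e. mderiv t f (z + e))))"
  proof (rule avg_mono)
    fix t
    define h where "h z = avg E (\<lambda>e. mderiv t f (z + e))" for z
    have "total h = avg E (\<lambda>e. total (\<lambda>z. mderiv t f (z + e)))"
      unfolding h_def by (intro total_avg finsupp_shift finsupp_mderiv_pair fsf)
    also have "\<dots> = total (mderiv t f)" using E(1) by (simp add: total_shift avg_const)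
    finally have total: "total h = total (mderiv t f)" .
    have "h z = 0" if "z + base_shift t \<notin> thick A E" for z
      unfolding h_def
    proof (rule avg_zero)
      fix e assume "e \<in># E"
      then have "z + base_shift t + e \<notin> A" using that by (auto simp: thick_def)
      then have "f (z + e + base_shift t) = 0" using A(2) by (auto simp: add_ac)
      then show "mderiv t f (z + e) = 0" using mderiv_pair_support by blast
    qed
    then have "z \<in> (\<lambda>z. z - base_shift t) ` thick A E" if "h z \<noteq> 0" for z
      using that by (intro image_eqI[of _ _ "z + base_shift t"]) auto
    then have "{z. h z \<noteq> 0} \<subseteq> (\<lambda>z. z - base_shift t) ` thick A E" by auto
    then have "(cmod (total h))\<^sup>2 \<le> real (card ((\<lambda>z. z - base_shift t) ` thick A E)) * energy h"
      by (rule total_le_card[rotated]) (simp add: finite_thick A)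
    also have "card ((\<lambda>z. z - base_shift t) ` thick A E) = card (thick A E)"
      by (intro card_image inj_onI) simp
    finally have "(cmod (total h))\<^sup>2 \<le> T * energy h"
      using E(2) by (meson energy_nonneg mult_right_mono order_trans)
    then show "(cmod (total (mderiv t f)))\<^sup>2 \<le> T * energy (\<lambda>z. avg E (\<lambda>e. mderiv t f (z + e)))"
      unfolding total h_def .
  qed
  also have "\<dots> = T * rbox (E # Xs) f"
    by (simp add: rbox_Cons_energy[OF fsf] avg_mult_left)
  finally show ?thesis .
qed

lemma concatenation:
  assumes f: "one_bounded S f" and len: "\<And>i. i \<in># I \<Longrightarrow> length (Ys i) = m"
  shows "avg I (\<lambda>i. rbox (Zs @ X i # Ys i) f) ^ (2 * 4 ^ m)
    \<le> S ^ (2 * 4 ^ m - 1) * avg I (\<lambda>i. avg I (\<lambda>j. rbox (Zs @ minkowski (X i) (X j) # Ys i @ Ys j) f))"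
proof -
  have n: "(1::nat) \<le> 2 * 4 ^ m" by (simp add: Suc_le_eq)
  have fsf: "finsupp f" using f by (simp add: one_bounded_def)
  have "avg I (\<lambda>i. rbox (Zs @ X i # Ys i) f) ^ (2 * 4 ^ m)
      = avg (pair_lists Zs) (\<lambda>t. avg I (\<lambda>i. rbox (X i # Ys i) (mderiv t f))) ^ (2 * 4 ^ m)"
    by (simp only: rbox_append avg_swap[of I])
  also have "\<dots> \<le> avg (pair_lists Zs) (\<lambda>t. avg I (\<lambda>i. rbox (X i # Ys i) (mderiv t f)) ^ (2 * 4 ^ m))"
    by (intro avg_power_le[OF _ n] avg_nonneg rbox_nonneg finsupp_mderiv_pair fsf) auto
  also have "\<dots> \<le> avg (pair_lists Zs) (\<lambda>t. S ^ (2 * 4 ^ m - 1)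
      * avg I (\<lambda>i. avg I (\<lambda>j. rbox (minkowski (X i) (X j) # Ys i @ Ys j) (mderiv t f))))"
    by (intro avg_mono concatenation_step one_bounded_mderiv f len)
  also have "\<dots> = S ^ (2 * 4 ^ m - 1) * avg I (\<lambda>i. avg (pair_lists Zs) (\<lambda>t. avg I (\<lambda>j. rbox (minkowski (X i) (X j) # Ys i @ Ys j) (mderiv t f))))"
    by (simp only: avg_mult_left[symmetric]) (subst avg_swap, rule refl)
  also have "\<dots> = S ^ (2 * 4 ^ m - 1) * avg I (\<lambda>i. avg I (\<lambda>j. rbox (Zs @ minkowski (X i) (X j) # Ys i @ Ys j) f))"
    by (simp only: rbox_append[of Zs]) (subst (2) avg_swap, rule refl)
  finally show ?thesis .
qed

section \<open>Concatenation along one variable\<close>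

text \<open>Dividing by a common bound T for the support of f and for the sets
  \<open>thick A E\<close> cancels all powers of the support size, so neither T nor the dimension
  appears in the constants below.\<close>

definition nbox :: "real \<Rightarrow> ('a \<Rightarrow> complex) \<Rightarrow> 'a::ab_group_add multiset list \<Rightarrow> real" where
  "nbox T f Xs = rbox Xs f / T"

definition admissible :: "real \<Rightarrow> 'a::ab_group_add set \<Rightarrow> ('a \<Rightarrow> complex) \<Rightarrow> bool" where
  "admissible T A f \<longleftrightarrow> T > 0 \<and> one_bounded T f \<and> finite A \<and> {z. f z \<noteq> 0} \<subseteq> A"

definition fits :: "real \<Rightarrow> 'a::ab_group_add set \<Rightarrow> 'a multiset \<Rightarrow> bool" where
  "fits T A E \<longleftrightarrow> E \<noteq> {#} \<and> real (card (thick A E)) \<le> T"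

lemma admissible_finsupp: "admissible T A f \<Longrightarrow> finsupp f"
  by (simp add: admissible_def one_bounded_def)

lemma nbox_perm: "mset Xs = mset Ys \<Longrightarrow> nbox T f Xs = nbox T f Ys"
  unfolding nbox_def by (metis rbox_perm)

lemma nbox_nonneg: "admissible T A f \<Longrightarrow> Xs \<noteq> [] \<Longrightarrow> nbox T f Xs \<ge> 0"
  unfolding nbox_def by (intro divide_nonneg_nonneg rbox_nonneg admissible_finsupp) (auto simp: admissible_def)

lemma nbox_le_1: "admissible T A f \<Longrightarrow> Xs \<noteq> [] \<Longrightarrow> nbox T f Xs \<le> 1"
  unfolding nbox_def using rbox_le[of T f Xs] by (auto simp: admissible_def)

lemma nbox_add_direction:
  assumes "admissible T A f" "fits T A E"
  shows "(nbox T f Xs)\<^sup>2 \<le> nbox T f (E # Xs)"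
proof -
  have "(rbox Xs f)\<^sup>2 \<le> T * rbox (E # Xs) f"
    using assms by (intro rbox_add_direction) (auto simp: admissible_def fits_def)
  moreover have "T > 0" using assms by (simp add: admissible_def)
  ultimately show ?thesis
    by (simp add: nbox_def power_divide field_simps power2_eq_square)
qed

lemma nbox_add_directions:
  assumes "admissible T A f" "\<And>E. E \<in> set Es \<Longrightarrow> fits T A E" "Xs \<noteq> []"
  shows "nbox T f Xs ^ (2 ^ length Es) \<le> nbox T f (Es @ Xs)"
  using assms(2)
proof (induction Es)
  case (Cons E Es)
  have "nbox T f Xs ^ (2 ^ length (E # Es)) = (nbox T f Xs ^ (2 ^ length Es))\<^sup>2"
    by (simp add: power_mult[symmetric] mult.commute)
  also have "\<dots> \<le> (nbox T f (Es @ Xs))\<^sup>2"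
    using Cons.IH Cons.prems assms(3) by (intro power_mono zero_le_power nbox_nonneg[OF assms(1)]) auto
  also have "\<dots> \<le> nbox T f (E # Es @ Xs)"
    using Cons.prems by (intro nbox_add_direction[OF assms(1)]) auto
  finally show ?case by simp
qed simp

text \<open>Adding E first guarantees the further direction that the comparison with E requires. It
  costs the square and the second copy of E.\<close>

lemma nbox_replace:
  assumes "admissible T A f" "fits T A E" "dominated b X E" "X \<noteq> {#}"
  shows "(nbox T f (Zs @ X # Ys))\<^sup>2 \<le> b\<^sup>2 * nbox T f (Zs @ [E, E] @ Ys)"
proof -
  have "(nbox T f (Zs @ X # Ys))\<^sup>2 \<le> nbox T f (E # Zs @ X # Ys)"
    by (rule nbox_add_direction[OF assms(1,2)])
  also have "\<dots> = nbox T f (X # E # Zs @ Ys)"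
    by (rule nbox_perm) simp
  also have "\<dots> \<le> b\<^sup>2 * nbox T f (E # E # Zs @ Ys)"
    using rbox_dominated[OF assms(3) admissible_finsupp[OF assms(1)] _ assms(4), of "E # Zs @ Ys"] assms(1)
    by (simp add: nbox_def admissible_def divide_right_mono)
  also have "nbox T f (E # E # Zs @ Ys) = nbox T f (Zs @ [E, E] @ Ys)"
    by (rule nbox_perm) simp
  finally show ?thesis .
qed

lemma nbox_concatenation:
  assumes "admissible T A f" and len: "\<And>i. i \<in># I \<Longrightarrow> length (Ys i) = m"
  shows "avg I (\<lambda>i. nbox T f (Zs @ X i # Ys i)) ^ (2 * 4 ^ m)
    \<le> avg I (\<lambda>i. avg I (\<lambda>j. nbox T f (Zs @ minkowski (X i) (X j) # Ys i @ Ys j)))"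
proof -
  have T: "T > 0" and f: "one_bounded T f" using assms by (auto simp: admissible_def)
  have n: "avg J (\<lambda>i. g i / T) = avg J g / T" for J and g :: "_ \<Rightarrow> real"
    by (simp only: divide_inverse avg_mult_right)
  have "2 * 4 ^ m = Suc (2 * 4 ^ m - 1)" by simp
  then have "T ^ (2 * 4 ^ m) = T ^ (2 * 4 ^ m - 1) * T" by (metis power_Suc mult.commute)
  with concatenation[OF f len, where Zs = Zs and X = X] T show ?thesis
    by (simp add: nbox_def n power_divide field_simps)
qed

text \<open>Concatenation produces four indices, each with its own copy of the remaining directions.\<close>

fun spread :: "'b list \<Rightarrow> 'b list" where
  "spread [] = []"
| "spread (x # xs) = [x, x] @ spread xs @ spread xs @ spread xs @ spread xs"

lemma spread_map: "spread (map g xs) = map g (spread xs)"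
  by (induction xs) auto

lemma set_spread: "set (spread xs) = set xs"
  by (induction xs) auto

text \<open>The loss has to be a power of 1/\<eta>: later \<eta> is proportional to the average
  under study, and such a loss is absorbed by a higher power of this average. Four indices arise
  from two concatenations.\<close>

definition equidistributed :: "real \<Rightarrow> nat \<Rightarrow> 'i multiset \<Rightarrow> ('i \<Rightarrow> 'a::ab_group_add multiset) \<Rightarrow> 'a multiset \<Rightarrow> bool" where
  "equidistributed k c I F G \<longleftrightarrow> (\<forall>\<eta>. 0 < \<eta> \<and> \<eta> \<le> 1 \<longrightarrow> (\<exists>Bad.
     avg I (\<lambda>a. avg I (\<lambda>b. avg I (\<lambda>a'. avg I (\<lambda>b'. if Bad a b a' b' then 1 else (0::real))))) \<le> \<eta> \<and>
     (\<forall>a\<in>#I. \<forall>b\<in>#I. \<forall>a'\<in>#I. \<forall>b'\<in>#I. \<not> Bad a b a' b' \<longrightarrow>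
       dominated (k * (1 / \<eta>) ^ c) (minkowski (minkowski (F a) (F b)) (minkowski (F a') (F b'))) G)))"

lemma power_chain:
  fixes x y z :: real
  assumes "x ^ P \<le> K * y" "y ^ Q \<le> K' * z" "0 \<le> x" "0 \<le> K"
  shows "x ^ (P * Q) \<le> (K ^ Q * K') * z"
proof -
  have "x ^ (P * Q) \<le> (K * y) ^ Q"
    unfolding power_mult using assms by (intro power_mono) auto
  also have "\<dots> = K ^ Q * y ^ Q" by (rule power_mult_distrib)
  also have "\<dots> \<le> K ^ Q * (K' * z)" using assms by (intro mult_left_mono) auto
  finally show ?thesis by simp
qed

lemma minkowski_nonempty: "X \<noteq> {#} \<Longrightarrow> Y \<noteq> {#} \<Longrightarrow> minkowski X Y \<noteq> {#}"
  using size_minkowski[of X Y] by (metis mult_eq_0_iff size_eq_0_iff_empty)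

text \<open>Concatenation is applied over I with n remaining directions, then over pairs with n + n;
  these give the first two factors of the exponent. In 2 + 2c, the 2 is the square in
  \<open>nbox_replace\<close> and 2c stems from the squared loss.\<close>

lemma one_family:
  fixes k :: real
  assumes adm: "admissible T A f" and G: "fits T A G" and k: "k \<ge> 0" and I: "I \<noteq> {#}"
    and F: "\<And>h. h \<in># I \<Longrightarrow> F h \<noteq> {#}" and eq: "equidistributed k c I F G"
    and len: "\<And>h. h \<in># I \<Longrightarrow> length (Ys h) = n"
  shows "avg I (\<lambda>h. nbox T f (Zs @ F h # Ys h)) ^ (2 * 4 ^ n * (2 * 4 ^ (n + n)) * (2 + 2 * c))
    \<le> 2 ^ (2 + 2 * c) * k\<^sup>2 * avg I (\<lambda>a. avg I (\<lambda>b. avg I (\<lambda>a'. avg I (\<lambda>b'.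
        nbox T f (Zs @ [G, G] @ Ys a @ Ys b @ Ys a' @ Ys b')))))"
proof -
  define J where "J = mtimes (mtimes I I) (mtimes I I)"
  define X where "X = (\<lambda>((a, b), (a', b')). minkowski (minkowski (F a) (F b)) (minkowski (F a') (F b')))"
  define Y where "Y = (\<lambda>((a, b), (a', b')). Ys a @ Ys b @ Ys a' @ Ys b')"
  have J: "J \<noteq> {#}" using I unfolding J_def by (metis size_mtimes mult_eq_0_iff size_eq_0_iff_empty)
  define \<alpha> where "\<alpha> = avg I (\<lambda>h. nbox T f (Zs @ F h # Ys h))"
  define \<beta> where "\<beta> = \<alpha> ^ (2 * 4 ^ n * (2 * 4 ^ (n + n)))"
  define \<Phi> where "\<Phi> j = nbox T f (Zs @ X j # Y j)" for j
  define \<Psi> where "\<Psi> j = nbox T f (Zs @ [G, G] @ Y j)" for j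
  have \<alpha>: "\<alpha> \<ge> 0" unfolding \<alpha>_def by (intro avg_nonneg nbox_nonneg[OF adm]) auto
  have \<Phi>: "0 \<le> \<Phi> j" "\<Phi> j \<le> 1" for j unfolding \<Phi>_def by (intro nbox_nonneg[OF adm] nbox_le_1[OF adm]; simp)+
  have \<Psi>: "0 \<le> \<Psi> j" for j unfolding \<Psi>_def by (intro nbox_nonneg[OF adm]) simp
  have "\<alpha> ^ (2 * 4 ^ n) \<le> avg (mtimes I I) (\<lambda>(a, b). nbox T f (Zs @ minkowski (F a) (F b) # Ys a @ Ys b))"
    unfolding \<alpha>_def avg_mtimes case_prod_conv by (rule nbox_concatenation[OF adm len])
  then have "\<beta> \<le> (avg (mtimes I I) (\<lambda>(a, b). nbox T f (Zs @ minkowski (F a) (F b) # Ys a @ Ys b))) ^ (2 * 4 ^ (n + n))"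
    unfolding \<beta>_def power_mult using \<alpha> by (intro power_mono zero_le_power)
  also have "\<dots> \<le> avg J \<Phi>"
  proof -
    have "avg (mtimes I I) (\<lambda>p. nbox T f (Zs @ (case p of (a, b) \<Rightarrow> minkowski (F a) (F b)) # (case p of (a, b) \<Rightarrow> Ys a @ Ys b))) ^ (2 * 4 ^ (n + n))
      \<le> avg (mtimes I I) (\<lambda>p. avg (mtimes I I) (\<lambda>q. nbox T f (Zs @ minkowski (case p of (a, b) \<Rightarrow> minkowski (F a) (F b)) (case q of (a, b) \<Rightarrow> minkowski (F a) (F b))
         # (case p of (a, b) \<Rightarrow> Ys a @ Ys b) @ (case q of (a, b) \<Rightarrow> Ys a @ Ys b))))"
      by (rule nbox_concatenation[OF adm]) (auto simp: len)
    then show ?thesis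
      by (simp add: J_def \<Phi>_def X_def Y_def avg_mtimes)
  qed
  finally have \<beta>: "\<beta> \<le> avg J \<Phi>" .
  have \<beta>0: "\<beta> \<ge> 0" unfolding \<beta>_def using \<alpha> by simp
  have "(\<beta> / 2) ^ (2 + 2 * c) \<le> k\<^sup>2 * avg J \<Psi>"
  proof (cases "\<beta> = 0")
    case True
    then show ?thesis using avg_nonneg[of J \<Psi>] \<Psi> by simp
  next
    case False
    \<comment> \<open>Normalised box norms are at most 1, so bad quadruples of density \<eta> carry
      at most \<eta> of the average, and at least half of \<beta> is left on the good ones.\<close>
    define \<eta> where "\<eta> = \<beta> / 2"
    have "avg J \<Phi> \<le> 1" by (rule avg_le_const) (use \<Phi> in auto)
    then have \<eta>: "0 < \<eta>" "\<eta> \<le> 1" using False \<beta>0 \<beta> by (auto simp: \<eta>_def)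
    obtain Bad where Bad:
      "avg I (\<lambda>a. avg I (\<lambda>b. avg I (\<lambda>a'. avg I (\<lambda>b'. if Bad a b a' b' then 1 else (0::real))))) \<le> \<eta>"
      "\<And>a b a' b'. a \<in># I \<Longrightarrow> b \<in># I \<Longrightarrow> a' \<in># I \<Longrightarrow> b' \<in># I \<Longrightarrow> \<not> Bad a b a' b' \<Longrightarrow>
        dominated (k * (1 / \<eta>) ^ c) (minkowski (minkowski (F a) (F b)) (minkowski (F a') (F b'))) G"
      using eq \<eta> unfolding equidistributed_def by meson
    define B where "B = (\<lambda>((a, b), (a', b')). Bad a b a' b')"
    define gd where "gd j = (if B j then 0 else \<Phi> j)" for j
    have "avg J \<Phi> \<le> avg J (\<lambda>j. (if B j then 1 else 0) + gd j)"
      by (rule avg_mono) (use \<Phi> in \<open>auto simp: gd_def\<close>)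
    also have "\<dots> = avg J (\<lambda>j. if B j then 1 else 0) + avg J gd" by (rule avg_add)
    also have "avg J (\<lambda>j. if B j then 1 else (0::real)) \<le> \<eta>"
      using Bad(1) by (simp add: J_def B_def avg_mtimes)
    finally have "\<eta> \<le> avg J gd" using \<beta> by (simp add: \<eta>_def)
    then have "\<eta>\<^sup>2 \<le> (avg J gd)\<^sup>2" using \<eta> by (intro power_mono) auto
    also have "\<dots> \<le> avg J (\<lambda>j. (gd j)\<^sup>2)" by (rule avg_power_le) (auto simp: gd_def \<Phi>)
    also have "\<dots> \<le> avg J (\<lambda>j. (k * (1 / \<eta>) ^ c)\<^sup>2 * \<Psi> j)"
    proof (rule avg_mono)
      fix j assume j: "j \<in># J"
      obtain a b a' b' where abab: "j = ((a, b), (a', b'))" by (metis surj_pair)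
      have mem: "a \<in># I" "b \<in># I" "a' \<in># I" "b' \<in># I" using j by (auto simp: J_def abab)
      show "(gd j)\<^sup>2 \<le> (k * (1 / \<eta>) ^ c)\<^sup>2 * \<Psi> j"
      proof (cases "B j")
        case True
        then show ?thesis using \<Psi>[of j] by (simp add: gd_def)
      next
        case False
        then have "dominated (k * (1 / \<eta>) ^ c) (X j) G"
          using Bad(2)[OF mem] by (simp add: X_def B_def abab)
        moreover have "X j \<noteq> {#}" unfolding X_def abab by (simp add: minkowski_nonempty F mem)
        ultimately show ?thesis
          using nbox_replace[OF adm G, of _ "X j" Zs "Y j"] False by (simp add: gd_def \<Phi>_def \<Psi>_def)
      qed
    qed
    also have "\<dots> = (k * (1 / \<eta>) ^ c)\<^sup>2 * avg J \<Psi>" by (simp only: avg_mult_left)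
    finally have "\<eta>\<^sup>2 \<le> k\<^sup>2 * ((1 / \<eta>) ^ c)\<^sup>2 * avg J \<Psi>" by (simp add: power_mult_distrib)
    \<comment> \<open>Multiplication by \<eta>^(2c) cancels the loss and leaves a pure power of
      \<eta>.\<close>
    then have "\<eta>\<^sup>2 * (\<eta> ^ c)\<^sup>2 \<le> (k\<^sup>2 * ((1 / \<eta>) ^ c)\<^sup>2 * avg J \<Psi>) * (\<eta> ^ c)\<^sup>2"
      by (intro mult_right_mono) auto
    also have "\<dots> = k\<^sup>2 * avg J \<Psi>" using \<eta> by (simp add: power_one_over field_simps)
    also have "\<eta>\<^sup>2 * (\<eta> ^ c)\<^sup>2 = \<eta> ^ (2 + 2 * c)" by (simp only: power_add power_mult[symmetric] mult.commute[of c])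
    finally show ?thesis by (simp add: \<eta>_def)
  qed
  then have "\<beta> ^ (2 + 2 * c) \<le> 2 ^ (2 + 2 * c) * (k\<^sup>2 * avg J \<Psi>)"
    by (simp add: power_divide field_simps)
  moreover have "avg J \<Psi> = avg I (\<lambda>a. avg I (\<lambda>b. avg I (\<lambda>a'. avg I (\<lambda>b'.
        nbox T f (Zs @ [G, G] @ Ys a @ Ys b @ Ys a' @ Ys b')))))"
    by (simp add: J_def avg_mtimes \<Psi>_def Y_def)
  ultimately show ?thesis by (simp only: \<beta>_def \<alpha>_def power_mult[symmetric] mult.assoc)
qed

lemma avg_nbox_chain:
  assumes adm: "admissible T A f" and P: "P \<ge> 1" and K: "K \<ge> 0" and L: "\<And>j. j \<in># J \<Longrightarrow> L j \<noteq> []"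
    and step: "\<And>Zs. avg I (\<lambda>h. nbox T f (Zs @ Ys h)) ^ P \<le> K * nbox T f (Zs @ R)"
  shows "avg J (\<lambda>j. avg I (\<lambda>h. nbox T f (L j @ Ys h))) ^ P \<le> K * avg J (\<lambda>j. nbox T f (L j @ R))"
proof -
  have "avg J (\<lambda>j. avg I (\<lambda>h. nbox T f (L j @ Ys h))) ^ P \<le> avg J (\<lambda>j. avg I (\<lambda>h. nbox T f (L j @ Ys h)) ^ P)"
    by (intro avg_power_le P avg_nonneg nbox_nonneg[OF adm]) (use L in auto)
  also have "\<dots> \<le> avg J (\<lambda>j. K * nbox T f (L j @ R))" by (intro avg_mono step)
  finally show ?thesis by (simp only: avg_mult_left)
qed

text \<open>The four blocks carry independent indices, so the bound for one index applies to each
  block in turn while the other three count as fixed directions. A nonempty L keeps all intermediate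
  averages nonnegative.\<close>

lemma four_fold_chain:
  fixes Ys :: "'i \<Rightarrow> 'a::ab_group_add multiset list"
  assumes adm: "admissible T A f" and P: "P \<ge> 1" and K: "K \<ge> 0" and L: "L \<noteq> []"
    and step: "\<And>Zs. avg I (\<lambda>h. nbox T f (Zs @ Ys h)) ^ P \<le> K * nbox T f (Zs @ R)"
  shows "avg I (\<lambda>a. avg I (\<lambda>b. avg I (\<lambda>a'. avg I (\<lambda>b'. nbox T f (L @ Ys a @ Ys b @ Ys a' @ Ys b'))))) ^ (P * P * P * P)
     \<le> (((K ^ P * K) ^ P * K) ^ P * K) * nbox T f (L @ R @ R @ R @ R)"
proof -
  let ?N = "\<lambda>A B C D. nbox T f (L @ A @ B @ C @ D)"
  have perm: "?N A B C D = nbox T f ((L @ A @ B @ D) @ C)" "?N A B C D = nbox T f ((L @ A @ C @ D) @ B)"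
    "?N A B C D = nbox T f ((L @ B @ C @ D) @ A)" for A B C D
    by (rule nbox_perm, simp)+
  define x4 where "x4 = avg I (\<lambda>a. avg I (\<lambda>b. avg I (\<lambda>a'. avg I (\<lambda>b'. ?N (Ys a) (Ys b) (Ys a') (Ys b')))))"
  define x3 where "x3 = avg I (\<lambda>a. avg I (\<lambda>b. avg I (\<lambda>a'. ?N (Ys a) (Ys b) (Ys a') R)))"
  define x2 where "x2 = avg I (\<lambda>a. avg I (\<lambda>b. ?N (Ys a) (Ys b) R R))"
  define x1 where "x1 = avg I (\<lambda>a. ?N (Ys a) R R R)"
  have nn: "?N A B C D \<ge> 0" for A B C D by (intro nbox_nonneg[OF adm]) (use L in auto)
  note ch = avg_nbox_chain[OF adm P K _ step]
  have 4: "x4 ^ P \<le> K * x3"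
    using ch[of "mtimes I (mtimes I I)" "\<lambda>(a, b, a'). L @ Ys a @ Ys b @ Ys a'"] L
    by (simp add: x4_def x3_def avg_mtimes split_beta)
  have "x3 = avg I (\<lambda>a. avg I (\<lambda>b. avg I (\<lambda>a'. nbox T f ((L @ Ys a @ Ys b @ R) @ Ys a'))))"
    unfolding x3_def by (intro avg_cong perm(1))
  then have 3: "x3 ^ P \<le> K * x2"
    using ch[of "mtimes I I" "\<lambda>(a, b). L @ Ys a @ Ys b @ R"] L by (simp add: x2_def avg_mtimes split_beta)
  have "x2 = avg I (\<lambda>a. avg I (\<lambda>b. nbox T f ((L @ Ys a @ R @ R) @ Ys b)))"
    unfolding x2_def by (intro avg_cong perm(2))
  then have 2: "x2 ^ P \<le> K * x1"
    using ch[of I "\<lambda>a. L @ Ys a @ R @ R"] L by (simp add: x1_def)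
  have "x1 = avg I (\<lambda>a. nbox T f ((L @ R @ R @ R) @ Ys a))"
    unfolding x1_def by (intro avg_cong perm(3))
  then have 1: "x1 ^ P \<le> K * ?N R R R R"
    using step[of "L @ R @ R @ R"] by simp
  have nx: "x4 \<ge> 0" "x3 \<ge> 0" "x2 \<ge> 0" "x1 \<ge> 0"
    unfolding x4_def x3_def x2_def x1_def by (intro avg_nonneg nn)+
  have "x4 ^ (P * P) \<le> (K ^ P * K) * x2" by (rule power_chain[OF 4 3 nx(1) K])
  then have "x4 ^ (P * P * P) \<le> ((K ^ P * K) ^ P * K) * x1" by (rule power_chain[OF _ 2 nx(1)]) (use K in simp)
  then show ?thesis unfolding x4_def[symmetric] by (rule power_chain[OF _ 1 nx(1)]) (use K in simp)
qed

text \<open>P and K are chosen before T, A, f and I, which makes the final constants uniform. The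
  induction is on the number of families; Zs holds the directions already freed from the
  variable.\<close>

lemma one_variable:
  fixes k :: real
  assumes k: "k \<ge> 0"
  shows "\<exists>P K. P \<ge> (1::nat) \<and> K \<ge> (0::real) \<and> (\<forall>T A f (I :: 'i multiset) Zs Fs (Gs :: 'a::ab_group_add multiset list).
    admissible T A f \<longrightarrow> I \<noteq> {#} \<longrightarrow> length Fs = n \<longrightarrow> list_all2 (equidistributed k c I) Fs Gs \<longrightarrow>
    (\<forall>G\<in>set Gs. fits T A G) \<longrightarrow> (\<forall>F\<in>set Fs. \<forall>h\<in>#I. F h \<noteq> {#}) \<longrightarrow>
    avg I (\<lambda>h. nbox T f (Zs @ map (\<lambda>F. F h) Fs)) ^ P \<le> K * nbox T f (Zs @ spread Gs))"
proof (induction n)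
  case 0
  show ?case
    by (intro exI[of _ 1]) (auto simp: avg_const)
next
  case (Suc n)
  then obtain P K where P: "P \<ge> 1" and K: "K \<ge> 0" and IH: "\<forall>T A f (I :: 'i multiset) Zs Fs (Gs :: 'a multiset list).
    admissible T A f \<longrightarrow> I \<noteq> {#} \<longrightarrow> length Fs = n \<longrightarrow> list_all2 (equidistributed k c I) Fs Gs \<longrightarrow>
    (\<forall>G\<in>set Gs. fits T A G) \<longrightarrow> (\<forall>F\<in>set Fs. \<forall>h\<in>#I. F h \<noteq> {#}) \<longrightarrow>
    avg I (\<lambda>h. nbox T f (Zs @ map (\<lambda>F. F h) Fs)) ^ P \<le> K * nbox T f (Zs @ spread Gs)"
    by (elim exE conjE)
  note IH = IH[THEN spec, THEN spec, THEN spec, THEN spec, THEN spec, THEN spec, THEN spec,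
      THEN mp, THEN mp, THEN mp, THEN mp, THEN mp, THEN mp]
  define p where "p = 2 * 4 ^ n * (2 * 4 ^ (n + n)) * (2 + 2 * c)"
  define q where "q = P * P * P * P"
  define K1 where "K1 = 2 ^ (2 + 2 * c) * k\<^sup>2"
  define K2 where "K2 = (((K ^ P * K) ^ P * K) ^ P * K)"
  have K1: "K1 \<ge> 0" by (simp add: K1_def)
  have K2: "K2 \<ge> 0" using K by (simp add: K2_def)
  have main: "avg I (\<lambda>h. nbox T f (Zs @ map (\<lambda>F. F h) Fs)) ^ (p * q) \<le> (K1 ^ q * K2) * nbox T f (Zs @ spread Gs)"
    if adm: "admissible T A f" and I: "I \<noteq> {#}" and len: "length Fs = Suc n"
      and eq: "list_all2 (equidistributed k c I) Fs Gs" and fit: "\<forall>G\<in>set Gs. fits T A G"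
      and ne: "\<forall>F\<in>set Fs. \<forall>h\<in>#I. F h \<noteq> {#}"
    for T A f and I :: "'i multiset" and Zs Fs and Gs :: "'a multiset list"
  proof -
    obtain F Fs' where Fs: "Fs = F # Fs'" using len by (cases Fs) auto
    obtain G Gs' where Gs: "Gs = G # Gs'" using eq Fs by (cases Gs) auto
    define Ys where "Ys h = map (\<lambda>F. F h) Fs'" for h
    have "avg I (\<lambda>h. nbox T f (Zs @ F h # Ys h)) ^ p
      \<le> K1 * avg I (\<lambda>a. avg I (\<lambda>b. avg I (\<lambda>a'. avg I (\<lambda>b'. nbox T f (Zs @ [G, G] @ Ys a @ Ys b @ Ys a' @ Ys b')))))"
      unfolding p_def K1_def
      by (rule one_family[OF adm _ k I]) (use fit ne eq len in \<open>auto simp: Fs Gs Ys_def\<close>)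
    moreover have "avg I (\<lambda>a. avg I (\<lambda>b. avg I (\<lambda>a'. avg I (\<lambda>b'. nbox T f ((Zs @ [G, G]) @ Ys a @ Ys b @ Ys a' @ Ys b'))))) ^ q
      \<le> K2 * nbox T f ((Zs @ [G, G]) @ spread Gs' @ spread Gs' @ spread Gs' @ spread Gs')"
      unfolding q_def K2_def Ys_def
      by (rule four_fold_chain[OF adm P K])
        (use fit ne eq len in \<open>auto simp: Fs Gs intro!: IH[OF adm I]\<close>)
    ultimately have "avg I (\<lambda>h. nbox T f (Zs @ F h # Ys h)) ^ (p * q)
      \<le> (K1 ^ q * K2) * nbox T f ((Zs @ [G, G]) @ spread Gs' @ spread Gs' @ spread Gs' @ spread Gs')"
      by (intro power_chain[where y = "avg I (\<lambda>a. avg I (\<lambda>b. avg I (\<lambda>a'. avg I (\<lambda>b'. nbox T f (Zs @ [G, G] @ Ys a @ Ys b @ Ys a' @ Ys b')))))"])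
        (auto intro!: avg_nonneg nbox_nonneg[OF adm] K1)
    then show ?thesis by (simp add: Fs Gs Ys_def)
  qed
  have "p * q \<ge> 1" using P by (simp add: p_def q_def Suc_le_eq)
  moreover have "K1 ^ q * K2 \<ge> 0" using K1 K2 by simp
  ultimately show ?case
    by (intro exI[of _ "p * q"] exI[of _ "K1 ^ q * K2"] conjI allI impI) (assumption | rule main)+
qed

section \<open>Equidistribution of bilinear progressions\<close>

lemma finite_pm [simp]: "finite (pm X)"
  by (simp add: pm_def)

lemma card_pm [simp]: "card (pm X) = 2 * X + 1"
  by (simp add: pm_def)

lemma mem_pm: "x \<in> pm X \<longleftrightarrow> \<bar>x\<bar> \<le> int X"
  by (auto simp: pm_def)

text \<open>Inside a residue class modulo d the quotient of n + L by d determines n, and it ranges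
  over 0, ..., 2L div d.\<close>

lemma card_residue_class_le:
  fixes S :: "int set"
  assumes "S \<subseteq> pm L" "d > 0" "\<And>x y. x \<in> S \<Longrightarrow> y \<in> S \<Longrightarrow> int d dvd x - y"
  shows "card S \<le> 2 * L div d + 1"
proof -
  have "inj_on (\<lambda>n. (n + int L) div int d) S"
  proof (rule inj_onI)
    fix x y assume xy: "x \<in> S" "y \<in> S" "(x + int L) div int d = (y + int L) div int d"
    have "(x + int L) mod int d = (y + int L) mod int d"
      using assms(3)[OF xy(1,2)] by (simp add: mod_eq_dvd_iff)
    with xy(3) have "x + int L = y + int L" by (metis div_mult_mod_eq)
    then show "x = y" by simp
  qed
  then have "card S = card ((\<lambda>n. (n + int L) div int d) ` S)" by (simp add: card_image)
  also have "\<dots> \<le> card {0..int (2 * L div d)}"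
  proof (intro card_mono)
    show "(\<lambda>n. (n + int L) div int d) ` S \<subseteq> {0..int (2 * L div d)}"
    proof
      fix z assume "z \<in> (\<lambda>n. (n + int L) div int d) ` S"
      then obtain n where n: "n \<in> S" "z = (n + int L) div int d" by auto
      then have "0 \<le> n + int L" "n + int L \<le> int (2 * L)" using assms(1) by (auto simp: pm_def)
      then show "z \<in> {0..int (2 * L div d)}"
        using assms(2) by (auto simp: n(2) zdiv_int zdiv_mono1 pos_imp_zdiv_nonneg_iff)
    qed
  qed simp
  finally show ?thesis by simp
qed

lemma sum_of_bool_unique_le:
  assumes "finite A" "\<And>x y. x \<in> A \<Longrightarrow> y \<in> A \<Longrightarrow> P x \<Longrightarrow> P y \<Longrightarrow> x = y"
  shows "(\<Sum>x\<in>A. if P x then 1 else 0) \<le> (if \<exists>x\<in>A. P x then 1 else (0::nat))"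
proof -
  have "card {x \<in> A. P x} \<le> 1"
    unfolding One_nat_def using assms by (subst card_le_Suc0_iff_eq) auto
  moreover have "{x \<in> A. P x} = {}" if "\<not> (\<exists>x\<in>A. P x)" using that by auto
  ultimately show ?thesis
    using assms(1) by (auto simp: sum.If_cases Int_def)
qed

text \<open>As q \<noteq> 0, each x admits at most one y, and two admissible x differ by a multiple
  of |q| / gcd(p, q).\<close>

lemma card_solutions_le:
  fixes p q w :: int
  assumes "q \<noteq> 0"
  shows "(\<Sum>x\<in>pm L. \<Sum>y\<in>pm L. if p * x + q * y = w then 1 else 0) \<le> 2 * L div (nat \<bar>q\<bar> div nat (gcd p q)) + 1"
proof -
  define g where "g = gcd p q"
  define d where "d = nat \<bar>q\<bar> div nat g"
  have g: "g > 0" "g dvd q" using assms by (auto simp: g_def)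
  have d: "int d = \<bar>q\<bar> div g" using g by (simp add: d_def zdiv_int)
  have d0: "d > 0"
  proof -
    have "\<bar>q\<bar> \<ge> g" using g assms by (simp add: zdvd_imp_le)
    then have "\<bar>q\<bar> div g > 0" using g by (simp add: pos_imp_zdiv_pos_iff)
    then show ?thesis using d by linarith
  qed
  define S where "S = {x \<in> pm L. \<exists>y\<in>pm L. p * x + q * y = w}"
  have "(\<Sum>x\<in>pm L. \<Sum>y\<in>pm L. if p * x + q * y = w then 1 else 0) \<le> (\<Sum>x\<in>pm L. if \<exists>y\<in>pm L. p * x + q * y = w then 1 else (0::nat))"
    using assms by (intro sum_mono sum_of_bool_unique_le) auto
  also have "\<dots> = card S"
    by (simp add: S_def sum.If_cases Int_def)
  also have "\<dots> \<le> 2 * L div d + 1"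
  proof (rule card_residue_class_le[OF _ d0])
    fix x x' assume "x \<in> S" "x' \<in> S"
    then obtain y y' where "p * x + q * y = w" "p * x' + q * y' = w" by (auto simp: S_def)
    then have "p * (x - x') = q * (y' - y)" by (simp add: algebra_simps)
    then have "q dvd p * (x - x')" by simp
    then have "\<bar>q\<bar> div g dvd x - x'"
    proof -
      obtain p' q' where pq: "p = g * p'" "q = g * q'" "coprime p' q'"
        using gcd_coprime_exists[of p q] g unfolding g_def by (metis less_irrefl mult.commute)
      have "g * q' dvd g * (p' * (x - x'))" using \<open>q dvd p * (x - x')\<close> by (simp add: pq mult.assoc)
      then have "q' dvd p' * (x - x')" using g by simp
      then have "q' dvd x - x'" using pq(3) by (simp add: coprime_commute coprime_dvd_mult_right_iff)
      moreover have "\<bar>q\<bar> div g = \<bar>q'\<bar>" using g by (simp add: pq abs_mult)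
      ultimately show ?thesis by simp
    qed
    then show "int d dvd x - x'" by (simp add: d)
  qed (auto simp: S_def)
  finally show ?thesis by (simp add: d_def g_def)
qed

section \<open>Sums of three lines compared with a rectangle in \<int>^2\<close>

lemma set_minkowski: "set_mset (minkowski X Y) = {x + y |x y. x \<in># X \<and> y \<in># Y}"
  by (induction X) auto

lemma minkowski_repeat: "minkowski (repeat_mset m Y) E = repeat_mset m (minkowski Y E)"
  by (induction m) (simp_all add: minkowski_plus)

text \<open>Repeating every translate of a cover m times accounts for multiplicities up to
  m.\<close>

lemma dominated_by_cover:
  assumes "\<And>z. count X z \<le> m" "set_mset X \<subseteq> set_mset (minkowski Y E)"
    "real (m * size Y * size E) \<le> b * real (size X)"
  shows "dominated b X E"
  unfolding dominated_def
proof (intro exI[of _ "repeat_mset m Y"] conjI)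
  show "X \<subseteq># minkowski (repeat_mset m Y) E"
    unfolding minkowski_repeat
  proof (rule mset_subset_eqI)
    fix z
    show "count X z \<le> count (repeat_mset m (minkowski Y E)) z"
    proof (cases "z \<in># X")
      case True
      then have "count (minkowski Y E) z \<ge> 1" using assms(2) by (auto simp: Suc_le_eq)
      then have "m * 1 \<le> m * count (minkowski Y E) z" by (rule mult_le_mono2)
      then show ?thesis using assms(1)[of z] by (simp only: count_repeat_mset mult_1_right)
    qed (simp add: not_in_iff)
  qed
qed (use assms(3) in simp)

text \<open>The pair records the coefficients of v and w in n (v + h w). Counting in \<int>^2 is
  insensitive to linear relations between v and w, and \<open>dominated_image\<close> carries the
  result over to \<int>^D.\<close>

definition line :: "nat \<Rightarrow> int \<Rightarrow> (int \<times> int) multiset" where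
  "line L h = image_mset (\<lambda>n. (n, h * n)) (mset_set (pm L))"

definition rectangle :: "nat \<Rightarrow> nat \<Rightarrow> (int \<times> int) multiset" where
  "rectangle L L' = minkowski (image_mset (\<lambda>n. (n, 0)) (mset_set (pm L))) (image_mset (\<lambda>n. (0, n)) (mset_set (pm L')))"

lemma size_line [simp]: "size (line L h) = 2 * L + 1"
  by (simp add: line_def)

lemma size_rectangle [simp]: "size (rectangle L L') = (2 * L + 1) * (2 * L' + 1)"
  by (simp add: rectangle_def)

text \<open>The first coordinate forces z = u - x - y; substituted in the second, this leaves one
  linear equation in x and y.\<close>

lemma count_lines:
  "count (minkowski (minkowski (line L h) (line L h')) (line L h'')) (u, v)
    \<le> (\<Sum>x\<in>pm L. \<Sum>y\<in>pm L. if (h - h'') * x + (h' - h'') * y = v - h'' * u then 1 else 0)"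
proof -
  have "count (minkowski (minkowski (line L h) (line L h')) (line L h'')) (u, v)
    = (\<Sum>x\<in>pm L. \<Sum>y\<in>pm L. \<Sum>z\<in>pm L. if x + y + z = u \<and> h * x + h' * y + h'' * z = v then 1 else 0)"
    unfolding count_minkowski sum_mset_minkowski line_def
    by (simp add: multiset.map_comp comp_def sum_unfold_sum_mset)
  also have "\<dots> \<le> (\<Sum>x\<in>pm L. \<Sum>y\<in>pm L. if (h - h'') * x + (h' - h'') * y = v - h'' * u then 1 else 0)"
  proof (intro sum_mono)
    fix x y
    have "(\<Sum>z\<in>pm L. if x + y + z = u \<and> h * x + h' * y + h'' * z = v then 1 else 0)
      \<le> (if \<exists>z\<in>pm L. x + y + z = u \<and> h * x + h' * y + h'' * z = v then 1 else (0::nat))"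
      by (intro sum_of_bool_unique_le) auto
    also have "\<dots> \<le> (if (h - h'') * x + (h' - h'') * y = v - h'' * u then 1 else 0)"
      by (auto simp: algebra_simps)
    finally show "(\<Sum>z\<in>pm L. if x + y + z = u \<and> h * x + h' * y + h'' * z = v then 1 else 0)
      \<le> (if (h - h'') * x + (h' - h'') * y = v - h'' * u then 1 else (0::nat))" .
  qed
  finally show ?thesis .
qed

text \<open>Three adjacent translates of [-L, L], spaced by its 2L + 1 elements, cover [-3L, 3L].
  Doing so in both coordinates gives the translates in \<open>nine\<close>.\<close>

lemma three_intervals:
  assumes "\<bar>u\<bar> \<le> 3 * int L"
  obtains v n where "v \<in> {- (2 * int L + 1), 0, 2 * int L + 1}" "n \<in> pm L" "u = v + n"
proof -
  consider "u < - int L" | "\<bar>u\<bar> \<le> int L" | "u > int L" by linarith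
  then show ?thesis
  proof cases
    case 1
    then show ?thesis using assms that[of "- (2 * int L + 1)" "u + (2 * int L + 1)"] by (auto simp: mem_pm)
  next
    case 2
    then show ?thesis using that[of 0 u] by (auto simp: mem_pm)
  next
    case 3
    then show ?thesis using assms that[of "2 * int L + 1" "u - (2 * int L + 1)"] by (auto simp: mem_pm)
  qed
qed

definition nine :: "nat \<Rightarrow> nat \<Rightarrow> (int \<times> int) multiset" where
  "nine L L' = mset_set ({- (2 * int L + 1), 0, 2 * int L + 1} \<times> {- (2 * int L' + 1), 0, 2 * int L' + 1})"

lemma size_nine [simp]: "size (nine L L') = 9"
  by (simp add: nine_def)

lemma lines_subset_nine:
  assumes "h \<in> pm H" "h' \<in> pm H" "h'' \<in> pm H"
  shows "set_mset (minkowski (minkowski (line L h) (line L h')) (line L h''))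
    \<subseteq> set_mset (minkowski (nine L (H * L)) (rectangle L (H * L)))"
proof
  fix z assume "z \<in># minkowski (minkowski (line L h) (line L h')) (line L h'')"
  then obtain a b c where abc: "a \<in> pm L" "b \<in> pm L" "c \<in> pm L" "z = (a + b + c, h * a + h' * b + h'' * c)"
    by (auto simp: set_minkowski line_def)
  have *: "\<bar>x * y\<bar> \<le> int (H * L)" if "x \<in> pm H" "y \<in> pm L" for x y
    using that unfolding mem_pm abs_mult of_nat_mult by (intro mult_mono) auto
  have "\<bar>a + b + c\<bar> \<le> 3 * int L" using abc by (auto simp: mem_pm)
  then obtain v n where v: "v \<in> {- (2 * int L + 1), 0, 2 * int L + 1}" "n \<in> pm L" "a + b + c = v + n"
    by (rule three_intervals)
  have "\<bar>h * a + h' * b + h'' * c\<bar> \<le> 3 * int (H * L)"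
    using *[OF assms(1) abc(1)] *[OF assms(2) abc(2)] *[OF assms(3) abc(3)] by linarith
  then obtain v' n' where v': "v' \<in> {- (2 * int (H * L) + 1), 0, 2 * int (H * L) + 1}" "n' \<in> pm (H * L)"
    "h * a + h' * b + h'' * c = v' + n'"
    by (rule three_intervals)
  have "z = (v, v') + ((n, 0) + (0, n'))" using abc(4) v(3) v'(3) by simp
  moreover have "(v, v') \<in># nine L (H * L)" using v v' by (auto simp: nine_def)
  moreover have "(n, 0) + (0, n') \<in># rectangle L (H * L)"
    using v(2) v'(2) unfolding rectangle_def set_minkowski by force
  ultimately show "z \<in># minkowski (nine L (H * L)) (rectangle L (H * L))"
    unfolding set_minkowski by blast
qed

text \<open>With m copies of the nine translates, 9 m (2L+1)(2HL+1) is compared with the (2L+1)^3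
  elements of the triple sum; a factor 2L+1 cancels.\<close>

lemma dominated_lines:
  assumes "h \<in> pm H" "h' \<in> pm H" "h'' \<in> pm H"
    and "\<And>w. (\<Sum>x\<in>pm L. \<Sum>y\<in>pm L. if (h - h'') * x + (h' - h'') * y = w then 1 else 0) \<le> m"
    and "9 * real m * real (2 * H * L + 1) \<le> b * real ((2 * L + 1)\<^sup>2)"
  shows "dominated b (minkowski (minkowski (line L h) (line L h')) (line L h'')) (rectangle L (H * L))"
proof (rule dominated_by_cover[OF _ lines_subset_nine[OF assms(1-3)]])
  show "count (minkowski (minkowski (line L h) (line L h')) (line L h'')) z \<le> m" for z
    using order_trans[OF count_lines assms(4)] by (cases z) simp
  have "9 * real m * real (2 * H * L + 1) * real (2 * L + 1) \<le> b * real ((2 * L + 1)\<^sup>2) * real (2 * L + 1)"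
    by (rule mult_right_mono[OF assms(5)]) simp
  then show "real (m * size (nine L (H * L)) * size (rectangle L (H * L)))
    \<le> b * real (size (minkowski (minkowski (line L h) (line L h')) (line L h'')))"
    by (simp add: power2_eq_square algebra_simps)
qed

section \<open>Density of degenerate triples and domination for the others\<close>

lemma sum_inverse_squares_le:
  assumes "D \<ge> 1" "D \<le> N"
  shows "(\<Sum>d=D+1..N. 1 / (real d)\<^sup>2) \<le> 1 / real D - 1 / real N"
  using assms(2)
proof (induction N rule: dec_induct)
  case (step n)
  have n: "real n > 0" using step assms by simp
  have "1 / (real (Suc n))\<^sup>2 \<le> 1 / real n - 1 / real (Suc n)"
  proof -
    have "1 / (real (Suc n))\<^sup>2 \<le> 1 / (real n * real (Suc n))"
      using n by (intro frac_le) (auto simp: power2_eq_square)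
    also have "\<dots> = 1 / real n - 1 / real (Suc n)" using n by (simp add: field_simps)
    finally show ?thesis .
  qed
  with step show ?case by simp
qed simp

lemma avg_pm_indicator: "avg (mset_set (pm H)) (\<lambda>x. if P x then 1 else (0::real)) = real (card {x \<in> pm H. P x}) / real (2 * H + 1)"
  by (simp add: avg_mset_set sum.If_cases Int_def divide_inverse mult.commute)

lemma avg_sum: "avg E (\<lambda>x. \<Sum>d\<in>D. g d x) = (\<Sum>d\<in>D. avg E (g d))"
  unfolding avg_def sum_unfold_sum_mset by (subst sum_mset.swap) (simp add: sum_mset_scaleR)

text \<open>For fixed c, the b close to c have density O(\<zeta>). A given d divides both a - c and
  b - c with density at most (2/d)^2, because a and b are independent, and the sum over d >
  1/\<zeta> is again O(\<zeta>). The two parts contribute 2\<zeta> and 8\<zeta>.\<close>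

lemma bad_pairs_le:
  fixes \<zeta> :: real
  assumes "c \<in> pm H" "\<zeta> > 0" "\<zeta> * real H \<ge> 1" "\<zeta> \<le> 1"
  defines "I \<equiv> mset_set (pm H)"
  shows "avg I (\<lambda>a. avg I (\<lambda>b. if \<bar>b - c\<bar> < \<zeta> * real H \<or> real_of_int (gcd (a - c) (b - c)) > 1 / \<zeta> then 1 else (0::real))) \<le> 10 * \<zeta>"
proof -
  have H: "H \<ge> 1" using assms(3) by (cases H) auto
  have I: "I \<noteq> {#}" unfolding I_def using H by (simp add: mset_set_empty_iff pm_def)
  define D where "D = nat \<lfloor>1 / \<zeta>\<rfloor>"
  have D1: "D \<ge> 1" using assms(2,4) by (simp add: D_def le_nat_iff)
  have Dz: "1 / real D \<le> 2 * \<zeta>"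
  proof -
    have "real D \<ge> 1 / \<zeta> - 1" unfolding D_def using assms(2) by (simp add: of_nat_nat)
    then have "2 * real D \<ge> 1 / \<zeta>" using D1 by linarith
    then show ?thesis using assms(2) D1 by (simp add: field_simps)
  qed
  define g1 where "g1 b = (if real_of_int \<bar>b - c\<bar> < \<zeta> * real H then 1 else (0::real))" for b
  define u where "u d a = (if int d dvd a - c then 1 else (0::real))" for d a
  have avg_u: "avg I (u d) \<le> 2 / real d" if d: "d \<in> {D+1..2*H}" for d
  proof -
    have "card {x \<in> pm H. int d dvd x - c} \<le> 2 * H div d + 1"
    proof (rule card_residue_class_le)
      fix x y assume "x \<in> {x \<in> pm H. int d dvd x - c}" "y \<in> {x \<in> pm H. int d dvd x - c}"
      then show "int d dvd x - y" using dvd_diff[of "int d" "x - c" "y - c"] by simp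
    qed (use d in auto)
    then have "real (card {x \<in> pm H. int d dvd x - c}) \<le> real (2 * H div d) + 1" by linarith
    also have "\<dots> \<le> real (2 * H) / real d + 1" using of_nat_div_le_of_nat[where 'a = real, of "2 * H" d] by simp
    also have "\<dots> = real (2 * H + d) / real d" using d by (simp add: add_divide_distrib)
    also have "\<dots> \<le> real (2 * (2 * H + 1)) / real d"
      using d by (intro divide_right_mono) auto
    also have "\<dots> = 2 / real d * real (2 * H + 1)" by simp
    finally show ?thesis
      unfolding u_def I_def avg_pm_indicator by (simp add: field_simps)
  qed
  have u0: "avg I (u d) \<ge> 0" for d by (rule avg_nonneg) (simp add: u_def)
  have avg_g1: "avg I g1 \<le> 2 * \<zeta>"
  proof -
    define n where "n = nat \<lfloor>\<zeta> * real H\<rfloor>"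
    have "{x \<in> pm H. real_of_int \<bar>x - c\<bar> < \<zeta> * real H} \<subseteq> (\<lambda>y. y + c) ` pm n"
    proof
      fix x assume "x \<in> {x \<in> pm H. real_of_int \<bar>x - c\<bar> < \<zeta> * real H}"
      then have "\<bar>x - c\<bar> \<le> int n" unfolding n_def using assms(3) by (simp add: le_floor_iff)
      then show "x \<in> (\<lambda>y. y + c) ` pm n" by (intro image_eqI[of _ _ "x - c"]) (auto simp: mem_pm)
    qed
    then have "card {x \<in> pm H. real_of_int \<bar>x - c\<bar> < \<zeta> * real H} \<le> card ((\<lambda>y. y + c) ` pm n)"
      by (intro card_mono) auto
    also have "\<dots> \<le> 2 * n + 1" using card_image_le[of "pm n" "\<lambda>y. y + c"] by simp
    finally have "real (card {x \<in> pm H. real_of_int \<bar>x - c\<bar> < \<zeta> * real H}) \<le> 2 * real n + 1" by linarith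
    also have "real n \<le> \<zeta> * real H" unfolding n_def using assms(3) by (simp add: of_nat_nat)
    finally have "real (card {x \<in> pm H. real_of_int \<bar>x - c\<bar> < \<zeta> * real H}) \<le> 3 * (\<zeta> * real H)"
      using assms(3) by linarith
    also have "\<dots> \<le> 2 * \<zeta> * real (2 * H + 1)" using assms(2) by (simp add: algebra_simps)
    finally show ?thesis unfolding g1_def I_def avg_pm_indicator by (simp add: divide_le_eq)
  qed
  \<comment> \<open>Union bound over the value d of the gcd. Outside the case counted by g1 one has
    0 < |b - c| \<le> 2H, hence d \<le> 2H.\<close>
  have "avg I (\<lambda>a. avg I (\<lambda>b. if \<bar>b - c\<bar> < \<zeta> * real H \<or> real_of_int (gcd (a - c) (b - c)) > 1 / \<zeta> then 1 else (0::real)))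
    \<le> avg I (\<lambda>a. avg I (\<lambda>b. g1 b + (\<Sum>d=D+1..2*H. u d a * u d b)))"
  proof (intro avg_mono)
    fix a b assume ab: "a \<in># I" "b \<in># I"
    have nn: "(\<Sum>d=D+1..2*H. u d a * u d b) \<ge> 0" by (intro sum_nonneg) (simp add: u_def)
    show "(if \<bar>b - c\<bar> < \<zeta> * real H \<or> real_of_int (gcd (a - c) (b - c)) > 1 / \<zeta> then 1 else (0::real))
      \<le> g1 b + (\<Sum>d=D+1..2*H. u d a * u d b)"
    proof (cases "\<bar>b - c\<bar> < \<zeta> * real H")
      case True
      then show ?thesis using nn by (simp add: g1_def)
    next
      case False
      then have g10: "g1 b = 0" by (simp add: g1_def)
      show ?thesis
      proof (cases "real_of_int (gcd (a - c) (b - c)) > 1 / \<zeta>")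
        case True
        define d where "d = nat (gcd (a - c) (b - c))"
        have dint: "int d = gcd (a - c) (b - c)" by (simp add: d_def)
        have "b - c \<noteq> 0" using False assms(3) by auto
        have "int d \<le> \<bar>b - c\<bar>" unfolding dint using \<open>b - c \<noteq> 0\<close> by (simp add: zdvd_imp_le)
        also have "\<bar>b - c\<bar> \<le> 2 * int H" using ab assms(1) by (auto simp: I_def pm_def)
        finally have "d \<le> 2 * H" by linarith
        moreover have "d \<ge> D + 1"
        proof -
          have "real D \<le> 1 / \<zeta>" unfolding D_def using assms(2) by (simp add: of_nat_nat)
          also have "\<dots> < real d" using True by (metis dint of_int_of_nat_eq)
          finally show ?thesis by simp
        qed
        ultimately have d: "d \<in> {D+1..2*H}" by simp
        have "u d a * u d b = 1" by (simp add: u_def dint)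
        then have "1 \<le> (\<Sum>d=D+1..2*H. u d a * u d b)"
          using member_le_sum[of d "{D+1..2*H}" "\<lambda>d. u d a * u d b"] d by (simp add: u_def)
        then show ?thesis using True g10 by simp
      next
        case F: False
        then show ?thesis using False nn g10 by simp
      qed
    qed
  qed
  also have "\<dots> = avg I g1 + (\<Sum>d=D+1..2*H. avg I (u d) * avg I (u d))"
    unfolding avg_add avg_sum avg_const[OF I]
    by (simp only: avg_mult_left[symmetric] avg_mult_right[symmetric])
  also have "\<dots> \<le> 2 * \<zeta> + (\<Sum>d=D+1..2*H. (2 / real d) * (2 / real d))"
    by (intro add_mono avg_g1 sum_mono mult_mono avg_u u0) auto
  also have "(\<Sum>d=D+1..2*H. (2 / real d) * (2 / real d)) = 4 * (\<Sum>d=D+1..2*H. 1 / (real d)\<^sup>2)"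
    by (simp add: sum_distrib_left power2_eq_square)
  also have "\<dots> \<le> 4 * (2 * \<zeta>)"
  proof (cases "D \<le> 2 * H")
    case True
    have "(\<Sum>d=D+1..2*H. 1 / (real d)\<^sup>2) \<le> 1 / real D - 1 / real (2 * H)"
      by (rule sum_inverse_squares_le[OF D1 True])
    also have "\<dots> \<le> 1 / real D" by simp
    finally show ?thesis using Dz by linarith
  next
    case False
    then show ?thesis using assms(2) by simp
  qed
  finally show ?thesis by linarith
qed


text \<open>In a good triple d = |h' - h''| / gcd is at least \<zeta>^2 H, and multiplicities are at
  most 2L/d + 1. As L \<ge> H this is O(L / (\<zeta>^2 H)), the average density L^3 / (H L^2) up to
  a factor \<zeta>^-2. The exponent q serves all l at once.\<close>

lemma dominated_lines_generic:
  fixes \<zeta> :: real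
  assumes h: "h \<in> pm H" "h' \<in> pm H" "h'' \<in> pm H" and H: "H \<ge> 1" and l: "1 \<le> l" "l \<le> q"
    and \<zeta>: "0 < \<zeta>" "\<zeta> \<le> 1"
    and good: "\<zeta> * real H \<ge> 1 \<Longrightarrow> real_of_int \<bar>h' - h''\<bar> \<ge> \<zeta> * real H \<and> real_of_int (gcd (h - h'') (h' - h'')) \<le> 1 / \<zeta>"
  shows "dominated (27 * (1 / \<zeta>) ^ (q + 1))
    (minkowski (minkowski (line (H ^ l) h) (line (H ^ l) h')) (line (H ^ l) h'')) (rectangle (H ^ l) (H * H ^ l))"
proof -
  define L where "L = H ^ l"
  have L1: "L \<ge> 1" using H by (simp add: L_def Suc_le_eq)
  have LH: "L \<ge> H" using H l power_increasing[of 1 l H] by (simp add: L_def)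
  have inv: "1 / \<zeta> \<ge> 1" using \<zeta> by simp
  have HL: "real (2 * H * L + 1) \<le> 3 * real H * real L"
  proof -
    have "1 \<le> H * L" using H L1 by (simp add: Suc_le_eq)
    then have "2 * H * L + 1 \<le> 3 * H * L" by simp
    then have "real (2 * H * L + 1) \<le> real (3 * H * L)" by (simp only: of_nat_le_iff)
    then show ?thesis by simp
  qed
  show ?thesis
    unfolding L_def[symmetric]
  proof (cases "\<zeta> * real H \<ge> 1")
    \<comment> \<open>For H < 1/\<zeta> the trivial multiplicity bound (2L+1)^2 is enough, since H L
      = H^(l+1) is at most (1/\<zeta>)^(q+1). The exponent of the loss comes from this case.\<close>
    case False
    then have Hz: "real H \<le> 1 / \<zeta>" using \<zeta> by (simp add: field_simps)
    show "dominated (27 * (1 / \<zeta>) ^ (q + 1))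
      (minkowski (minkowski (line L h) (line L h')) (line L h'')) (rectangle L (H * L))"
    proof (rule dominated_lines[OF h, where m = "(2 * L + 1)\<^sup>2"])
      fix w
      have "(\<Sum>x\<in>pm L. \<Sum>y\<in>pm L. if (h - h'') * x + (h' - h'') * y = w then 1 else 0) \<le> (\<Sum>x\<in>pm L. \<Sum>y\<in>pm L. 1::nat)"
        by (intro sum_mono) simp
      then show "(\<Sum>x\<in>pm L. \<Sum>y\<in>pm L. if (h - h'') * x + (h' - h'') * y = w then 1 else 0) \<le> (2 * L + 1)\<^sup>2"
        by (simp add: power2_eq_square)
    next
      have "real H * real L = real H ^ (l + 1)" by (simp add: L_def)
      also have "\<dots> \<le> (1 / \<zeta>) ^ (l + 1)" by (intro power_mono Hz) simp
      also have "\<dots> \<le> (1 / \<zeta>) ^ (q + 1)" using l by (intro power_increasing inv) simp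
      finally have "real (2 * H * L + 1) \<le> 3 * (1 / \<zeta>) ^ (q + 1)" using HL by (simp only: mult.assoc)
      then have "9 * real ((2 * L + 1)\<^sup>2) * real (2 * H * L + 1) \<le> 9 * real ((2 * L + 1)\<^sup>2) * (3 * (1 / \<zeta>) ^ (q + 1))"
        by (intro mult_left_mono) auto
      then show "9 * real ((2 * L + 1)\<^sup>2) * real (2 * H * L + 1) \<le> 27 * (1 / \<zeta>) ^ (q + 1) * real ((2 * L + 1)\<^sup>2)"
        by (simp only: mult_ac)
    qed
  next
    case True
    define g where "g = gcd (h - h'') (h' - h'')"
    define d where "d = nat \<bar>h' - h''\<bar> div nat g"
    have q: "real_of_int \<bar>h' - h''\<bar> \<ge> \<zeta> * real H" "real_of_int g \<le> 1 / \<zeta>"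
      using good[OF True] by (auto simp: g_def)
    have qn0: "h' - h'' \<noteq> 0" using q True by auto
    then have g: "g > 0" "g dvd \<bar>h' - h''\<bar>" by (auto simp: g_def)
    have "real d = real_of_int \<bar>h' - h''\<bar> / real_of_int g"
    proof -
      have "int d = \<bar>h' - h''\<bar> div g" using g by (simp add: d_def zdiv_int)
      then have "real d = real_of_int (\<bar>h' - h''\<bar> div g)" by (metis of_int_of_nat_eq)
      also have "\<dots> = real_of_int \<bar>h' - h''\<bar> / real_of_int g" using g by (intro real_of_int_div)
      finally show ?thesis .
    qed
    also have "\<dots> \<ge> (\<zeta> * real H) / (1 / \<zeta>)"
      using q g \<zeta> by (intro frac_le) auto
    finally have d: "real d \<ge> \<zeta>\<^sup>2 * real H" by (simp add: power2_eq_square mult_ac)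
    have zH: "\<zeta>\<^sup>2 * real H > 0" using \<zeta> H by simp
    have "\<zeta>\<^sup>2 * real H \<le> 1 * real L" using \<zeta> LH by (intro mult_mono) (auto simp: power_le_one)
    then have zL: "1 \<le> real L / (\<zeta>\<^sup>2 * real H)" using zH by simp
    have "real (2 * L div d + 1) \<le> real (2 * L) / real d + 1"
      using of_nat_div_le_of_nat[where 'a = real, of "2 * L" d] by simp
    also have "\<dots> \<le> real (2 * L) / (\<zeta>\<^sup>2 * real H) + 1"
      using d zH H by (intro add_mono divide_left_mono mult_pos_pos) auto
    also have "\<dots> \<le> 3 * (real L / (\<zeta>\<^sup>2 * real H))" using zL by simp
    finally have m: "real (2 * L div d + 1) \<le> 3 * (real L / (\<zeta>\<^sup>2 * real H))" .
    show "dominated (27 * (1 / \<zeta>) ^ (q + 1))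
      (minkowski (minkowski (line L h) (line L h')) (line L h'')) (rectangle L (H * L))"
    proof (rule dominated_lines[OF h, where m = "2 * L div d + 1"])
      fix w
      show "(\<Sum>x\<in>pm L. \<Sum>y\<in>pm L. if (h - h'') * x + (h' - h'') * y = w then 1 else 0) \<le> 2 * L div d + 1"
        unfolding d_def g_def by (rule card_solutions_le[OF qn0])
    next
      have "9 * real (2 * L div d + 1) * real (2 * H * L + 1)
          \<le> 9 * (3 * (real L / (\<zeta>\<^sup>2 * real H))) * (3 * real H * real L)"
        by (intro mult_mono m HL mult_left_mono) auto
      also have "\<dots> = 81 * (1 / \<zeta>)\<^sup>2 * (real L)\<^sup>2"
        using H \<zeta> by (simp add: field_simps power2_eq_square)
      \<comment> \<open>81 is at most 4 * 27, and the 4 is regained from (2L+1)^2 \<ge>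
        (2L)^2.\<close>
      also have "\<dots> \<le> 108 * (1 / \<zeta>) ^ (q + 1) * (real L)\<^sup>2"
      proof -
        have "(1 / \<zeta>)\<^sup>2 \<le> (1 / \<zeta>) ^ (q + 1)" using l by (intro power_increasing inv) simp
        moreover have "(1 / \<zeta>) ^ (q + 1) \<ge> 0" using \<zeta> by simp
        ultimately have "81 * (1 / \<zeta>)\<^sup>2 \<le> 108 * (1 / \<zeta>) ^ (q + 1)" by linarith
        then show ?thesis by (rule mult_right_mono) simp
      qed
      also have "\<dots> = 27 * (1 / \<zeta>) ^ (q + 1) * (2 * real L)\<^sup>2" by (simp add: power_mult_distrib)
      also have "\<dots> \<le> 27 * (1 / \<zeta>) ^ (q + 1) * real ((2 * L + 1)\<^sup>2)"
      proof (intro mult_left_mono)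
        have "(2 * real L)\<^sup>2 \<le> (real (2 * L + 1))\<^sup>2" by (intro power_mono) auto
        then show "(2 * real L)\<^sup>2 \<le> real ((2 * L + 1)\<^sup>2)" by (simp only: of_nat_power)
      qed (use \<zeta> in simp)
      finally show "9 * real (2 * L div d + 1) * real (2 * H * L + 1) \<le> 27 * (1 / \<zeta>) ^ (q + 1) * real ((2 * L + 1)\<^sup>2)" .
    qed
  qed
qed

section \<open>From \<int>^2 to sums of progressions in \<int>^D\<close>

definition comb :: "vec \<Rightarrow> vec \<Rightarrow> int \<times> int \<Rightarrow> vec" where
  "comb v w p = vscale (fst p) v + vscale (snd p) w"

lemma comb_add: "comb v w (p + q) = comb v w p + comb v w q"
  by (auto simp: comb_def vscale_def fun_eq_iff algebra_simps)

lemma prog_eq_image_line: "prog (v + vscale h w) (pm L) = image_mset (comb v w) (line L h)"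
  unfolding prog_def line_def multiset.map_comp
  by (intro image_mset_cong) (auto simp: comb_def vscale_def fun_eq_iff algebra_simps)

lemma image_rectangle: "image_mset (comb v w) (rectangle L L') = minkowski (prog v (pm L)) (prog w (pm L'))"
proof -
  have "comb v w (n, 0) = vscale n v" "comb v w (0, n) = vscale n w" for n
    by (simp_all add: comb_def vscale_def fun_eq_iff)
  then show ?thesis
    unfolding rectangle_def image_minkowski[OF comb_add] prog_def
    by (simp add: image_mset.compositionality comp_def)
qed

lemma size_prog [simp]: "finite I \<Longrightarrow> size (prog v I) = card I"
  by (simp add: prog_def)

text \<open>Whether a triple is degenerate depends on its entries only, not on the vectors or
  lengths. One exceptional set therefore serves all w in W, and the constants multiply.\<close>

lemma equidistributed_progressions:
  assumes H: "H \<ge> 1" and W: "finite W" and l: "\<And>w. w \<in> W \<Longrightarrow> 1 \<le> l w \<and> l w \<le> q"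
  shows "equidistributed ((27 * 10 ^ (q + 1)) ^ card W) ((q + 1) * card W) (mset_set (pm H))
    (\<lambda>h. minkowski_sum.F (\<lambda>w. prog (v w + vscale h (v' w)) (pm (H ^ l w))) W)
    (minkowski_sum.F (\<lambda>w. minkowski (prog (v w) (pm (H ^ l w))) (prog (v' w) (pm (H * H ^ l w)))) W)"
  unfolding equidistributed_def
proof (intro allI impI)
  fix \<eta> :: real assume \<eta>: "0 < \<eta> \<and> \<eta> \<le> 1"
  \<comment> \<open>\<open>bad_pairs_le\<close> bounds the exceptional density by 10\<zeta>.\<close>
  define \<zeta> where "\<zeta> = \<eta> / 10"
  have \<zeta>: "0 < \<zeta>" "\<zeta> \<le> 1" "10 * \<zeta> = \<eta>" using \<eta> by (auto simp: \<zeta>_def)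
  define I where "I = mset_set (pm H)"
  have I: "I \<noteq> {#}" unfolding I_def by (simp add: mset_set_empty_iff pm_def)
  define bad where "bad a b c \<longleftrightarrow> \<zeta> * real H \<ge> 1 \<and>
    (real_of_int \<bar>b - c\<bar> < \<zeta> * real H \<or> real_of_int (gcd (a - c) (b - c)) > 1 / \<zeta>)" for a b c
  have "avg I (\<lambda>a. avg I (\<lambda>b. avg I (\<lambda>c. avg I (\<lambda>d. if bad a b c then 1 else (0::real)))))
      = avg I (\<lambda>a. avg I (\<lambda>b. avg I (\<lambda>c. if bad a b c then 1 else (0::real))))"
    by (simp add: avg_const[OF I])
  also have "\<dots> = avg I (\<lambda>a. avg I (\<lambda>c. avg I (\<lambda>b. if bad a b c then 1 else (0::real))))"
    by (intro avg_cong avg_swap)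
  also have "\<dots> = avg I (\<lambda>c. avg I (\<lambda>a. avg I (\<lambda>b. if bad a b c then 1 else (0::real))))"
    by (rule avg_swap)
  also have "\<dots> \<le> \<eta>"
  proof (rule avg_le_const)
    fix c assume c: "c \<in># I"
    show "avg I (\<lambda>a. avg I (\<lambda>b. if bad a b c then 1 else (0::real))) \<le> \<eta>"
    proof (cases "\<zeta> * real H \<ge> 1")
      case True
      then show ?thesis
        using bad_pairs_le[of c H \<zeta>] c \<zeta> by (simp add: bad_def I_def)
    next
      case False
      then show ?thesis using \<eta> I by (simp add: bad_def avg_const)
    qed
  qed (use \<eta> in simp)
  finally have small: "avg I (\<lambda>a. avg I (\<lambda>b. avg I (\<lambda>c. avg I (\<lambda>d. if bad a b c then 1 else (0::real))))) \<le> \<eta>" .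
  let ?F = "\<lambda>h w. prog (v w + vscale h (v' w)) (pm (H ^ l w))"
  let ?G = "\<lambda>w. minkowski (prog (v w) (pm (H ^ l w))) (prog (v' w) (pm (H * H ^ l w)))"
  let ?b = "27 * (1 / \<zeta>) ^ (q + 1)"
  have b: "(27 * 10 ^ (q + 1)) ^ card W * (1 / \<eta>) ^ ((q + 1) * card W) = ?b ^ card W"
  proof -
    have "10 * (1 / \<eta>) = 1 / \<zeta>" by (simp add: \<zeta>_def)
    then have "?b = 27 * 10 ^ (q + 1) * (1 / \<eta>) ^ (q + 1)"
      by (metis mult.assoc power_mult_distrib)
    then show ?thesis by (simp only: power_mult power_mult_distrib)
  qed
  have good: "dominated (?b ^ card W) (minkowski (minkowski (minkowski_sum.F (?F a) W) (minkowski_sum.F (?F b) W))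
      (minkowski (minkowski_sum.F (?F c) W) (minkowski_sum.F (?F d) W))) (minkowski_sum.F ?G W)"
    if abcd: "a \<in># I" "b \<in># I" "c \<in># I" "d \<in># I" and nb: "\<not> bad a b c" for a b c d
    \<comment> \<open>Four sums over W become one sum over W of fourfold sums, so that domination
      can be checked for each w separately.\<close>
    unfolding minkowski_sum.distrib[symmetric]
  proof (rule dominated_sum[OF W])
    fix w assume w: "w \<in> W"
    have "dominated ?b (minkowski (minkowski (line (H ^ l w) a) (line (H ^ l w) b)) (line (H ^ l w) c)) (rectangle (H ^ l w) (H * H ^ l w))"
      by (rule dominated_lines_generic[OF _ _ _ H]) (use abcd nb l[OF w] \<zeta> in \<open>auto simp: I_def bad_def\<close>)
    from dominated_extra[OF dominated_image[OF this comb_add[of "v w" "v' w"]], of "?F d w"]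
    show "dominated ?b (minkowski (minkowski (?F a w) (?F b w)) (minkowski (?F c w) (?F d w))) (?G w)"
      unfolding image_minkowski[OF comb_add] image_rectangle prog_eq_image_line[symmetric] minkowski_assoc .
  qed (use \<zeta> in simp)
  show "\<exists>Bad. avg (mset_set (pm H)) (\<lambda>a. avg (mset_set (pm H)) (\<lambda>b. avg (mset_set (pm H)) (\<lambda>c.
      avg (mset_set (pm H)) (\<lambda>d. if Bad a b c d then 1 else (0::real))))) \<le> \<eta> \<and>
    (\<forall>a\<in>#mset_set (pm H). \<forall>b\<in>#mset_set (pm H). \<forall>c\<in>#mset_set (pm H). \<forall>d\<in>#mset_set (pm H). \<not> Bad a b c d \<longrightarrow>
      dominated ((27 * 10 ^ (q + 1)) ^ card W * (1 / \<eta>) ^ ((q + 1) * card W))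
       (minkowski (minkowski (minkowski_sum.F (?F a) W) (minkowski_sum.F (?F b) W))
        (minkowski (minkowski_sum.F (?F c) W) (minkowski_sum.F (?F d) W))) (minkowski_sum.F ?G W))"
    unfolding b I_def[symmetric]
    by (intro exI[of _ "\<lambda>a b c d. bad a b c"] conjI small ballI impI good)
qed

section \<open>Treating the variables one at a time\<close>

lemma iexpect_eq_avg: "iexpect Es g = avg (pair_lists Es) g"
  by (induction Es arbitrary: g) (simp_all add: mexpect_eq_avg avg_pair_lists_Cons del: pair_lists.simps(2))

lemma finite_cube [simp]: "finite (cube n)"
  unfolding cube_def by (intro finite_PiE) auto

lemma card_cube [simp]: "card (cube n) = 2 ^ n"
  unfolding cube_def by (subst card_PiE) (auto simp: numeral_2_eq_2)

lemma cube_le_1: "u \<in> cube n \<Longrightarrow> i < n \<Longrightarrow> u i \<le> 1"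
  by (force simp: cube_def PiE_def Pi_def)

text \<open>The new coordinate is put in front to match the list constructor; the elimination of
  variables appends at the end instead (\<open>cube_Suc_upd\<close>).\<close>

definition cube_cons :: "nat \<Rightarrow> (nat \<Rightarrow> nat) \<Rightarrow> nat \<Rightarrow> nat" where
  "cube_cons e u = (\<lambda>i. case i of 0 \<Rightarrow> e | Suc i \<Rightarrow> u i)"

lemma cube_cons_simps [simp]: "cube_cons e u 0 = e" "cube_cons e u (Suc i) = u i"
  by (simp_all add: cube_cons_def)

lemma cube_cons_inj: "cube_cons e u = cube_cons e' u' \<longleftrightarrow> e = e' \<and> u = u'"
  by (metis cube_cons_simps ext)

lemma cube_Suc_cons: "cube (Suc n) = cube_cons 0 ` cube n \<union> cube_cons 1 ` cube n"
proof
  show "cube (Suc n) \<subseteq> cube_cons 0 ` cube n \<union> cube_cons 1 ` cube n"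
  proof
    fix u assume u: "u \<in> cube (Suc n)"
    have "u = cube_cons (u 0) (\<lambda>i. u (Suc i))"
      by (auto simp: cube_cons_def fun_eq_iff split: nat.split)
    moreover have "(\<lambda>i. u (Suc i)) \<in> cube n" using u by (auto simp: cube_def PiE_iff extensional_def)
    moreover have "u 0 = 0 \<or> u 0 = 1" using cube_le_1[OF u, of 0] by auto
    ultimately show "u \<in> cube_cons 0 ` cube n \<union> cube_cons 1 ` cube n" by (metis UnCI imageI)
  qed
  have "cube_cons e u \<in> cube (Suc n)" if "u \<in> cube n" "e \<in> {0, 1}" for e u
    using that by (auto simp: cube_def PiE_iff extensional_def cube_cons_def split: nat.split)
  then show "cube_cons 0 ` cube n \<union> cube_cons 1 ` cube n \<subseteq> cube (Suc n)" by auto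
qed

lemma weight_cube_cons: "weight (Suc n) (cube_cons e u) = e + weight n u"
  by (simp add: weight_def sum.lessThan_Suc_shift del: sum.lessThan_Suc)

lemma cnj_funpow_mult: "(cnj ^^ n) (a * b) = (cnj ^^ n) a * (cnj ^^ n) b"
  by (induction n) auto

lemma cnj_funpow_cnj: "(cnj ^^ n) (cnj a) = (cnj ^^ Suc n) a"
  by (simp add: funpow_swap1)

abbreviation vertex :: "(vec \<times> vec) list \<Rightarrow> (nat \<Rightarrow> nat) \<Rightarrow> vec" where
  "vertex ps \<epsilon> \<equiv> (\<Sum>i<length ps. vscale (1 - int (\<epsilon> i)) (fst (ps ! i)) + vscale (int (\<epsilon> i)) (snd (ps ! i)))"

lemma vscale_01 [simp]: "vscale 0 v = 0" "vscale 1 v = v"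
  by (auto simp: vscale_def fun_eq_iff)

lemma vertex_cons: "vertex ((y, y') # ps) (cube_cons e u)
    = vscale (1 - int e) y + vscale (int e) y' + vertex ps u"
  by (simp add: sum.lessThan_Suc_shift del: sum.lessThan_Suc)

text \<open>Splitting off the first coordinate pairs each vertex with its neighbour in direction y'
  - y; the extra conjugation of the neighbour is the one in f(z + y) cnj (f(z + y')).\<close>

lemma prod_vertices_eq_mderiv:
  "(\<Prod>\<epsilon>\<in>cube (length ps). (cnj ^^ weight (length ps) \<epsilon>) (f (x + vertex ps \<epsilon>))) = mderiv ps f x"
proof (induction ps arbitrary: f)
  case Nil
  have "cube 0 = {\<lambda>_. undefined}" by (simp add: cube_def)
  then show ?case by (simp add: weight_def)
next
  case (Cons p ps)
  obtain y y' where p: "p = (y, y')" by force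
  let ?n = "length ps"
  let ?g = "\<lambda>\<epsilon>. (cnj ^^ weight (Suc ?n) \<epsilon>) (f (x + vertex (p # ps) \<epsilon>))"
  have "(\<Prod>\<epsilon>\<in>cube (Suc ?n). ?g \<epsilon>) = (\<Prod>\<epsilon>\<in>cube_cons 0 ` cube ?n. ?g \<epsilon>) * (\<Prod>\<epsilon>\<in>cube_cons 1 ` cube ?n. ?g \<epsilon>)"
    unfolding cube_Suc_cons by (intro prod.union_disjoint) (auto simp: cube_cons_inj)
  also have "\<dots> = (\<Prod>\<epsilon>\<in>cube ?n. ?g (cube_cons 0 \<epsilon>)) * (\<Prod>\<epsilon>\<in>cube ?n. ?g (cube_cons 1 \<epsilon>))"
    by (subst (1 2) prod.reindex) (auto simp: inj_on_def cube_cons_inj)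
  also have "\<dots> = (\<Prod>\<epsilon>\<in>cube ?n. (cnj ^^ weight ?n \<epsilon>) (f (x + vertex ps \<epsilon> + y) * cnj (f (x + vertex ps \<epsilon> + y'))))"
    unfolding prod.distrib[symmetric] p vertex_cons weight_cube_cons cnj_funpow_mult cnj_funpow_cnj
    by (simp add: add_ac)
  also have "\<dots> = mderiv (p # ps) f x" 
    unfolding p using Cons.IH[of "\<lambda>z. f (z + y) * cnj (f (z + y'))"] by (simp only: mderiv_pair.simps)
  finally show ?case by (simp only: length_Cons)
qed

lemma zvec_add: "x \<in> zvec D \<Longrightarrow> y \<in> zvec D \<Longrightarrow> x + y \<in> zvec D"
  by (simp add: zvec_def)

lemma zvec_diff: "x \<in> zvec D \<Longrightarrow> y \<in> zvec D \<Longrightarrow> x - y \<in> zvec D"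
  by (simp add: zvec_def)

lemma zvec_0 [simp]: "0 \<in> zvec D"
  by (simp add: zvec_def)

lemma zvec_vscale: "x \<in> zvec D \<Longrightarrow> vscale n x \<in> zvec D"
  by (simp add: zvec_def vscale_def)

lemma zvec_sum: "(\<And>i. i \<in> I \<Longrightarrow> g i \<in> zvec D) \<Longrightarrow> sum g I \<in> zvec D"
  by (induction I rule: infinite_finite_induct) (auto intro: zvec_add)

lemma pair_lists_memD: "ps \<in># pair_lists Es \<Longrightarrow> length ps = length Es \<and> (\<forall>i<length Es. fst (ps ! i) \<in># Es ! i \<and> snd (ps ! i) \<in># Es ! i)"
proof (induction Es arbitrary: ps)
  case (Cons E Es)
  then obtain y y' t where t: "ps = (y, y') # t" "y \<in># E" "y' \<in># E" "t \<in># pair_lists Es" by auto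
  show ?case using Cons.IH[OF t(4)] t by (auto simp: nth_Cons split: nat.split)
qed auto

text \<open>f is arbitrary outside \<open>zvec D\<close>, so it is cut off there. All shifts stay in
  \<open>zvec D\<close>, hence the derivatives of f' vanish outside and the sum becomes a
  \<open>total\<close> over all sequences.\<close>

lemma boxpow_eq_rbox:
  fixes f :: "vec \<Rightarrow> complex"
  assumes E: "\<And>E x. E \<in> set Es \<Longrightarrow> x \<in># E \<Longrightarrow> x \<in> zvec D"
  defines "f' \<equiv> (\<lambda>x. if x \<in> zvec D then f x else 0)"
  assumes finsupp: "finsupp f'"
  shows "boxpow D Es f = rbox Es f'"
  unfolding boxpow_def rbox_def gbox_def iexpect_eq_avg
proof (intro arg_cong[where f = Re] avg_cong)
  fix ps assume ps: "ps \<in># pair_lists Es"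
  have len: "length ps = length Es" using pair_lists_memD[OF ps] by simp
  have mem: "fst (ps ! i) \<in> zvec D" "snd (ps ! i) \<in> zvec D" if "i < length ps" for i
    using pair_lists_memD[OF ps] that E nth_mem by metis+
  have vz: "vertex ps \<epsilon> \<in> zvec D" for \<epsilon>
    by (intro zvec_sum zvec_add zvec_vscale mem) auto
  have sgz: "base_shift ps \<in> zvec D"
  proof -
    have "base_shift ps = (\<Sum>i<length ps. fst (ps ! i))"
      by (simp add: sum_list_sum_nth atLeast0LessThan)
    then show ?thesis using mem by (auto intro!: zvec_sum)
  qed
  have eq: "(\<Prod>\<epsilon>\<in>cube (length Es). (cnj ^^ weight (length Es) \<epsilon>) (f (x + vertex ps \<epsilon>))) = mderiv ps f' x"
    if x: "x \<in> zvec D" for x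
  proof -
    have "f (x + vertex ps \<epsilon>) = f' (x + vertex ps \<epsilon>)" for \<epsilon>
      using zvec_add[OF x vz] by (simp add: f'_def)
    then show ?thesis unfolding len[symmetric] by (simp only: prod_vertices_eq_mderiv)
  qed
  have supp: "x \<in> zvec D" if "mderiv ps f' x \<noteq> 0" for x
  proof -
    have "x + base_shift ps \<in> zvec D" using mderiv_pair_support[OF that] by (auto simp: f'_def split: if_splits)
    from zvec_diff[OF this sgz] show ?thesis by simp
  qed
  have "(\<Sum>\<^sub>\<infinity>x\<in>zvec D. \<Prod>\<epsilon>\<in>cube (length Es). (cnj ^^ weight (length Es) \<epsilon>) (f (x + vertex ps \<epsilon>)))
      = (\<Sum>\<^sub>\<infinity>x\<in>{x. mderiv ps f' x \<noteq> 0}. mderiv ps f' x)"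
    by (rule infsum_cong_neutral) (use eq supp in auto)
  also have "\<dots> = total (mderiv ps f')"
    unfolding total_def by (rule infsum_finite[OF finsupp_mderiv_pair[OF finsupp]])
  finally show "(\<Sum>\<^sub>\<infinity>x\<in>zvec D. \<Prod>\<epsilon>\<in>cube (length Es). (cnj ^^ weight (length Es) \<epsilon>)
     (f (x + (\<Sum>i<length Es. vscale (1 - int (\<epsilon> i)) (fst (ps ! i)) + vscale (int (\<epsilon> i)) (snd (ps ! i)))))) = total (mderiv ps f')"
    by (simp only: len)
qed

lemma dominated_pm:
  assumes "H \<le> M"
  shows "dominated 2 (mset_set (pm M)) (mset_set (pm H))"
proof -
  \<comment> \<open>[-M, M] is covered by Suc t blocks of 2H + 1 elements. Together they have at
    most 2M + 2H + 1 \<le> 2 (2M + 1) elements, because H \<le> M.\<close>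
  define t where "t = 2 * M div (2 * H + 1)"
  define Y where "Y = image_mset (\<lambda>i. int H - int M + int i * (2 * int H + 1)) (mset_set {..t})"
  have "t * (2 * H + 1) \<le> 2 * M" unfolding t_def by (rule div_times_less_eq_dividend)
  then have "Suc t * (2 * H + 1) \<le> 2 * (2 * M + 1)" using assms by simp
  then have t: "real (Suc t * (2 * H + 1)) \<le> real (2 * (2 * M + 1))" by (simp only: of_nat_le_iff)
  show ?thesis
  proof (rule dominated_by_cover[where Y = Y and m = 1])
    show "count (mset_set (pm M)) z \<le> 1" for z by (simp add: count_mset_set')
    show "set_mset (mset_set (pm M)) \<subseteq> set_mset (minkowski Y (mset_set (pm H)))"
    proof
      fix x assume "x \<in># mset_set (pm M)"
      then have x: "- int M \<le> x" "x \<le> int M" by (auto simp: pm_def)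
      define i where "i = nat (x + int M) div (2 * H + 1)"
      define \<rho> where "\<rho> = nat (x + int M) mod (2 * H + 1)"
      have "nat (x + int M) = i * (2 * H + 1) + \<rho>" unfolding i_def \<rho>_def by (metis div_mult_mod_eq)
      moreover have "x + int M = int (nat (x + int M))" using x by simp
      ultimately have "x + int M = int (i * (2 * H + 1) + \<rho>)" by (simp only:)
      then have xe: "x = (int H - int M + int i * (2 * int H + 1)) + (int \<rho> - int H)" by (simp add: algebra_simps)
      have "i \<le> t" unfolding i_def t_def using x by (intro div_le_mono) simp
      moreover have "\<rho> < 2 * H + 1" by (simp add: \<rho>_def)
      then have "int \<rho> - int H \<in># mset_set (pm H)" by (auto simp: pm_def)
      moreover have "int H - int M + int i * (2 * int H + 1) \<in># Y" if "i \<le> t" using that by (auto simp: Y_def)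
      ultimately show "x \<in># minkowski Y (mset_set (pm H))"
        unfolding set_minkowski using xe by blast
    qed
    show "real (1 * size Y * size (mset_set (pm H))) \<le> 2 * real (size (mset_set (pm M)))"
      using t by (simp add: Y_def)
  qed
qed

lemma vscale_add_left: "vscale (m + n) v = vscale m v + vscale n v"
  by (auto simp: vscale_def fun_eq_iff algebra_simps)

lemma dominated_prog: "H \<le> M \<Longrightarrow> dominated 2 (prog v (pm M)) (prog v (pm H))"
  unfolding prog_def by (intro dominated_image dominated_pm vscale_add_left)

text \<open>16 = 2^4: a factor 2 is lost in each of the four summands.\<close>

lemma equidistributed_dominated:
  assumes "equidistributed k c I F G" "\<And>h. h \<in># I \<Longrightarrow> dominated 2 (F' h) (F h)" "k \<ge> 0"
  shows "equidistributed (16 * k) c I F' G"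
  unfolding equidistributed_def
proof (intro allI impI)
  fix \<eta> :: real assume \<eta>: "0 < \<eta> \<and> \<eta> \<le> 1"
  obtain Bad where Bad:
    "avg I (\<lambda>a. avg I (\<lambda>b. avg I (\<lambda>a'. avg I (\<lambda>b'. if Bad a b a' b' then 1 else (0::real))))) \<le> \<eta>"
    "\<And>a b a' b'. a \<in># I \<Longrightarrow> b \<in># I \<Longrightarrow> a' \<in># I \<Longrightarrow> b' \<in># I \<Longrightarrow> \<not> Bad a b a' b' \<Longrightarrow>
      dominated (k * (1 / \<eta>) ^ c) (minkowski (minkowski (F a) (F b)) (minkowski (F a') (F b'))) G"
    using assms(1) \<eta> unfolding equidistributed_def by meson
  have "dominated (16 * k * (1 / \<eta>) ^ c) (minkowski (minkowski (F' a) (F' b)) (minkowski (F' a') (F' b'))) G"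
    if "a \<in># I" "b \<in># I" "a' \<in># I" "b' \<in># I" "\<not> Bad a b a' b'" for a b a' b'
  proof -
    have "dominated ((2 * 2) * (2 * 2)) (minkowski (minkowski (F' a) (F' b)) (minkowski (F' a') (F' b')))
      (minkowski (minkowski (F a) (F b)) (minkowski (F a') (F b')))"
      by (intro dominated_minkowski assms(2) that) auto
    from dominated_trans[OF this Bad(2)[OF that]] assms(3) \<eta> show ?thesis by (simp add: mult.assoc)
  qed
  then show "\<exists>Bad. avg I (\<lambda>a. avg I (\<lambda>b. avg I (\<lambda>a'. avg I (\<lambda>b'. if Bad a b a' b' then 1 else (0::real))))) \<le> \<eta> \<and>
     (\<forall>a\<in>#I. \<forall>b\<in>#I. \<forall>a'\<in>#I. \<forall>b'\<in>#I. \<not> Bad a b a' b' \<longrightarrow>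
       dominated (16 * k * (1 / \<eta>) ^ c) (minkowski (minkowski (F' a) (F' b)) (minkowski (F' a') (F' b'))) G)"
    using Bad(1) by blast
qed

section \<open>Coefficients after the first variables are eliminated\<close>

lemma cube_Suc_upd: "cube (Suc k) = (\<lambda>w. w(k := 0)) ` cube k \<union> (\<lambda>w. w(k := 1)) ` cube k"
  unfolding cube_def lessThan_Suc PiE_insert_eq by (auto simp: image_iff)

lemma weight_upd: "weight (Suc k) (w(k := e)) = weight k w + e"
  by (simp add: weight_def)

lemma inj_upd: "inj_on (\<lambda>w. w(k := e)) (cube k)"
proof (rule inj_onI)
  fix w w' assume w: "w \<in> cube k" "w' \<in> cube k" "w(k := e) = w'(k := e)"
  have "w i = w' i" for i
    using w by (cases "i = k") (auto simp: cube_def PiE_iff extensional_def fun_upd_def dest: fun_cong[of _ _ i])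
  then show "w = w'" by auto
qed

text \<open>Pairing the two values of coordinate k exhibits the target of the k-th elimination: the
  constant and the linear coefficient in that variable each get a progression.\<close>

lemma minkowski_sum_cube_Suc:
  "minkowski_sum.F g (cube (Suc k)) = minkowski_sum.F (\<lambda>w. minkowski (g (w(k := 0))) (g (w(k := 1)))) (cube k)"
proof -
  have "minkowski_sum.F g (cube (Suc k))
    = minkowski (minkowski_sum.F g ((\<lambda>w. w(k := 0)) ` cube k)) (minkowski_sum.F g ((\<lambda>w. w(k := 1)) ` cube k))"
    unfolding cube_Suc_upd
  proof (rule minkowski_sum.union_disjoint)
    show "(\<lambda>w. w(k := 0)) ` cube k \<inter> (\<lambda>w. w(k := 1)) ` cube k = {}"
      by (auto dest!: fun_cong[of _ _ k])
  qed auto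
  then show ?thesis
    by (simp add: minkowski_sum.reindex[OF inj_upd] minkowski_sum.distrib comp_def)
qed

text \<open>The coefficient of \<open>\<Prod>i<k. h\<^sub>i ^ w\<^sub>i\<close> when the multilinear polynomial is regarded as a polynomial in
  \<open>h\<^sub>0, \<dots>, h\<^sub>k\<^sub>-\<^sub>1\<close>.\<close>

definition coef :: "nat \<Rightarrow> ((nat \<Rightarrow> nat) \<Rightarrow> vec) \<Rightarrow> nat \<Rightarrow> (nat \<Rightarrow> int) \<Rightarrow> (nat \<Rightarrow> nat) \<Rightarrow> vec" where
  "coef r \<gamma> k h w = (\<Sum>u\<in>{u \<in> cube r. \<forall>i<k. u i = w i}. vscale (\<Prod>i=k..<r. h i ^ u i) (\<gamma> u))"

lemma vscale_mult: "vscale (m * n) v = vscale m (vscale n v)"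
  by (simp add: vscale_def fun_eq_iff mult.assoc)

lemma vscale_sum: "vscale m (\<Sum>i\<in>I. g i) = (\<Sum>i\<in>I. vscale m (g i))"
  by (induction I rule: infinite_finite_induct) (auto simp: vscale_def fun_eq_iff algebra_simps)

lemma coef_split:
  assumes "k < r"
  shows "coef r \<gamma> k h w = coef r \<gamma> (Suc k) h (w(k := 0)) + vscale (h k) (coef r \<gamma> (Suc k) h (w(k := 1)))"
proof -
  define S where "S e = {u \<in> cube r. \<forall>i<Suc k. u i = (w(k := e)) i}" for e :: nat
  have un: "{u \<in> cube r. \<forall>i<k. u i = w i} = S 0 \<union> S 1"
  proof -
    have "u k = 0 \<or> u k = 1" if "u \<in> cube r" for u using cube_le_1[OF that assms] by auto
    then show ?thesis unfolding S_def by (auto simp: less_Suc_eq)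
  qed
  have pr: "(\<Prod>i=k..<r. h i ^ u i) = h k ^ u k * (\<Prod>i=Suc k..<r. h i ^ u i)" for u
    using assms by (simp add: prod.atLeast_Suc_lessThan)
  have "coef r \<gamma> k h w = (\<Sum>u\<in>S 0. vscale (h k ^ u k * (\<Prod>i=Suc k..<r. h i ^ u i)) (\<gamma> u))
      + (\<Sum>u\<in>S 1. vscale (h k ^ u k * (\<Prod>i=Suc k..<r. h i ^ u i)) (\<gamma> u))"
    unfolding coef_def un pr by (rule sum.union_disjoint) (auto simp: S_def)
  also have "(\<Sum>u\<in>S 0. vscale (h k ^ u k * (\<Prod>i=Suc k..<r. h i ^ u i)) (\<gamma> u)) = coef r \<gamma> (Suc k) h (w(k := 0))"
    unfolding coef_def S_def[symmetric] by (rule sum.cong) (auto simp: S_def)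
  also have "(\<Sum>u\<in>S 1. vscale (h k ^ u k * (\<Prod>i=Suc k..<r. h i ^ u i)) (\<gamma> u)) = vscale (h k) (coef r \<gamma> (Suc k) h (w(k := 1)))"
    unfolding coef_def S_def[symmetric] vscale_sum
    by (rule sum.cong) (auto simp: S_def vscale_mult[symmetric])
  finally show ?thesis .
qed

text \<open>Coefficients with respect to the first l variables depend on the later variables
  only.\<close>

lemma coef_upd: "k < l \<Longrightarrow> coef r \<gamma> l (h(k := x)) w = coef r \<gamma> l h w"
  unfolding coef_def by (intro sum.cong refl arg_cong2[where f = vscale] prod.cong) auto

lemma coef_0: "coef r \<gamma> 0 h w = multilin r \<gamma> h"
  by (simp add: coef_def multilin_def monomial_def atLeast0LessThan)

lemma coef_last:
  assumes "w \<in> cube r"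
  shows "coef r \<gamma> r h w = \<gamma> w"
proof -
  have "u = w" if "u \<in> cube r" "\<forall>i<r. u i = w i" for u
    using that assms unfolding cube_def by (intro PiE_ext[of u "{..<r}" "\<lambda>_. {0,1}" w]) auto
  then have "{u \<in> cube r. \<forall>i<r. u i = w i} = {w}" using assms by auto
  then show ?thesis by (simp add: coef_def)
qed

text \<open>Interpolates between C_j(h)\<sqdot>[-H, H] for k = 0 and E_j for k = r. Each eliminated
  variable occurring in the monomial lengthens the interval by a factor H.\<close>

definition partial :: "nat \<Rightarrow> nat \<Rightarrow> ((nat \<Rightarrow> nat) \<Rightarrow> vec) \<Rightarrow> nat \<Rightarrow> (nat \<Rightarrow> int) \<Rightarrow> vec multiset" where
  "partial r H \<gamma> k h = minkowski_sum.F (\<lambda>w. prog (coef r \<gamma> k h w) (pm (H ^ (weight k w + 1)))) (cube k)"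

lemma cube_0: "cube 0 = {\<lambda>_. undefined}"
  by (simp add: cube_def)

lemma partial_0: "partial r H \<gamma> 0 h = prog (multilin r \<gamma> h) (pm H)"
  by (simp add: partial_def cube_0 coef_0 weight_def)

lemma partial_last:
  "partial r H \<gamma> r h = minkowski_sum.F (\<lambda>u. prog (\<gamma> u) (pm (H ^ (weight r u + 1)))) (cube r)"
  unfolding partial_def by (rule minkowski_sum.cong) (simp_all add: coef_last)

lemma weight_le: "w \<in> cube k \<Longrightarrow> weight k w \<le> k"
  unfolding weight_def using sum_mono[of "{..<k}" w "\<lambda>_. 1"] cube_le_1 by simp

lemma equidistributed_partial:
  assumes "k < r" "H \<ge> 1"
  shows "equidistributed ((27 * 10 ^ (k + 2)) ^ 2 ^ k) ((k + 2) * 2 ^ k) (mset_set (pm H))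
    (\<lambda>x. partial r H \<gamma> k (h(k := x))) (partial r H \<gamma> (Suc k) h)"
proof -
  let ?v = "\<lambda>w. coef r \<gamma> (Suc k) h (w(k := 0))" and ?v' = "\<lambda>w. coef r \<gamma> (Suc k) h (w(k := 1))"
  have 1: "partial r H \<gamma> k (h(k := x))
      = minkowski_sum.F (\<lambda>w. prog (?v w + vscale x (?v' w)) (pm (H ^ (weight k w + 1)))) (cube k)" for x
    unfolding partial_def coef_split[OF assms(1)] by (simp add: coef_upd)
  have 2: "partial r H \<gamma> (Suc k) h
      = minkowski_sum.F (\<lambda>w. minkowski (prog (?v w) (pm (H ^ (weight k w + 1)))) (prog (?v' w) (pm (H * H ^ (weight k w + 1))))) (cube k)"
    unfolding partial_def minkowski_sum_cube_Suc weight_upd by simp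
  show ?thesis
    unfolding 1 2
    using equidistributed_progressions[OF assms(2) finite_cube[of k], of "\<lambda>w. weight k w + 1" "k + 1" ?v ?v'] weight_le
    by (simp add: algebra_simps)
qed

text \<open>Only the initial progressions have length M. Cutting them to length H costs a constant
  and is merged with the elimination of the first variable.\<close>

definition stage :: "nat \<Rightarrow> nat \<Rightarrow> nat \<Rightarrow> ((nat \<Rightarrow> nat) \<Rightarrow> vec) \<Rightarrow> nat \<Rightarrow> (nat \<Rightarrow> int) \<Rightarrow> vec multiset" where
  "stage r H M \<gamma> k h = (if k = 0 then prog (multilin r \<gamma> h) (pm M) else partial r H \<gamma> k h)"

lemma equidistributed_stage:
  assumes "k < r" "H \<ge> 1" "H \<le> M"
  shows "equidistributed (16 * (27 * 10 ^ (k + 2)) ^ 2 ^ k) ((k + 2) * 2 ^ k) (mset_set (pm H))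
    (\<lambda>x. stage r H M \<gamma> k (h(k := x))) (stage r H M \<gamma> (Suc k) h)"
proof -
  have "dominated 2 E E" for E :: "vec multiset"
    by (rule dominated_mono[OF dominated_refl]) simp
  then have "dominated 2 (stage r H M \<gamma> k h') (partial r H \<gamma> k h')" for h'
    using dominated_prog[OF assms(3)] by (simp add: stage_def partial_0)
  moreover have "stage r H M \<gamma> (Suc k) h = partial r H \<gamma> (Suc k) h" by (simp add: stage_def)
  ultimately show ?thesis
    using equidistributed_dominated[OF equidistributed_partial[OF assms(1,2)]] by simp
qed

lemma prog_nonempty [simp]: "prog v (pm L) \<noteq> {#}"
  by (simp add: prog_def mset_set_empty_iff pm_def)

lemma minkowski_sum_nonempty: "finite W \<Longrightarrow> (\<And>w. w \<in> W \<Longrightarrow> X w \<noteq> {#}) \<Longrightarrow> minkowski_sum.F X W \<noteq> {#}"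
  by (induction W rule: finite_induct) (auto simp: minkowski_nonempty)

lemma stage_nonempty: "stage r H M \<gamma> k h \<noteq> {#}"
proof -
  have "partial r H \<gamma> k h \<noteq> {#}"
    unfolding partial_def by (rule minkowski_sum_nonempty) (rule finite_cube, rule prog_nonempty)
  then show ?thesis by (simp add: stage_def)
qed

text \<open>Resampling coordinate k preserves the uniform distribution: exchanging x with h k is an
  involution on the pairs (h, x).\<close>

lemma avg_PiE_upd:
  fixes k r :: nat
  assumes "k < r" "finite S" "S \<noteq> {}"
  shows "avg (mset_set ({..<r} \<rightarrow>\<^sub>E S)) (\<lambda>h. avg (mset_set S) (\<lambda>x. \<Phi> (h(k := x))))
    = avg (mset_set ({..<r} \<rightarrow>\<^sub>E S)) \<Phi>"
proof -
  let ?P = "{..<r} \<rightarrow>\<^sub>E S"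
  have fin: "finite ?P" by (intro finite_PiE) (use assms in auto)
  have "(\<Sum>h\<in>?P. \<Sum>x\<in>S. \<Phi> (h(k := x))) = (\<Sum>(h, x)\<in>?P \<times> S. \<Phi> (h(k := x)))"
    by (simp add: sum.cartesian_product)
  also have "\<dots> = (\<Sum>(h, x)\<in>?P \<times> S. \<Phi> h)"
  proof (rule sum.reindex_bij_witness[where i = "\<lambda>(h, x). (h(k := x), h k)" and j = "\<lambda>(h, x). (h(k := x), h k)"])
    fix a assume "a \<in> ?P \<times> S"
    then obtain h x where a: "a = (h, x)" "h \<in> ?P" "x \<in> S" by auto
    have "h(k := x) \<in> ?P"
      using a assms(1) by (auto simp: PiE_iff extensional_def)
    moreover have "h k \<in> S" using a(2) assms(1) by auto
    ultimately show "(case a of (h, x) \<Rightarrow> (h(k := x), h k)) \<in> ?P \<times> S"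
      "(case a of (h, x) \<Rightarrow> (h(k := x), h k)) \<in> ?P \<times> S" by (simp_all add: a(1))
    show "(case case a of (h, x) \<Rightarrow> (h(k := x), h k) of (h, x) \<Rightarrow> (h(k := x), h k)) = a"
      "(case case a of (h, x) \<Rightarrow> (h(k := x), h k) of (h, x) \<Rightarrow> (h(k := x), h k)) = a"
      "(case case a of (h, x) \<Rightarrow> (h(k := x), h k) of (h, x) \<Rightarrow> \<Phi> h) = (case a of (h, x) \<Rightarrow> \<Phi> (h(k := x)))"
      by (simp_all add: a(1))
  qed
  also have "\<dots> = real (card S) *\<^sub>R (\<Sum>h\<in>?P. \<Phi> h)"
    by (simp add: sum.cartesian_product[symmetric] sum_constant_scaleR scaleR_sum_right)
  finally show ?thesis
    using assms by (simp add: avg_mset_set fin scaleR_sum_right[symmetric])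
qed

text \<open>The average runs over all r variables at every stage, though the summand becomes
  constant in those already treated; this keeps the index set fixed. The list js contains labels j,
  so the copies made by \<open>spread\<close> are tracked independently of h.\<close>

lemma all_stages:
  assumes "js \<noteq> []" "k \<le> r"
  shows "\<exists>P K. P \<ge> (1::nat) \<and> K \<ge> (0::real) \<and> (\<forall>T A f H M \<gamma>.
    admissible T A f \<longrightarrow> H \<ge> 1 \<longrightarrow> H \<le> M \<longrightarrow>
    (\<forall>j\<in>set js. \<forall>l\<in>{1..r}. \<forall>h\<in>{..<r} \<rightarrow>\<^sub>E pm H. fits T A (partial r H (\<gamma> j) l h)) \<longrightarrow>
    avg (mset_set ({..<r} \<rightarrow>\<^sub>E pm H)) (\<lambda>h. nbox T f (map (\<lambda>j. prog (multilin r (\<gamma> j) h) (pm M)) js)) ^ P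
      \<le> K * avg (mset_set ({..<r} \<rightarrow>\<^sub>E pm H)) (\<lambda>h. nbox T f (map (\<lambda>j. stage r H M (\<gamma> j) k h) ((spread ^^ k) js))))"
  using assms(2)
proof (induction k)
  case 0
  show ?case by (intro exI[of _ 1]) (simp add: stage_def)
next
  case (Suc k)
  then have kr: "k < r" "k \<le> r" by simp_all
  define js' where "js' = (spread ^^ k) js"
  have set_js': "set js' = set js" unfolding js'_def by (induction k) (simp_all add: set_spread)
  obtain P K where P: "P \<ge> 1" and K: "K \<ge> 0" and IH: "\<forall>T A f H M \<gamma>.
    admissible T A f \<longrightarrow> H \<ge> 1 \<longrightarrow> H \<le> M \<longrightarrow>
    (\<forall>j\<in>set js. \<forall>l\<in>{1..r}. \<forall>h\<in>{..<r} \<rightarrow>\<^sub>E pm H. fits T A (partial r H (\<gamma> j) l h)) \<longrightarrow>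
    avg (mset_set ({..<r} \<rightarrow>\<^sub>E pm H)) (\<lambda>h. nbox T f (map (\<lambda>j. prog (multilin r (\<gamma> j) h) (pm M)) js)) ^ P
      \<le> K * avg (mset_set ({..<r} \<rightarrow>\<^sub>E pm H)) (\<lambda>h. nbox T f (map (\<lambda>j. stage r H M (\<gamma> j) k h) js'))"
    using Suc.IH[OF kr(2)] unfolding js'_def by (elim exE conjE)
  define k0 :: real where "k0 = 16 * (27 * 10 ^ (k + 2)) ^ 2 ^ k"
  have k0: "k0 \<ge> 0" by (simp add: k0_def)
  obtain Q L where Q: "Q \<ge> 1" and L: "L \<ge> 0" and one: "\<forall>T A f (I :: int multiset) Zs Fs (Gs :: vec multiset list).
    admissible T A f \<longrightarrow> I \<noteq> {#} \<longrightarrow> length Fs = length js' \<longrightarrow> list_all2 (equidistributed k0 ((k + 2) * 2 ^ k) I) Fs Gs \<longrightarrow>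
    (\<forall>G\<in>set Gs. fits T A G) \<longrightarrow> (\<forall>F\<in>set Fs. \<forall>h\<in>#I. F h \<noteq> {#}) \<longrightarrow>
    avg I (\<lambda>h. nbox T f (Zs @ map (\<lambda>F. F h) Fs)) ^ Q \<le> L * nbox T f (Zs @ spread Gs)"
    using one_variable[OF k0, of "length js'" "(k + 2) * 2 ^ k"] by (elim exE conjE)
  note IH = IH[THEN spec, THEN spec, THEN spec, THEN spec, THEN spec, THEN spec, THEN mp, THEN mp, THEN mp, THEN mp]
  note one = one[THEN spec, THEN spec, THEN spec, THEN spec, THEN spec, THEN spec, THEN spec,
      THEN mp, THEN mp, THEN mp, THEN mp, THEN mp, THEN mp]
  have main: "avg (mset_set ({..<r} \<rightarrow>\<^sub>E pm H)) (\<lambda>h. nbox T f (map (\<lambda>j. prog (multilin r (\<gamma> j) h) (pm M)) js)) ^ (P * Q)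
      \<le> (K ^ Q * L) * avg (mset_set ({..<r} \<rightarrow>\<^sub>E pm H)) (\<lambda>h. nbox T f (map (\<lambda>j. stage r H M (\<gamma> j) (Suc k) h) ((spread ^^ Suc k) js)))"
    if adm: "admissible T A f" and H: "H \<ge> 1" "H \<le> M"
      and fit: "\<forall>j\<in>set js. \<forall>l\<in>{1..r}. \<forall>h\<in>{..<r} \<rightarrow>\<^sub>E pm H. fits T A (partial r H (\<gamma> j) l h)"
    for T A f H M \<gamma>
  proof -
    let ?\<Pi> = "{..<r} \<rightarrow>\<^sub>E pm H"
    have fin\<Pi>: "finite ?\<Pi>" by (intro finite_PiE) auto
    have ne: "js' \<noteq> []" using assms(1) set_js' by (metis set_empty)
    define \<Phi> where "\<Phi> h = nbox T f (map (\<lambda>j. stage r H M (\<gamma> j) k h) js')" for h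
    have \<Phi>: "\<Phi> h \<ge> 0" for h unfolding \<Phi>_def by (intro nbox_nonneg[OF adm]) (use ne in simp)
    have I: "mset_set (pm H) \<noteq> {#}" by (simp add: mset_set_empty_iff pm_def)
    \<comment> \<open>Resampling coordinate k produces an inner average over that variable alone, to
      which the one-variable bound applies for each fixed h.\<close>
    have "avg (mset_set ?\<Pi>) \<Phi> ^ Q = avg (mset_set ?\<Pi>) (\<lambda>h. avg (mset_set (pm H)) (\<lambda>x. \<Phi> (h(k := x)))) ^ Q"
      by (subst avg_PiE_upd[OF kr(1)]) (auto simp: pm_def)
    also have "\<dots> \<le> avg (mset_set ?\<Pi>) (\<lambda>h. avg (mset_set (pm H)) (\<lambda>x. \<Phi> (h(k := x))) ^ Q)"
      by (intro avg_power_le Q avg_nonneg \<Phi>)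
    also have "\<dots> \<le> avg (mset_set ?\<Pi>) (\<lambda>h. L * nbox T f (map (\<lambda>j. stage r H M (\<gamma> j) (Suc k) h) ((spread ^^ Suc k) js)))"
    proof (rule avg_mono)
      fix h assume "h \<in># mset_set ?\<Pi>"
      then have h: "h \<in> ?\<Pi>" using fin\<Pi> by simp
      have "avg (mset_set (pm H)) (\<lambda>x. nbox T f ([] @ map (\<lambda>F. F x) (map (\<lambda>j x. stage r H M (\<gamma> j) k (h(k := x))) js'))) ^ Q
         \<le> L * nbox T f ([] @ spread (map (\<lambda>j. stage r H M (\<gamma> j) (Suc k) h) js'))"
      proof (rule one[OF adm I])
        show "list_all2 (equidistributed k0 ((k + 2) * 2 ^ k) (mset_set (pm H)))
          (map (\<lambda>j x. stage r H M (\<gamma> j) k (h(k := x))) js') (map (\<lambda>j. stage r H M (\<gamma> j) (Suc k) h) js')"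
          unfolding list.rel_map k0_def
          by (rule list.rel_refl_strong) (rule equidistributed_stage[OF kr(1) H])
        show "\<forall>G\<in>set (map (\<lambda>j. stage r H M (\<gamma> j) (Suc k) h) js'). fits T A G"
          using fit h kr(1) by (auto simp: set_js' stage_def)
        show "\<forall>F\<in>set (map (\<lambda>j x. stage r H M (\<gamma> j) k (h(k := x))) js'). \<forall>x\<in>#mset_set (pm H). F x \<noteq> {#}"
          by (simp add: stage_nonempty)
      qed simp
      then show "avg (mset_set (pm H)) (\<lambda>x. \<Phi> (h(k := x))) ^ Q
        \<le> L * nbox T f (map (\<lambda>j. stage r H M (\<gamma> j) (Suc k) h) ((spread ^^ Suc k) js))"
        by (simp add: \<Phi>_def spread_map js'_def comp_def)
    qed
    finally have "avg (mset_set ?\<Pi>) \<Phi> ^ Q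
      \<le> L * avg (mset_set ?\<Pi>) (\<lambda>h. nbox T f (map (\<lambda>j. stage r H M (\<gamma> j) (Suc k) h) ((spread ^^ Suc k) js)))"
      by (simp only: avg_mult_left)
    moreover have "avg (mset_set ?\<Pi>) (\<lambda>h. nbox T f (map (\<lambda>j. prog (multilin r (\<gamma> j) h) (pm M)) js)) ^ P
      \<le> K * avg (mset_set ?\<Pi>) \<Phi>"
      unfolding \<Phi>_def by (rule IH[OF adm H fit])
    ultimately show ?thesis
      by (intro power_chain[OF _ _ _ K]) (use assms(1) in \<open>auto intro!: avg_nonneg nbox_nonneg[OF adm]\<close>)
  qed
  have "P * Q \<ge> 1" using P Q by (simp add: Suc_le_eq)
  moreover have "K ^ Q * L \<ge> 0" using K L by simp
  ultimately show ?case
    by (intro exI[of _ "P * Q"] exI[of _ "K ^ Q * L"] conjI allI impI) (assumption | rule main)+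
qed

section \<open>Size of the directions\<close>

lemma card_zvec_le:
  assumes "finite J"
  shows "card {z \<in> zvec D. \<forall>k<D. z k \<in> J} \<le> card J ^ D" "finite {z \<in> zvec D. \<forall>k<D. z k \<in> J}"
proof -
  let ?S = "{z \<in> zvec D. \<forall>k<D. z k \<in> J}"
  have sub: "?S \<subseteq> (\<lambda>g k. if k < D then g k else 0) ` ({..<D} \<rightarrow>\<^sub>E J)"
  proof
    fix z assume z: "z \<in> ?S"
    have "z = (\<lambda>k. if k < D then restrict z {..<D} k else 0)"
      using z by (auto simp: zvec_def fun_eq_iff)
    moreover have "restrict z {..<D} \<in> {..<D} \<rightarrow>\<^sub>E J" using z by auto
    ultimately show "z \<in> (\<lambda>g k. if k < D then g k else 0) ` ({..<D} \<rightarrow>\<^sub>E J)" by blast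
  qed
  have fin: "finite ({..<D} \<rightarrow>\<^sub>E J)" by (intro finite_PiE) (use assms in auto)
  then show "finite ?S" using sub finite_subset by blast
  have "card ?S \<le> card ({..<D} \<rightarrow>\<^sub>E J)"
    by (rule order_trans[OF card_mono[OF _ sub] card_image_le]) (use fin in auto)
  then show "card ?S \<le> card J ^ D" by (simp add: card_PiE)
qed

lemma minkowski_sum_bound:
  fixes b :: int
  assumes "finite W" "\<And>w x. w \<in> W \<Longrightarrow> x \<in># X w \<Longrightarrow> x \<in> zvec D \<and> (\<forall>k<D. \<bar>x k\<bar> \<le> b)"
    "e \<in># minkowski_sum.F X W"
  shows "e \<in> zvec D \<and> (\<forall>k<D. \<bar>e k\<bar> \<le> int (card W) * b)"
  using assms
proof (induction W arbitrary: e rule: finite_induct)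
  case (insert w W)
  obtain x y where xy: "e = x + y" "x \<in># X w" "y \<in># minkowski_sum.F X W"
    using insert.prems(2) insert.hyps by (auto simp: set_minkowski)
  have x: "x \<in> zvec D" "\<And>k. k < D \<Longrightarrow> \<bar>x k\<bar> \<le> b" using insert.prems(1) xy(2) by auto
  have y: "y \<in> zvec D" "\<And>k. k < D \<Longrightarrow> \<bar>y k\<bar> \<le> int (card W) * b" using insert.IH[OF _ xy(3)] insert.prems(1) by auto
  have "\<bar>x k + y k\<bar> \<le> (1 + int (card W)) * b" if "k < D" for k
    using x(2)[OF that] y(2)[OF that] by (simp add: algebra_simps)
  moreover have "int (card (insert w W)) = 1 + int (card W)" using insert.hyps by simp
  ultimately have "\<bar>(x + y) k\<bar> \<le> int (card (insert w W)) * b" if "k < D" for k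
    using that by (simp only: plus_fun_apply)
  then show ?case unfolding xy(1) by (intro conjI allI impI zvec_add[OF x(1) y(1)])
qed simp

text \<open>For each monomial u, eliminated variables enter through the interval length and the
  others through their values, in total at most H^(|u|+1) V \<le> H^d M V \<le> N. One factor 2^r
  counts the monomials in a coefficient, the other the progressions in the sum.\<close>

lemma partial_bound:
  assumes \<gamma>: "\<forall>u\<in>cube r. \<gamma> u \<in> zvec D" "\<forall>u\<in>cube r. weight r u > d \<longrightarrow> \<gamma> u = 0" "\<forall>u\<in>cube r. \<forall>k<D. \<bar>\<gamma> u k\<bar> \<le> int V"
    and H: "H \<ge> 1" "H \<le> M" "H ^ d * M * V \<le> N" and l: "l \<le> r" and h: "h \<in> {..<r} \<rightarrow>\<^sub>E pm H"
    and e: "e \<in># partial r H \<gamma> l h"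
  shows "e \<in> zvec D \<and> (\<forall>k<D. \<bar>e k\<bar> \<le> int (4 ^ r * N))"
proof -
  have "x \<in> zvec D \<and> (\<forall>k<D. \<bar>x k\<bar> \<le> int (2 ^ r * N))"
    if w: "w \<in> cube l" and x: "x \<in># prog (coef r \<gamma> l h w) (pm (H ^ (weight l w + 1)))" for w x
  proof -
    obtain n where n: "\<bar>n\<bar> \<le> int (H ^ (weight l w + 1))" "x = vscale n (coef r \<gamma> l h w)"
      using x by (auto simp: prog_def mem_pm)
    define U where "U = {u \<in> cube r. \<forall>i<l. u i = w i}"
    have U: "finite U" "card U \<le> 2 ^ r"
      using card_mono[of "cube r" U] by (auto simp: U_def)
    have "x \<in> zvec D" unfolding n(2) coef_def using \<gamma>(1) by (intro zvec_vscale zvec_sum) auto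
    moreover have "\<bar>x k\<bar> \<le> int (2 ^ r * N)" if k: "k < D" for k
    proof -
      have fun_sum: "(\<Sum>u\<in>S. g u) k = (\<Sum>u\<in>S. g u k)" for g :: "(nat \<Rightarrow> nat) \<Rightarrow> vec" and S
        by (induction S rule: infinite_finite_induct) auto
      have "x k = (\<Sum>u\<in>U. n * (\<Prod>i=l..<r. h i ^ u i) * \<gamma> u k)"
        by (simp add: n(2) coef_def U_def[symmetric] vscale_def fun_sum sum_distrib_left mult.assoc)
      also have "\<bar>\<dots>\<bar> \<le> (\<Sum>u\<in>U. \<bar>n * (\<Prod>i=l..<r. h i ^ u i) * \<gamma> u k\<bar>)" by (rule sum_abs)
      also have "\<dots> \<le> (\<Sum>u\<in>U. int N)"
      proof (rule sum_mono)
        fix u assume "u \<in> U"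
        then have u: "u \<in> cube r" "\<And>i. i < l \<Longrightarrow> u i = w i" by (auto simp: U_def)
        show "\<bar>n * (\<Prod>i=l..<r. h i ^ u i) * \<gamma> u k\<bar> \<le> int N"
        proof (cases "weight r u > d")
          case True
          then have "\<gamma> u k = 0" using \<gamma>(2) u(1) by (simp add: zero_fun_def)
          then show ?thesis by simp
        next
          case False
          have "\<bar>\<Prod>i=l..<r. h i ^ u i\<bar> = (\<Prod>i=l..<r. \<bar>h i\<bar> ^ u i)"
            by (simp add: abs_prod power_abs)
          also have "\<dots> \<le> (\<Prod>i=l..<r. int H ^ u i)"
            using h by (intro prod_mono conjI power_mono) (auto simp: mem_pm PiE_iff)
          also have "\<dots> = int H ^ (\<Sum>i=l..<r. u i)" by (rule power_sum[symmetric])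
          finally have p: "\<bar>\<Prod>i=l..<r. h i ^ u i\<bar> \<le> int H ^ (\<Sum>i=l..<r. u i)" .
          have wt: "weight l w + (\<Sum>i=l..<r. u i) = weight r u"
          proof -
            have "weight l w = (\<Sum>i<l. u i)" unfolding weight_def using u(2) by simp
            then show ?thesis unfolding weight_def using l
              by (simp add: atLeast0LessThan[symmetric] sum.atLeastLessThan_concat)
          qed
          have "\<bar>n * (\<Prod>i=l..<r. h i ^ u i) * \<gamma> u k\<bar>
              \<le> int (H ^ (weight l w + 1)) * int H ^ (\<Sum>i=l..<r. u i) * int V"
            unfolding abs_mult using n(1) p \<gamma>(3) u(1) k by (intro mult_mono) auto
          also have "\<dots> = int (H ^ (weight r u) * H * V)"
            by (simp add: wt[symmetric] power_add)
          also have "\<dots> \<le> int (H ^ d * M * V)"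
            using False H by (simp only: of_nat_le_iff) (intro mult_le_mono power_increasing, auto)
          also have "\<dots> \<le> int N" using H(3) by (simp only: of_nat_le_iff)
          finally show ?thesis .
        qed
      qed
      also have "\<dots> = int (card U) * int N" by simp
      also have "\<dots> \<le> int (2 ^ r) * int N" using U(2) by (intro mult_right_mono) (simp_all only: of_nat_le_iff of_nat_0_le_iff)
      finally show ?thesis by simp
    qed
    ultimately show ?thesis by blast
  qed
  from minkowski_sum_bound[OF finite_cube this e[unfolded partial_def]]
  have 1: "e \<in> zvec D" "\<And>k. k < D \<Longrightarrow> \<bar>e k\<bar> \<le> int (2 ^ l) * int (2 ^ r * N)" by auto
  have "(2::nat) ^ l * (2 ^ r * N) \<le> 2 ^ r * (2 ^ r * N)"
    using l by (intro mult_le_mono power_increasing) auto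
  also have "\<dots> = 4 ^ r * N" by (simp add: power_mult_distrib[symmetric] mult.assoc[symmetric])
  finally have "int (2 ^ l) * int (2 ^ r * N) \<le> int (4 ^ r * N)" by (simp only: of_nat_mult[symmetric] of_nat_le_iff)
  then show ?thesis using 1 by fastforce
qed

text \<open>A - E lies in the cube of radius (R+1) N, and 2 (R+1) N + 1 \<le> (2R+3) N.\<close>

lemma fits_of_bound:
  assumes A: "A \<subseteq> {x \<in> zvec D. \<forall>k<D. 1 \<le> x k \<and> x k \<le> int N}" and N: "N \<ge> 1" and E: "E \<noteq> {#}"
    "\<And>e. e \<in># E \<Longrightarrow> e \<in> zvec D \<and> (\<forall>k<D. \<bar>e k\<bar> \<le> int (R * N))"
  shows "fits ((real (2 * R + 3) * real N) ^ D) A E"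
proof -
  have "thick A E \<subseteq> {z \<in> zvec D. \<forall>k<D. z k \<in> pm ((R + 1) * N)}"
  proof
    fix z assume "z \<in> thick A E"
    then obtain e where e: "e \<in># E" "z + e \<in> A" by (auto simp: thick_def)
    have ze: "z + e \<in> zvec D" "\<And>k. k < D \<Longrightarrow> 1 \<le> z k + e k \<and> z k + e k \<le> int N" using A e(2) by auto
    have "z \<in> zvec D" using zvec_diff[OF ze(1), of e] E(2)[OF e(1)] by simp
    moreover have "z k \<in> pm ((R + 1) * N)" if "k < D" for k
    proof -
      have "\<bar>e k\<bar> \<le> int (R * N)" "1 \<le> z k + e k" "z k + e k \<le> int N" using E(2)[OF e(1)] ze(2) that by auto
      then show ?thesis by (simp add: mem_pm algebra_simps)
    qed
    ultimately show "z \<in> {z \<in> zvec D. \<forall>k<D. z k \<in> pm ((R + 1) * N)}" by simp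
  qed
  then have "card (thick A E) \<le> card {z \<in> zvec D. \<forall>k<D. z k \<in> pm ((R + 1) * N)}"
    by (rule card_mono[OF card_zvec_le(2)[OF finite_pm]])
  also have "\<dots> \<le> (2 * ((R + 1) * N) + 1) ^ D" using card_zvec_le(1)[of "pm ((R + 1) * N)" D] by simp
  also have "\<dots> \<le> ((2 * R + 3) * N) ^ D" using N by (intro power_mono) (simp_all add: algebra_simps)
  finally have "real (card (thick A E)) \<le> real (((2 * R + 3) * N) ^ D)" by (simp only: of_nat_le_iff)
  then show ?thesis using E(1) by (simp add: fits_def)
qed

theorem theorem1p10:
  fixes r s :: nat
  assumes "r \<ge> 1" and "s \<ge> 1"
  shows "\<exists>t::nat. t \<ge> 1 \<and> (\<exists>C' c' :: real. C' > 0 \<and> c' > 0 \<and>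
    (\<forall>D::nat. D \<ge> 1 \<longrightarrow> (\<exists>C c :: real. C > 0 \<and> c > 0 \<and>
      (\<forall>(d::nat) (H::nat) (M::nat) (N::nat) (V::nat) (\<delta>::real)
         (\<gamma> :: nat \<Rightarrow> (nat \<Rightarrow> nat) \<Rightarrow> vec) (f :: vec \<Rightarrow> complex).
        d \<ge> 1 \<and> H \<ge> 1 \<and> M \<ge> 1 \<and> N \<ge> 1 \<and> V \<ge> 1 \<and> \<delta> > 0 \<and>
        d \<le> r \<and> C * \<delta> powr (- C') \<le> real H \<and> H \<le> M \<and> H ^ d * M * V \<le> N \<and>
        (\<forall>j<s. \<forall>u\<in>cube r. \<gamma> j u \<in> zvec D) \<and>
        (\<forall>j<s. \<forall>u\<in>cube r. weight r u > d \<longrightarrow> \<gamma> j u = 0) \<and>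
        (\<forall>j<s. \<forall>u\<in>cube r. \<forall>k<D. \<bar>\<gamma> j u k\<bar> \<le> int V) \<and>
        (\<forall>x\<in>zvec D. cmod (f x) \<le> 1) \<and>
        (\<forall>x\<in>zvec D. f x \<noteq> 0 \<longrightarrow> (\<forall>k<D. 1 \<le> x k \<and> x k \<le> int N)) \<and>
        (\<Sum>h\<in>{..<r} \<rightarrow>\<^sub>E pm H.
            boxpow D (map (\<lambda>j. prog (multilin r (\<gamma> j) h) (pm M)) [0..<s]) f)
          / real (card ({..<r} \<rightarrow>\<^sub>E pm H)) \<ge> \<delta> * real N ^ D
        \<longrightarrow>
        boxpow D
          (concat (map (\<lambda>j. replicate t
             (minkowski_sum.F (\<lambda>u. prog (\<gamma> j u) (pm (H ^ (weight r u + 1)))) (cube r)))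
           [0..<s])) f
          \<ge> c * \<delta> powr c' * real N ^ D))))"
proof -
  define js where "js = (spread ^^ r) [0..<s]"
  have js_ne: "[0..<s] \<noteq> []" using assms(2) by simp
  have set_js: "set js = {0..<s}" unfolding js_def by (induction r) (simp_all add: set_spread)
  obtain P K where P: "P \<ge> 1" and K: "K \<ge> 0" and stages: "\<forall>T A f H M \<gamma>.
    admissible T A f \<longrightarrow> H \<ge> 1 \<longrightarrow> H \<le> M \<longrightarrow>
    (\<forall>j\<in>set [0..<s]. \<forall>l\<in>{1..r}. \<forall>h\<in>{..<r} \<rightarrow>\<^sub>E pm H. fits T A (partial r H (\<gamma> j) l h)) \<longrightarrow>
    avg (mset_set ({..<r} \<rightarrow>\<^sub>E pm H)) (\<lambda>h. nbox T f (map (\<lambda>j. prog (multilin r (\<gamma> j) h) (pm M)) [0..<s])) ^ P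
      \<le> K * avg (mset_set ({..<r} \<rightarrow>\<^sub>E pm H)) (\<lambda>h. nbox T f (map (\<lambda>j. stage r H M (\<gamma> j) r h) js))"
    using all_stages[OF js_ne order_refl, of r] unfolding js_def by (elim exE conjE)
  note stages = stages[THEN spec, THEN spec, THEN spec, THEN spec, THEN spec, THEN spec, THEN mp, THEN mp, THEN mp, THEN mp]
  \<comment> \<open>No label occurs in js more often than its length, so with this t the list can be
    padded by some \<open>ws\<close> to exactly t copies of every label. It depends on r and s
    only.\<close>
  define t where "t = length js"
  define targets where "targets = concat (map (replicate t) [0..<s])"
  have t1: "t \<ge> 1" unfolding t_def using set_js assms(2) by (cases js) auto
  have count_targets: "count (mset targets) j = (if j < s then t else 0)" for j
    unfolding targets_def by (induction s) auto
  have "mset js \<subseteq># mset targets"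
  proof (rule mset_subset_eqI)
    fix j
    show "count (mset js) j \<le> count (mset targets) j"
      using set_js count_le_length[of js j] unfolding count_targets
      by (cases "j < s") (auto simp: t_def count_mset not_in_iff[symmetric] count_list_0_iff)
  qed
  then obtain ws where ws: "mset targets = mset (ws @ js)"
    by (metis ex_mset mset_append subset_mset.le_iff_add add.commute)
  have set_ws: "set ws \<subseteq> {..<s}"
  proof -
    have "set ws \<subseteq> set targets" using ws by (metis mset_eq_setD set_append sup_ge1)
    then show ?thesis by (auto simp: targets_def)
  qed
  define p where "p = P * 2 ^ length ws"
  \<comment> \<open>The summand 1 makes K' positive, since it becomes a denominator.\<close>
  define K' where "K' = K ^ 2 ^ length ws + 1"
  have K': "K' > 0" using K by (simp add: K'_def add_nonneg_pos)
  have p1: "p \<ge> 1" using P by (simp add: p_def Suc_le_eq)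
  define R where "R = (4::nat) ^ r"
  have bound: "boxpow D (concat (map (\<lambda>j. replicate t
             (minkowski_sum.F (\<lambda>u. prog (\<gamma> j u) (pm (H ^ (weight r u + 1)))) (cube r))) [0..<s])) f
      \<ge> ((1 / real (2 * R + 3) ^ D) ^ p / K') * \<delta> powr real p * real N ^ D"
    if D: "D \<ge> 1" and pos: "H \<ge> 1" "N \<ge> 1" "\<delta> > 0" and HM: "H \<le> M" "H ^ d * M * V \<le> N"
      and \<gamma>: "\<forall>j<s. \<forall>u\<in>cube r. \<gamma> j u \<in> zvec D" "\<forall>j<s. \<forall>u\<in>cube r. weight r u > d \<longrightarrow> \<gamma> j u = 0"
        "\<forall>j<s. \<forall>u\<in>cube r. \<forall>k<D. \<bar>\<gamma> j u k\<bar> \<le> int V"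
      and f: "\<forall>x\<in>zvec D. cmod (f x) \<le> 1" "\<forall>x\<in>zvec D. f x \<noteq> 0 \<longrightarrow> (\<forall>k<D. 1 \<le> x k \<and> x k \<le> int N)"
      and large: "(\<Sum>h\<in>{..<r} \<rightarrow>\<^sub>E pm H. boxpow D (map (\<lambda>j. prog (multilin r (\<gamma> j) h) (pm M)) [0..<s]) f)
          / real (card ({..<r} \<rightarrow>\<^sub>E pm H)) \<ge> \<delta> * real N ^ D"
    for D d H M N V :: nat and \<delta> :: real and \<gamma> :: "nat \<Rightarrow> (nat \<Rightarrow> nat) \<Rightarrow> vec" and f :: "vec \<Rightarrow> complex"
  proof -
    define f' where "f' = (\<lambda>x. if x \<in> zvec D then f x else 0)"
    define A where "A = {x \<in> zvec D. \<forall>k<D. 1 \<le> x k \<and> x k \<le> int N}"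
    \<comment> \<open>The bound of \<open>fits_of_bound\<close> for [N]^D enlarged by any direction.
      The ratio T / N^D is the sole source of D in the constants, so p is independent of D.\<close>
    define T where "T = (real (2 * R + 3) * real N) ^ D"
    define E where "E j = minkowski_sum.F (\<lambda>u. prog (\<gamma> j u) (pm (H ^ (weight r u + 1)))) (cube r)" for j
    let ?\<Pi> = "{..<r} \<rightarrow>\<^sub>E pm H"
    have fin\<Pi>: "finite ?\<Pi>" by (intro finite_PiE) auto
    have T0: "T > 0" unfolding T_def using pos by (intro zero_less_power mult_pos_pos) auto
    have NT: "real N ^ D \<le> T" unfolding T_def using pos by (intro power_mono) auto
    have A: "finite A" "real (card A) \<le> real N ^ D"
    proof -
      have A': "A = {x \<in> zvec D. \<forall>k<D. x k \<in> {1..int N}}" by (auto simp: A_def)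
      show "finite A" unfolding A' by (rule card_zvec_le) simp
      have "card A \<le> N ^ D" unfolding A' using card_zvec_le(1)[of "{1..int N}" D] by simp
      then show "real (card A) \<le> real N ^ D" by (metis of_nat_le_iff of_nat_power)
    qed
    have supp: "{x. f' x \<noteq> 0} \<subseteq> A" using f(2) by (auto simp: f'_def A_def)
    have finsupp: "finsupp f'" using supp A(1) finite_subset by blast
    have "real (card {x. f' x \<noteq> 0}) \<le> T"
      using card_mono[OF A(1) supp] A(2) NT by linarith
    then have adm: "admissible T A f'"
      using T0 finsupp A(1) supp f(1) by (auto simp: admissible_def one_bounded_def f'_def)
    have pb: "e \<in> zvec D \<and> (\<forall>k<D. \<bar>e k\<bar> \<le> int (R * N))"
      if "j < s" "l \<le> r" "h \<in> ?\<Pi>" "e \<in># partial r H (\<gamma> j) l h" for j l h e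
      unfolding R_def by (rule partial_bound[OF _ _ _ pos(1) HM that(2,3,4)]) (use \<gamma> that(1) in auto)
    have fits: "fits T A (partial r H (\<gamma> j) l h)" if "j < s" "l \<in> {1..r}" "h \<in> ?\<Pi>" for j l h
    proof -
      have "partial r H (\<gamma> j) l h \<noteq> {#}" using stage_nonempty[of r H M "\<gamma> j" l h] that(2) by (simp add: stage_def)
      then show ?thesis
        unfolding T_def by (intro fits_of_bound pb[of j l h]) (use that pos in \<open>auto simp: A_def\<close>)
    qed
    \<comment> \<open>After r eliminations the direction no longer depends on h, so its properties
      can be read off at any one point.\<close>
    define h0 where "h0 = (\<lambda>i\<in>{..<r}. 0::int)"
    have h0: "h0 \<in> ?\<Pi>" by (auto simp: h0_def mem_pm)
    have E_partial: "partial r H (\<gamma> j) r h = E j" for j h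
      unfolding E_def by (rule partial_last)
    have fitsE: "fits T A (E j)" if "j < s" for j
      using fits[OF that _ h0, of r] assms(1) by (simp add: E_partial)
    have zvecE: "e \<in> zvec D" if "j < s" "e \<in># E j" for j e
      using pb[OF that(1) order_refl h0, of e] that(2) by (simp add: E_partial)
    have start: "boxpow D (map (\<lambda>j. prog (multilin r (\<gamma> j) h) (pm M)) [0..<s]) f
        = T * nbox T f' (map (\<lambda>j. prog (multilin r (\<gamma> j) h) (pm M)) [0..<s])" for h
    proof -
      have "multilin r (\<gamma> j) h \<in> zvec D" if "j < s" for j
        unfolding multilin_def using \<gamma>(1) that by (intro zvec_sum zvec_vscale) auto
      then have "boxpow D (map (\<lambda>j. prog (multilin r (\<gamma> j) h) (pm M)) [0..<s]) f
          = rbox (map (\<lambda>j. prog (multilin r (\<gamma> j) h) (pm M)) [0..<s]) f'"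
        unfolding f'_def by (intro boxpow_eq_rbox finsupp[unfolded f'_def]) (auto simp: prog_def intro!: zvec_vscale)
      then show ?thesis using T0 by (simp add: nbox_def)
    qed
    define \<alpha> where "\<alpha> = avg (mset_set ?\<Pi>) (\<lambda>h. nbox T f' (map (\<lambda>j. prog (multilin r (\<gamma> j) h) (pm M)) [0..<s]))"
    have "\<delta> * real N ^ D \<le> T * \<alpha>"
      using large unfolding start
      by (simp add: \<alpha>_def avg_mset_set[OF fin\<Pi>] sum_distrib_left[symmetric] divide_inverse mult_ac)
    then have "\<delta> * real N ^ D \<le> (\<alpha> * real (2 * R + 3) ^ D) * real N ^ D"
      unfolding T_def power_mult_distrib by (simp only: mult_ac)
    then have "\<delta> \<le> \<alpha> * real (2 * R + 3) ^ D"
      by (rule mult_right_le_imp_le) (use pos in simp)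
    then have "\<delta> / real (2 * R + 3) ^ D \<le> \<alpha>"
      by (subst pos_divide_le_eq) simp_all
    then have "(\<delta> / real (2 * R + 3) ^ D) ^ p \<le> \<alpha> ^ p"
      using pos by (intro power_mono) auto
    also have "\<alpha> ^ p \<le> (K ^ 2 ^ length ws * 1) * nbox T f' (map E ws @ map E js)"
      unfolding p_def
    proof (rule power_chain[OF _ _ _ K])
      have "\<alpha> ^ P \<le> K * avg (mset_set ?\<Pi>) (\<lambda>h. nbox T f' (map (\<lambda>j. stage r H M (\<gamma> j) r h) js))"
        unfolding \<alpha>_def by (rule stages[OF adm pos(1) HM(1)]) (use fits in auto)
      also have "avg (mset_set ?\<Pi>) (\<lambda>h. nbox T f' (map (\<lambda>j. stage r H M (\<gamma> j) r h) js)) = nbox T f' (map E js)"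
      proof -
        have "mset_set ?\<Pi> \<noteq> {#}" using h0 fin\<Pi> by (metis elem_mset_set empty_iff set_mset_empty)
        moreover have "stage r H M (\<gamma> j) r h = E j" for j h using assms(1) by (simp add: stage_def E_partial)
        ultimately show ?thesis by (simp add: avg_const)
      qed
      finally show "\<alpha> ^ P \<le> K * nbox T f' (map E js)" .
      \<comment> \<open>Padding adds one direction per label in \<open>ws\<close>, and each of them
        squares the lower bound.\<close>
      have "nbox T f' (map E js) ^ (2 ^ length (map E ws)) \<le> nbox T f' (map E ws @ map E js)"
        by (rule nbox_add_directions[OF adm]) (use set_ws fitsE t1 in \<open>auto simp: t_def\<close>)
      then show "nbox T f' (map E js) ^ 2 ^ length ws \<le> 1 * nbox T f' (map E ws @ map E js)" by simp
      show "\<alpha> \<ge> 0" unfolding \<alpha>_def by (intro avg_nonneg nbox_nonneg[OF adm]) (use assms(2) in auto)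
    qed
    also have "nbox T f' (map E ws @ map E js) = nbox T f' (map E targets)"
      by (rule nbox_perm) (simp add: ws)
    also have "(K ^ 2 ^ length ws * 1) * nbox T f' (map E targets) \<le> K' * nbox T f' (map E targets)"
    proof (rule mult_right_mono)
      have "targets \<noteq> []" using ws t1 by (auto simp: t_def)
      then show "nbox T f' (map E targets) \<ge> 0" by (intro nbox_nonneg[OF adm]) simp
    qed (simp add: K'_def)
    finally have main: "(\<delta> / real (2 * R + 3) ^ D) ^ p / K' \<le> nbox T f' (map E targets)"
      using K' by (simp add: field_simps)
    have "((1 / real (2 * R + 3) ^ D) ^ p / K') * \<delta> powr real p * real N ^ D
        = (\<delta> / real (2 * R + 3) ^ D) ^ p / K' * real N ^ D"
      using pos by (simp add: powr_realpow power_divide)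
    also have "\<dots> \<le> (\<delta> / real (2 * R + 3) ^ D) ^ p / K' * T"
      using pos K' by (intro mult_left_mono NT) auto
    also have "\<dots> \<le> nbox T f' (map E targets) * T"
      using T0 by (intro mult_right_mono main) simp
    also have "\<dots> = rbox (map E targets) f'" using T0 by (simp add: nbox_def)
    also have "\<dots> = boxpow D (map E targets) f"
      unfolding f'_def
      by (intro boxpow_eq_rbox[symmetric] finsupp[unfolded f'_def]) (auto simp: targets_def intro: zvecE)
    also have "map E targets = concat (map (\<lambda>j. replicate t (E j)) [0..<s])"
      by (simp add: targets_def map_concat comp_def)
    finally show ?thesis unfolding E_def .
  qed
  show ?thesis
  proof (rule exI[of _ t], rule conjI[OF t1], rule exI[of _ 1], rule exI[of _ "real p"], intro conjI allI impI)
    fix D :: nat assume D: "D \<ge> 1"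
    show "\<exists>C c :: real. C > 0 \<and> c > 0 \<and>
      (\<forall>(d::nat) (H::nat) (M::nat) (N::nat) (V::nat) (\<delta>::real)
         (\<gamma> :: nat \<Rightarrow> (nat \<Rightarrow> nat) \<Rightarrow> vec) (f :: vec \<Rightarrow> complex).
        d \<ge> 1 \<and> H \<ge> 1 \<and> M \<ge> 1 \<and> N \<ge> 1 \<and> V \<ge> 1 \<and> \<delta> > 0 \<and>
        d \<le> r \<and> C * \<delta> powr (- 1) \<le> real H \<and> H \<le> M \<and> H ^ d * M * V \<le> N \<and>
        (\<forall>j<s. \<forall>u\<in>cube r. \<gamma> j u \<in> zvec D) \<and>
        (\<forall>j<s. \<forall>u\<in>cube r. weight r u > d \<longrightarrow> \<gamma> j u = 0) \<and>
        (\<forall>j<s. \<forall>u\<in>cube r. \<forall>k<D. \<bar>\<gamma> j u k\<bar> \<le> int V) \<and>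
        (\<forall>x\<in>zvec D. cmod (f x) \<le> 1) \<and>
        (\<forall>x\<in>zvec D. f x \<noteq> 0 \<longrightarrow> (\<forall>k<D. 1 \<le> x k \<and> x k \<le> int N)) \<and>
        (\<Sum>h\<in>{..<r} \<rightarrow>\<^sub>E pm H.
            boxpow D (map (\<lambda>j. prog (multilin r (\<gamma> j) h) (pm M)) [0..<s]) f)
          / real (card ({..<r} \<rightarrow>\<^sub>E pm H)) \<ge> \<delta> * real N ^ D
        \<longrightarrow>
        boxpow D
          (concat (map (\<lambda>j. replicate t
             (minkowski_sum.F (\<lambda>u. prog (\<gamma> j u) (pm (H ^ (weight r u + 1)))) (cube r)))
           [0..<s])) f
          \<ge> c * \<delta> powr real p * real N ^ D)"
    proof (rule exI[of _ 1], rule exI[of _ "(1 / real (2 * R + 3) ^ D) ^ p / K'"], intro conjI allI impI)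
      show "(1 / real (2 * R + 3) ^ D) ^ p / K' > 0" using K' by simp
    qed (simp, elim conjE, rule bound[OF D])
  qed (use p1 in auto)
qed

end
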